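(* Let $T$ be a trinity with sets of red, emerald and violet points $R$, $E$, $V$. The arborescence number $\rho(T)$ associated to the trinity is also the number of hypertrees in any of the six hypergraphs $(V,E)$, $(E,V)$, $(R,E)$, $(E,R)$, $(R,V)$, $(V,R)$ contained in the trinity.
   Context: A trinity is a triangulation of the sphere $S^2$ (multiple edges allowed) together with a three-coloring of the $0$-simplices (points) by red, emerald and violet, such that points joined by a $1$-simplex (edge) have different colors. $R$, $E$, $V$ are the sets of red, emerald, violet points. Each edge gets the color not occurring among its ends. The red graph $G_R$ is the plane bipartite graph with color classes $E$ and $V$ and the red edges; the emerald graph $G_E$ has color classes $R,V$ and the emerald edges; the violet graph $G_V$ has color classes $R,E$ and the violet edges. Each region of $G_R$ contains exactly one red point, and similarly for the other colors. Each of these bipartite graphs, with color classes $A,B$, induces two hypergraphs: $(A,B)$ with vertex set $A$ and hyperedges indexed by $B$ (each $b\in B$ being the set of its neighbors in $A$), and $(B,A)$. The resulting six hypergraphs are said to be contained in the trinity. A hypertree in the hypergraph $(A,B)$ is a function $f\colon B\to\mathbf N=\{0,1,2,\ldots\}$ such that some spanning tree of the bipartite graph with color classes $A,B$ has degree $f(b)+1$ at each $b\in B$. Each triangle has exactly one point and one edge of each color. Triangles are colored black or white according to the cyclic order of the colors around them relative to the orientation of the sphere; triangles sharing an edge have opposite colors. The planar dual $G_R^*$ has vertex set $R$ and one directed edge for each red edge, from the red point of the black triangle adjacent to that red edge to the red point of the white triangle adjacent to it. $G_E^*$ and $G_V^*$ are defined analogously. These directed graphs are balanced (in-degree equals out-degree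 at each vertex). A spanning arborescence of a directed graph with root $r$ is a spanning tree in which the unique path from $r$ to any other vertex is oriented toward that vertex. For a finite balanced directed graph $D$ the number of spanning arborescences does not depend on the root; it is the arborescence number $\rho(D)$. By Tutte's Tree Trinity Theorem $\rho(G_R^* )=\rho(G_E^* )=\rho(G_V^* )$, and this common value is $\rho(T)$, the arborescence number of the trinity. *)

theory Defs
  imports "HOL-Analysis.Analysis" "Graph_Theory.Arc_Walk"
begin

section \<open>Undirected multigraphs, spanning trees and arborescences\<close>

text \<open>
  Directed multigraphs are the records of type \<^typ>\<open>('v,'e) pre_digraph\<close>. The predicate
  \<open>spanning_tree\<close> of the theory \<open>Digraph_Component\<close> only forbids \<^emph>\<open>directed\<close> cycles, so it is not
  the notion needed here, and trees are defined via undirected walks.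
\<close>

record ('v, 'e) multigraph =
  gverts :: "'v set"
  gedges :: "'e set"
  gends  :: "'e \<Rightarrow> 'v set"

text \<open>A walk starting at \<open>u\<close> is the list of the edges traversed, each with the vertex it leads to.\<close>

fun walk :: "('e \<Rightarrow> 'v set) \<Rightarrow> 'e set \<Rightarrow> 'v \<Rightarrow> ('e \<times> 'v) list \<Rightarrow> 'v \<Rightarrow> bool" where
  "walk ends F u [] v \<longleftrightarrow> u = v"
| "walk ends F u ((e, w) # xs) v \<longleftrightarrow> e \<in> F \<and> ends e = {u, w} \<and> walk ends F w xs v"

definition simple_walk :: "('e \<Rightarrow> 'v set) \<Rightarrow> 'e set \<Rightarrow> 'v \<Rightarrow> ('e \<times> 'v) list \<Rightarrow> 'v \<Rightarrow> bool" where
  "simple_walk ends F u xs v \<longleftrightarrow> walk ends F u xs v \<and> distinct (u # map snd xs)"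

text \<open>Loops and pairs of parallel edges count as cycles.\<close>

definition is_cycle :: "('e \<Rightarrow> 'v set) \<Rightarrow> 'e set \<Rightarrow> 'v \<Rightarrow> ('e \<times> 'v) list \<Rightarrow> bool" where
  "is_cycle ends F u xs \<longleftrightarrow>
     xs \<noteq> [] \<and> walk ends F u xs u \<and> distinct (map fst xs) \<and> distinct (map snd xs)"

definition is_spanning_tree :: "('v, 'e) multigraph \<Rightarrow> 'e set \<Rightarrow> bool" where
  "is_spanning_tree G F \<longleftrightarrow>
     gverts G \<noteq> {} \<and> F \<subseteq> gedges G \<and>
     (\<forall>u\<in>gverts G. \<forall>v\<in>gverts G. \<exists>xs. simple_walk (gends G) F u xs v) \<and>
     (\<nexists>u xs. is_cycle (gends G) F u xs)"

definition degree_in :: "('v, 'e) multigraph \<Rightarrow> 'e set \<Rightarrow> 'v \<Rightarrow> nat" where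
  "degree_in G F v = card {e \<in> F. v \<in> gends G e}"

definition underlying :: "('v, 'e) pre_digraph \<Rightarrow> ('v, 'e) multigraph" where
  "underlying D = \<lparr> gverts = verts D, gedges = arcs D, gends = (\<lambda>e. {tail D e, head D e}) \<rparr>"

definition spanning_arborescences :: "('v, 'e) pre_digraph \<Rightarrow> 'v \<Rightarrow> 'e set set" where
  "spanning_arborescences D r =
     {F. is_spanning_tree (underlying D) F \<and>
         (\<forall>v\<in>verts D. \<forall>xs. simple_walk (gends (underlying D)) F r xs v \<longrightarrow>
                            pre_digraph.awalk D r (map fst xs) v)}"

text \<open>Meaningful only for digraphs in which the number does not depend on the root.\<close>

definition arborescence_number :: "('v, 'e) pre_digraph \<Rightarrow> nat" where
  "arborescence_number D = (THE n. \<forall>r\<in>verts D. card (spanning_arborescences D r) = n)"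

section \<open>Hypergraphs and hypertrees\<close>

text \<open>Hyperedges are indexed, so that different hyperedges may have the same elements.\<close>

record ('v, 'i) hypergraph =
  hverts :: "'v set"
  hedges :: "'i set"
  hinc   :: "'i \<Rightarrow> 'v set"

definition bip :: "('v, 'i) hypergraph \<Rightarrow> ('v + 'i, 'v \<times> 'i) multigraph" where
  "bip H = \<lparr> gverts = Inl ` hverts H \<union> Inr ` hedges H,
             gedges = {(a, b). a \<in> hverts H \<and> b \<in> hedges H \<and> a \<in> hinc H b},
             gends = (\<lambda>(a, b). {Inl a, Inr b}) \<rparr>"

definition hypertrees :: "('v, 'i) hypergraph \<Rightarrow> ('i \<Rightarrow> nat) set" where
  "hypertrees H =
     {f \<in> hedges H \<rightarrow>\<^sub>E UNIV.
        \<exists>F. is_spanning_tree (bip H) F \<and> (\<forall>b\<in>hedges H. degree_in (bip H) F (Inr b) = f b + 1)}"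

text \<open>The hypergraph \<open>(A, B)\<close> induced by a bipartite graph with color classes \<open>A\<close>, \<open>B\<close>.\<close>

definition induced_hypergraph :: "('v, 'e) multigraph \<Rightarrow> 'v set \<Rightarrow> 'v set \<Rightarrow> ('v, 'v) hypergraph" where
  "induced_hypergraph G A B =
     \<lparr> hverts = A, hedges = B, hinc = (\<lambda>b. {a \<in> A. \<exists>e\<in>gedges G. gends G e = {a, b}}) \<rparr>"

section \<open>Trinities\<close>

datatype color = Red | Emerald | Violet

type_synonym point = "real ^ 3"

text \<open>
  Edges and triangles are closed subsets of the sphere. The last component is an orientation of the
  sphere, given in the usual way for a triangulated surface: each triangle \<open>t\<close> carries a cyclic order
  of its vertices, encoded as the set \<open>orient t = {(a,b), (b,c), (c,a)}\<close> of its directed sides.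
\<close>

record trinity =
  points    :: "point set"
  edges     :: "point set set"
  triangles :: "point set set"
  col       :: "point \<Rightarrow> color"
  orient    :: "point set \<Rightarrow> (point \<times> point) set"

text \<open>
  Distinct edges may have the same ends, and distinct triangles the same vertices, or two or even all
  three edges in common. Closed edges and closed triangles are embedded; this is no restriction,
  because in a trinity the ends of an edge have different colors and hence so do the
  vertices and the edges of a triangle.
\<close>

definition sphere_edge :: "point set \<Rightarrow> point set \<Rightarrow> bool" where
  "sphere_edge P e \<longleftrightarrow> e \<subseteq> sphere 0 1 \<and>
     (\<exists>g. arc g \<and> path_image g = e \<and> P \<inter> e = {pathstart g, pathfinish g})"

definition sphere_triangle :: "point set \<Rightarrow> point set set \<Rightarrow> point set \<Rightarrow> bool" where
  "sphere_triangle P E t \<longleftrightarrow> t \<subseteq> sphere 0 1 \<and>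
     (\<exists>(a::real^2) b c h k.
        \<not> collinear {a, b, c} \<and> homeomorphism (convex hull {a, b, c}) t h k \<and>
        P \<inter> t = h ` {a, b, c} \<and>
        {h ` closed_segment a b, h ` closed_segment b c, h ` closed_segment c a} \<subseteq> E \<and>
        \<Union>E \<inter> t = h ` (closed_segment a b \<union> closed_segment b c \<union> closed_segment c a))"

definition sphere_triangulation :: "point set \<Rightarrow> point set set \<Rightarrow> point set set \<Rightarrow> bool" where
  "sphere_triangulation P E F \<longleftrightarrow>
     finite P \<and> finite E \<and> finite F \<and>
     P \<subseteq> sphere 0 1 \<and> (\<forall>e\<in>E. sphere_edge P e) \<and> (\<forall>t\<in>F. sphere_triangle P E t) \<and>
     (\<forall>e\<in>E. \<forall>e'\<in>E. e \<noteq> e' \<longrightarrow> e \<inter> e' \<subseteq> P) \<and>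
     (\<forall>t\<in>F. \<forall>t'\<in>F. t \<noteq> t' \<longrightarrow> t \<inter> t' \<subseteq> \<Union>E) \<and>
     \<Union>F = sphere 0 1"

definition ends :: "trinity \<Rightarrow> point set \<Rightarrow> point set" where
  "ends T e = points T \<inter> e"

text \<open>Coherence: two triangles induce opposite directions on each edge that they share.\<close>

definition is_orientation :: "trinity \<Rightarrow> bool" where
  "is_orientation T \<longleftrightarrow>
     (\<forall>t\<in>triangles T. \<exists>a b c. distinct [a, b, c] \<and> points T \<inter> t = {a, b, c} \<and>
        orient T t = {(a, b), (b, c), (c, a)}) \<and>
     (\<forall>e\<in>edges T. \<forall>t\<in>triangles T. \<forall>t'\<in>triangles T. t \<noteq> t' \<and> e \<subseteq> t \<and> e \<subseteq> t' \<longrightarrow>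
        (\<forall>a b. ends T e = {a, b} \<longrightarrow> ((a, b) \<in> orient T t \<longleftrightarrow> (b, a) \<in> orient T t')))"

definition is_trinity :: "trinity \<Rightarrow> bool" where
  "is_trinity T \<longleftrightarrow>
     sphere_triangulation (points T) (edges T) (triangles T) \<and>
     (\<forall>e\<in>edges T. inj_on (col T) (ends T e)) \<and>
     is_orientation T"

definition color_class :: "trinity \<Rightarrow> color \<Rightarrow> point set" where
  "color_class T c = {p \<in> points T. col T p = c}"

text \<open>The color of an edge is the one not occurring among its ends.\<close>

definition colored_edges :: "trinity \<Rightarrow> color \<Rightarrow> point set set" where
  "colored_edges T c = {e \<in> edges T. c \<notin> col T ` ends T e}"

definition color_graph :: "trinity \<Rightarrow> color \<Rightarrow> (point, point set) multigraph" where
  "color_graph T c =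
     \<lparr> gverts = {p \<in> points T. col T p \<noteq> c}, gedges = colored_edges T c, gends = ends T \<rparr>"

definition black :: "trinity \<Rightarrow> point set \<Rightarrow> bool" where
  "black T t \<longleftrightarrow> (\<exists>r e v. col T r = Red \<and> col T e = Emerald \<and> col T v = Violet \<and>
     orient T t = {(r, e), (e, v), (v, r)})"

definition white :: "trinity \<Rightarrow> point set \<Rightarrow> bool" where
  "white T t \<longleftrightarrow> (\<exists>r e v. col T r = Red \<and> col T e = Emerald \<and> col T v = Violet \<and>
     orient T t = {(r, v), (v, e), (e, r)})"

definition dual_digraph :: "trinity \<Rightarrow> color \<Rightarrow> (point, point set) pre_digraph" where
  "dual_digraph T c =
     \<lparr> verts = color_class T c, arcs = colored_edges T c,
       tail = (\<lambda>e. THE p. p \<in> color_class T c \<and>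
                 (\<exists>t\<in>triangles T. black T t \<and> e \<subseteq> t \<and> p \<in> t)),
       head = (\<lambda>e. THE p. p \<in> color_class T c \<and>
                 (\<exists>t\<in>triangles T. white T t \<and> e \<subseteq> t \<and> p \<in> t)) \<rparr>"

text \<open>The common value of the three arborescence numbers (Tutte's Tree Trinity Theorem).\<close>

definition trinity_arborescence_number :: "trinity \<Rightarrow> nat" where
  "trinity_arborescence_number T = (THE n. \<forall>c. arborescence_number (dual_digraph T c) = n)"

end

(* Write the triangulation as a set of white and a set of black triangles with three bijections
   between them, one for crossing the edges of each color; sphericity enters as the vanishing of
   first cohomology and the connectedness of vertex links, so that circulations in a dual graph and
   flows in a color graph are potential differences.

   Fix a root r0 among the a-points. A hypertree is the occurrence vector of the b-points in a choice
   of one white triangle at each other a-point, and such a choice is the same thing as a set of edges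
   of the dual with one edge entering each a-point except r0. The choices with a given occurrence
   vector are ordered by the potentials of their differences, and exactly one of them, the lowest, is
   free of directed cycles, hence an arborescence: a cycle can be reversed to lower the potential,
   while a potential difference of two arborescences attains its maximum at the root. So the
   arborescence number of the dual counts the hypertrees with hyperedges of either of the other two
   colors. Complements of spanning trees are dual spanning trees, and on the occurrence vectors
   passing to the complement is f |-> degree - 1 - f, which compares the three color graphs. *)

theory Submission
  imports Defs
begin

section \<open>Spherical maps and their potentials\<close>

text \<open>Reversing a directed cycle lowers the normalised potential only if the root lies on the
  upper side of the cycle. The opposite case has to be impossible, and this is where a hypertree
  must be more than the occurrence vector of one choice: the upper b-points would already receive
  the selected triangle of every a-point adjacent to them, which contradicts a Hall inequality that
  is strict for hypertrees. Strictness comes from asking for a choice for every root, since a root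
  adjacent to the given b-points drops out of the count. Hypertrees are therefore recast in this
  form (\<open>profiles\<close>) before they are compared with arborescences. The form also suits
  the complement of a tree, whose dual tree can be directed away from any root.\<close>

lemma cyclic_coboundary:
  fixes d :: "'t \<Rightarrow> int"
  assumes fin: "finite S" and bij: "bij_betw \<sigma> S S"
    and trans: "\<And>x y. x \<in> S \<Longrightarrow> y \<in> S \<Longrightarrow> (x, y) \<in> {(x, \<sigma> x) | x. x \<in> S}\<^sup>*"
    and sum0: "sum d S = 0"
  shows "\<exists>T. \<forall>x\<in>S. T x - T (\<sigma> x) = d x"
proof (cases "S = {}")
  case False
  then obtain s where s: "s \<in> S" by blast
  have pow_in: "(\<sigma> ^^ n) s \<in> S" for n
    by (induction n) (use s bij in \<open>auto simp: bij_betw_def\<close>)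
  have reach: "\<exists>n. (\<sigma> ^^ n) s = x" if "x \<in> S" for x
  proof -
    have "(s, x) \<in> {(x, \<sigma> x) | x. x \<in> S}\<^sup>*" using trans s that by blast
    then show ?thesis
    proof induction
      case base show ?case by (rule exI[of _ 0]) simp
    next
      case (step y z)
      then obtain n where "(\<sigma> ^^ n) s = y" by blast
      with step show ?case by (intro exI[of _ "Suc n"]) auto
    qed
  qed
  define N where "N x = (LEAST n. (\<sigma> ^^ n) s = x)" for x
  have N: "(\<sigma> ^^ N x) s = x" if "x \<in> S" for x
    unfolding N_def using reach[OF that] by (rule LeastI_ex)
  have N_le: "N x \<le> n" if "(\<sigma> ^^ n) s = x" for x n
    unfolding N_def using that by (rule Least_le)
  \<comment> \<open>Summation of \<open>d\<close> along the orbit of \<open>s\<close>, stopped at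
    the first visit \<open>N x\<close>. The required identity is then clear except where the orbit
    closes up, and there it says that the total of \<open>d\<close> vanishes.\<close>
  define T where "T x = - (\<Sum>i<N x. d ((\<sigma> ^^ i) s))" for x
  have "T x - T (\<sigma> x) = d x" if x: "x \<in> S" for x
  proof -
    have sx: "\<sigma> x \<in> S" using bij x by (auto simp: bij_betw_def)
    have le: "N (\<sigma> x) \<le> Suc (N x)" by (rule N_le) (simp add: N x)
    show ?thesis
    proof (cases "N (\<sigma> x) = Suc (N x)")
      case True
      then show ?thesis using N[OF x] by (simp add: T_def)
    next
      case lt: False
      \<comment> \<open>Here \<open>\<sigma> x\<close> was visited before time
        \<open>Suc (N x)\<close>. By injectivity a positive first visit would put \<open>x\<close>
        at a time earlier than \<open>N x\<close>, so the orbit has returned to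
        \<open>s\<close>.\<close>
      have N0: "N (\<sigma> x) = 0"
      proof (rule ccontr)
        assume "N (\<sigma> x) \<noteq> 0"
        then obtain k where k: "N (\<sigma> x) = Suc k" by (cases "N (\<sigma> x)") auto
        have "\<sigma> ((\<sigma> ^^ k) s) = \<sigma> x" using N[OF sx] k by simp
        then have "(\<sigma> ^^ k) s = x" using bij pow_in x by (auto simp: bij_betw_def inj_on_def)
        then have "N x \<le> k" by (rule N_le)
        then show False using le lt k by simp
      qed
      then have sxs: "\<sigma> x = s" using N[OF sx] by simp
      have img: "S = (\<lambda>i. (\<sigma> ^^ i) s) ` {..N x}"
      proof (rule equalityI)
        show "(\<lambda>i. (\<sigma> ^^ i) s) ` {..N x} \<subseteq> S" using pow_in by auto
        have closed: "\<sigma> y \<in> (\<lambda>i. (\<sigma> ^^ i) s) ` {..N x}" if y: "y \<in> (\<lambda>i. (\<sigma> ^^ i) s) ` {..N x}" for y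
        proof -
          obtain i where i: "i \<le> N x" "y = (\<sigma> ^^ i) s" using y by auto
          show ?thesis
          proof (cases "i = N x")
            case True
            then have "\<sigma> y = (\<sigma> ^^ 0) s" using i N[OF x] sxs by simp
            then show ?thesis by blast
          next
            case False
            then show ?thesis using i by (intro image_eqI[of _ _ "Suc i"]) auto
          qed
        qed
        have "(\<sigma> ^^ n) s \<in> (\<lambda>i. (\<sigma> ^^ i) s) ` {..N x}" for n
        proof (induction n)
          case 0
          have "(\<lambda>i. (\<sigma> ^^ i) s) 0 \<in> (\<lambda>i. (\<sigma> ^^ i) s) ` {..N x}" by (rule imageI) simp
          then show ?case by simp
        next
          case (Suc n) then show ?case using closed by simp
        qed
        then show "S \<subseteq> (\<lambda>i. (\<sigma> ^^ i) s) ` {..N x}" using reach by fastforce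
      qed
      have inj: "inj_on (\<lambda>i. (\<sigma> ^^ i) s) {..N x}"
      proof (rule linorder_inj_onI')
        fix i j assume ij: "i \<in> {..N x}" "j \<in> {..N x}" "i < j"
        show "(\<sigma> ^^ i) s \<noteq> (\<sigma> ^^ j) s"
        proof
          assume eq: "(\<sigma> ^^ i) s = (\<sigma> ^^ j) s"
          have "(\<sigma> ^^ (N x - j + i)) s = (\<sigma> ^^ (N x - j + j)) s"
            unfolding funpow_add o_apply eq ..
          also have "\<dots> = x" using ij N[OF x] by simp
          finally have "N x \<le> N x - j + i" by (rule N_le)
          then show False using ij by auto
        qed
      qed
      have "(\<Sum>i\<le>N x. d ((\<sigma> ^^ i) s)) = sum d S"
        unfolding img by (subst sum.reindex[OF inj]) simp
      then have "(\<Sum>i<N x. d ((\<sigma> ^^ i) s)) + d x = 0"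
        using sum0 N[OF x] by (simp add: lessThan_Suc_atMost[symmetric])
      then show ?thesis using N0 by (simp add: T_def)
    qed
  qed
  then show ?thesis by blast
qed simp

text \<open>\<open>W\<close> and \<open>Bl\<close> are the sets of white and black triangles, \<open>a\<close>, \<open>b\<close>, \<open>c\<close> give the points of a triangle, and
  \<open>\<alpha>\<close>, \<open>\<beta>\<close>, \<open>\<gamma>\<close> cross the edge opposite to the respective point. A white triangle also stands for each of
  its edges: \<open>w\<close> is the edge of \<open>G\<^sub>a\<close> with ends \<open>b w\<close>, \<open>c w\<close> and the arc of \<open>G\<^sub>a\<^sup>*\<close> from \<open>a (\<alpha> w)\<close> to \<open>a w\<close>.\<close>

locale sphere_map =
  fixes W Bl :: "'t set" and a b c :: "'t \<Rightarrow> 'p" and \<alpha> \<beta> \<gamma> :: "'t \<Rightarrow> 't"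
  assumes finite_W: "finite W" and W_nonempty: "W \<noteq> {}" and W_Bl: "W \<inter> Bl = {}"
    and bij_\<alpha>: "bij_betw \<alpha> W Bl" and bij_\<beta>: "bij_betw \<beta> W Bl" and bij_\<gamma>: "bij_betw \<gamma> W Bl"
    and b_\<alpha>: "w \<in> W \<Longrightarrow> b (\<alpha> w) = b w" and c_\<alpha>: "w \<in> W \<Longrightarrow> c (\<alpha> w) = c w"
    and a_\<beta>: "w \<in> W \<Longrightarrow> a (\<beta> w) = a w" and c_\<beta>: "w \<in> W \<Longrightarrow> c (\<beta> w) = c w"
    and a_\<gamma>: "w \<in> W \<Longrightarrow> a (\<gamma> w) = a w" and b_\<gamma>: "w \<in> W \<Longrightarrow> b (\<gamma> w) = b w"
    and link_a: "\<lbrakk>w \<in> W; w' \<in> W; a w = a w'\<rbrakk> \<Longrightarrow> (w, w') \<in> {(x, y). x \<in> W \<and> y \<in> W \<and> \<gamma> x = \<beta> y}\<^sup>*"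
    and link_b: "\<lbrakk>w \<in> W; w' \<in> W; b w = b w'\<rbrakk> \<Longrightarrow> (w, w') \<in> {(x, y). x \<in> W \<and> y \<in> W \<and> \<alpha> x = \<gamma> y}\<^sup>*"
    and link_c: "\<lbrakk>w \<in> W; w' \<in> W; c w = c w'\<rbrakk> \<Longrightarrow> (w, w') \<in> {(x, y). x \<in> W \<and> y \<in> W \<and> \<beta> x = \<alpha> y}\<^sup>*"
    and conn: "\<lbrakk>w \<in> W; w' \<in> W\<rbrakk> \<Longrightarrow>
       (w, w') \<in> {(x, y). x \<in> W \<and> y \<in> W \<and> (a x = a y \<or> b x = b y \<or> c x = c y)}\<^sup>*"
    and cohom: "\<lbrakk>\<And>w. w \<in> W \<Longrightarrow> f w - g w = f (\<gamma> w) - g (\<gamma> w);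
                \<And>w. w \<in> W \<Longrightarrow> g w - h w = g (\<alpha> w) - h (\<alpha> w);
                \<And>w. w \<in> W \<Longrightarrow> h w - f w = h (\<beta> w) - f (\<beta> w)\<rbrakk> \<Longrightarrow>
       \<exists>u :: 'p \<Rightarrow> int. \<forall>w\<in>W. u (a w) - u (b w) = f w - g w \<and> u (b w) - u (c w) = g w - h w"
begin

text \<open>Exchanging two colors reverses the cyclic order of the triangles round every point, so
  each link relation turns into a converse. Together with the rotation this makes every later lemma
  available for all six orders of the colors.\<close>

lemma sphere_map_swap: "sphere_map W Bl b a c \<beta> \<alpha> \<gamma>"
proof -
  have conv: "(w, w') \<in> {(x, y). x \<in> W \<and> y \<in> W \<and> p x = q y}\<^sup>*"
    if "(w', w) \<in> {(x, y). x \<in> W \<and> y \<in> W \<and> q x = p y}\<^sup>*" for w w' and p q :: "'t \<Rightarrow> 't"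
  proof -
    have "{(x, y). x \<in> W \<and> y \<in> W \<and> p x = q y} = {(x, y). x \<in> W \<and> y \<in> W \<and> q x = p y}\<inverse>" by auto
    then show ?thesis using that by (simp add: rtrancl_converse)
  qed
  show ?thesis
  proof
    fix w w' assume w: "w \<in> W" "w' \<in> W"
    show "(w, w') \<in> {(x, y). x \<in> W \<and> y \<in> W \<and> \<gamma> x = \<alpha> y}\<^sup>*" if "b w = b w'"
      using w that by (intro conv[OF link_b]) auto
    show "(w, w') \<in> {(x, y). x \<in> W \<and> y \<in> W \<and> \<beta> x = \<gamma> y}\<^sup>*" if "a w = a w'"
      using w that by (intro conv[OF link_a]) auto
    show "(w, w') \<in> {(x, y). x \<in> W \<and> y \<in> W \<and> \<alpha> x = \<beta> y}\<^sup>*" if "c w = c w'"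
      using w that by (intro conv[OF link_c]) auto
    have "{(x, y). x \<in> W \<and> y \<in> W \<and> (b x = b y \<or> a x = a y \<or> c x = c y)} =
      {(x, y). x \<in> W \<and> y \<in> W \<and> (a x = a y \<or> b x = b y \<or> c x = c y)}" by auto
    then show "(w, w') \<in> {(x, y). x \<in> W \<and> y \<in> W \<and> (b x = b y \<or> a x = a y \<or> c x = c y)}\<^sup>*"
      using conn[OF w] by simp
  next
    fix f g h :: "'t \<Rightarrow> int"
    assume fg: "\<And>w. w \<in> W \<Longrightarrow> f w - g w = f (\<gamma> w) - g (\<gamma> w)"
      and gh: "\<And>w. w \<in> W \<Longrightarrow> g w - h w = g (\<beta> w) - h (\<beta> w)"
      and hf: "\<And>w. w \<in> W \<Longrightarrow> h w - f w = h (\<alpha> w) - f (\<alpha> w)"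
    have "\<exists>u :: 'p \<Rightarrow> int. \<forall>w\<in>W. u (a w) - u (b w) = g w - f w \<and> u (b w) - u (c w) = f w - h w"
    proof (rule cohom)
      show "g w - f w = g (\<gamma> w) - f (\<gamma> w)" if "w \<in> W" for w using fg[OF that] by simp
      show "f w - h w = f (\<alpha> w) - h (\<alpha> w)" if "w \<in> W" for w using hf[OF that] by simp
      show "h w - g w = h (\<beta> w) - g (\<beta> w)" if "w \<in> W" for w using gh[OF that] by simp
    qed
    then obtain u :: "'p \<Rightarrow> int" where u: "\<forall>w\<in>W. u (a w) - u (b w) = g w - f w \<and> u (b w) - u (c w) = f w - h w"
      by blast
    show "\<exists>u :: 'p \<Rightarrow> int. \<forall>w\<in>W. u (b w) - u (a w) = f w - g w \<and> u (a w) - u (c w) = g w - h w"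
      by (rule exI[of _ u]) (use u in force)
  qed (simp_all add: finite_W W_nonempty W_Bl bij_\<alpha> bij_\<beta> bij_\<gamma> a_\<beta> c_\<beta> b_\<alpha> c_\<alpha> b_\<gamma> a_\<gamma>)
qed

lemma sphere_map_rotate: "sphere_map W Bl b c a \<beta> \<gamma> \<alpha>"
proof
  fix w w' assume w: "w \<in> W" "w' \<in> W"
  have "{(x, y). x \<in> W \<and> y \<in> W \<and> (b x = b y \<or> c x = c y \<or> a x = a y)} =
    {(x, y). x \<in> W \<and> y \<in> W \<and> (a x = a y \<or> b x = b y \<or> c x = c y)}" by auto
  then show "(w, w') \<in> {(x, y). x \<in> W \<and> y \<in> W \<and> (b x = b y \<or> c x = c y \<or> a x = a y)}\<^sup>*"
    using conn[OF w] by simp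
next
  fix f g h :: "'t \<Rightarrow> int"
  assume *: "\<And>w. w \<in> W \<Longrightarrow> f w - g w = f (\<alpha> w) - g (\<alpha> w)"
    "\<And>w. w \<in> W \<Longrightarrow> g w - h w = g (\<beta> w) - h (\<beta> w)"
    "\<And>w. w \<in> W \<Longrightarrow> h w - f w = h (\<gamma> w) - f (\<gamma> w)"
  then obtain u :: "'p \<Rightarrow> int" where u: "\<forall>w\<in>W. u (a w) - u (b w) = h w - f w \<and> u (b w) - u (c w) = f w - g w"
    using cohom[of h f g] by blast
  show "\<exists>u :: 'p \<Rightarrow> int. \<forall>w\<in>W. u (b w) - u (c w) = f w - g w \<and> u (c w) - u (a w) = g w - h w"
    by (rule exI[of _ u]) (use u in force)
qed (simp_all add: finite_W W_nonempty W_Bl bij_\<alpha> bij_\<beta> bij_\<gamma> a_\<beta> c_\<beta> b_\<alpha> c_\<alpha> b_\<gamma> a_\<gamma> link_a link_b link_c)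

section \<open>Summation round a point; flows and circulations as potential differences\<close>

lemma bij_transfer:
  assumes "bij_betw p W Bl" "bij_betw q W Bl"
  obtains s where "bij_betw s W W" "\<And>w w'. w \<in> W \<Longrightarrow> w' \<in> W \<Longrightarrow> p w = q w' \<longleftrightarrow> w' = s w"
proof
  show "bij_betw (inv_into W q \<circ> p) W W"
    using assms by (meson bij_betw_inv_into bij_betw_trans)
  show "p w = q w' \<longleftrightarrow> w' = (inv_into W q \<circ> p) w" if "w \<in> W" "w' \<in> W" for w w'
    using assms that by (auto simp: bij_betw_inv_into_left bij_betw_inv_into_right bij_betw_apply)
qed

text \<open>Crossing first the \<gamma>-edge and then the \<beta>-edge permutes the white triangles
  at each a-point in one cycle, so \<open>cyclic_coboundary\<close> applies to each a-point
  separately.\<close>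

lemma link_coboundary_a:
  fixes d :: "'t \<Rightarrow> int"
  assumes sum0: "\<And>r. sum d {w \<in> W. a w = r} = 0"
  shows "\<exists>T. \<forall>w\<in>W. \<forall>w'\<in>W. \<gamma> w = \<beta> w' \<longrightarrow> T w - T w' = d w"
proof -
  obtain s where s: "bij_betw s W W" "\<And>w w'. w \<in> W \<Longrightarrow> w' \<in> W \<Longrightarrow> \<gamma> w = \<beta> w' \<longleftrightarrow> w' = s w"
    using bij_transfer[OF bij_\<gamma> bij_\<beta>] by blast
  have sW: "s w \<in> W" if "w \<in> W" for w using s(1) that by (auto simp: bij_betw_def)
  have as: "a (s w) = a w" if "w \<in> W" for w
    using s(2)[OF that sW[OF that]] a_\<gamma>[OF that] a_\<beta>[OF sW[OF that]] by simp
  have "\<exists>T. \<forall>w\<in>{w \<in> W. a w = r}. T w - T (s w) = d w" for r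
  proof (rule cyclic_coboundary)
    let ?S = "{w \<in> W. a w = r}"
    show "finite ?S" using finite_W by simp
    have "inj_on s ?S" using s(1) by (auto simp: bij_betw_def inj_on_def)
    moreover have "s ` ?S \<subseteq> ?S" using sW as by auto
    ultimately show "bij_betw s ?S ?S"
      using endo_inj_surj[OF \<open>finite ?S\<close>] unfolding bij_betw_def by blast
    show "sum d ?S = 0" by (rule sum0)
    fix x y assume xy: "x \<in> ?S" "y \<in> ?S"
    then have "(x, y) \<in> {(x, y). x \<in> W \<and> y \<in> W \<and> \<gamma> x = \<beta> y}\<^sup>*" by (intro link_a) auto
    then have "a y = a x \<and> (x, y) \<in> {(x, s x) | x. x \<in> ?S}\<^sup>*"
    proof induction
      case (step y z)
      then have "z = s y" "y \<in> ?S" using s(2) xy by auto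
      then show ?case using step as by (auto intro: rtrancl_into_rtrancl)
    qed simp
    then show "(x, y) \<in> {(x, s x) | x. x \<in> ?S}\<^sup>*" ..
  qed
  then have "\<forall>r. \<exists>T. \<forall>w\<in>{w \<in> W. a w = r}. T w - T (s w) = d w" ..
  from choice[OF this] obtain T where "\<forall>r. \<forall>w\<in>{w \<in> W. a w = r}. T r w - T r (s w) = d w" ..
  then have T: "T r w - T r (s w) = d w" if "w \<in> W" "a w = r" for r w using that by auto
  show ?thesis
  proof (intro exI ballI impI)
    fix w w' assume "w \<in> W" "w' \<in> W" "\<gamma> w = \<beta> w'"
    then show "T (a w) w - T (a w') w' = d w" using s(2) as T by auto
  qed
qed

lemma link_induct_a:
  assumes "w \<in> W" "w' \<in> W" "a w = a w'" "P w"
    and step: "\<And>x y. \<lbrakk>x \<in> W; y \<in> W; a x = a w; a y = a w; \<gamma> x = \<beta> y; P x\<rbrakk> \<Longrightarrow> P y"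
  shows "P w'"
proof -
  have "(w, w') \<in> {(x, y). x \<in> W \<and> y \<in> W \<and> \<gamma> x = \<beta> y}\<^sup>*" using link_a assms by simp
  then have "a w' = a w \<and> P w'"
  proof induction
    case (step y z)
    then have "y \<in> W" "z \<in> W" "\<gamma> y = \<beta> z" by auto
    then have "a z = a y" using a_\<beta>[of z] a_\<gamma>[of y] by simp
    then show ?case using step assms(5)[of y z] by auto
  qed (simp add: assms)
  then show ?thesis ..
qed

lemma inv_\<alpha>: "w \<in> W \<Longrightarrow> inv_into W \<alpha> (\<alpha> w) = w"
  using bij_\<alpha> by (simp add: bij_betw_inv_into_left)

lemma inv_\<beta>: "w \<in> W \<Longrightarrow> inv_into W \<beta> (\<beta> w) = w"
  using bij_\<beta> by (simp add: bij_betw_inv_into_left)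

lemma notin_W: "w \<in> W \<Longrightarrow> \<alpha> w \<notin> W" "w \<in> W \<Longrightarrow> \<beta> w \<notin> W" "w \<in> W \<Longrightarrow> \<gamma> w \<notin> W"
  using W_Bl bij_betw_apply[OF bij_\<alpha>, of w] bij_betw_apply[OF bij_\<beta>, of w] bij_betw_apply[OF bij_\<gamma>, of w]
  by blast+

lemma \<beta>_surj: assumes "w \<in> W" obtains w' where "w' \<in> W" "\<beta> w' = \<gamma> w"
  using bij_\<beta> bij_\<gamma> assms by (metis bij_betw_iff_bijections)

lemma \<alpha>_surj: assumes "w \<in> W" obtains w' where "w' \<in> W" "\<alpha> w' = \<gamma> w"
  using bij_\<alpha> bij_\<gamma> assms by (metis bij_betw_iff_bijections)

lemma \<gamma>_surj: assumes "w \<in> W" obtains w' where "w' \<in> W" "\<gamma> w' = \<alpha> w"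
  using bij_\<alpha> bij_\<gamma> assms by (metis bij_betw_iff_bijections)

lemma \<beta>_surj': assumes "w \<in> W" obtains w' where "w' \<in> W" "\<beta> w' = \<alpha> w"
  using bij_\<beta> bij_\<alpha> assms by (metis bij_betw_iff_bijections)

text \<open>The three functions in \<open>cohom\<close> are values at the corners of a triangle.
  Here the c-corner gets 0, and a black triangle copies its a-value across its \<beta>-edge and its
  b-value across its \<alpha>-edge. Agreement across those edges then holds by construction, and the
  hypothesis is agreement across the \<gamma>-edges.\<close>

lemma white_cohomology:
  assumes S_T: "\<And>w w2 w3. \<lbrakk>w \<in> W; w2 \<in> W; w3 \<in> W; \<beta> w2 = \<gamma> w; \<alpha> w3 = \<gamma> w\<rbrakk> \<Longrightarrow> T w - S w = T w2 - S w3"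
  shows "\<exists>u :: 'p \<Rightarrow> int. \<forall>w\<in>W. u (a w) - u (c w) = T w \<and> u (b w) - u (c w) = S w"
proof -
  define f where "f t = (if t \<in> W then T t else T (inv_into W \<beta> t))" for t
  define g where "g t = (if t \<in> W then S t else S (inv_into W \<alpha> t))" for t
  have "\<exists>u :: 'p \<Rightarrow> int. \<forall>w\<in>W. u (a w) - u (b w) = f w - g w \<and> u (b w) - u (c w) = g w - 0"
  proof (rule cohom)
    fix w assume w: "w \<in> W"
    show "g w - 0 = g (\<alpha> w) - 0" using w by (simp add: g_def notin_W inv_\<alpha>)
    show "0 - f w = 0 - f (\<beta> w)" using w by (simp add: f_def notin_W inv_\<beta>)
    obtain w2 w3 where w23: "w2 \<in> W" "w3 \<in> W" "\<beta> w2 = \<gamma> w" "\<alpha> w3 = \<gamma> w"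
      using \<beta>_surj \<alpha>_surj w by metis
    then show "f w - g w = f (\<gamma> w) - g (\<gamma> w)"
      using S_T[OF w w23] w inv_\<alpha>[of w3] inv_\<beta>[of w2] by (simp add: f_def g_def notin_W)
  qed
  then obtain u :: "'p \<Rightarrow> int" where u: "\<forall>w\<in>W. u (a w) - u (b w) = f w - g w \<and> u (b w) - u (c w) = g w - 0" ..
  have "u (a w) - u (c w) = T w \<and> u (b w) - u (c w) = S w" if "w \<in> W" for w
    using bspec[OF u that] that by (simp add: f_def g_def)
  then show ?thesis by blast
qed

text \<open>A flow in the graph \<open>G\<^sub>c\<close> is the boundary of a 2-chain, its faces being the points \<open>c w\<close>.\<close>

lemma flow_potential:
  fixes d :: "'t \<Rightarrow> int"
  assumes a0: "\<And>r. sum d {w \<in> W. a w = r} = 0" and b0: "\<And>e. sum d {w \<in> W. b w = e} = 0"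
  shows "\<exists>h. \<forall>w\<in>W. d w = h (c w) - h (c (\<gamma> w))"
proof -
  obtain T where T: "\<And>w w'. w \<in> W \<Longrightarrow> w' \<in> W \<Longrightarrow> \<gamma> w = \<beta> w' \<Longrightarrow> T w - T w' = d w"
    using link_coboundary_a[of d] a0 by blast
  interpret swp: sphere_map W Bl b a c \<beta> \<alpha> \<gamma> by (rule sphere_map_swap)
  obtain S where S: "\<And>w w'. w \<in> W \<Longrightarrow> w' \<in> W \<Longrightarrow> \<gamma> w = \<alpha> w' \<Longrightarrow> S w - S w' = d w"
    using swp.link_coboundary_a[of d] b0 by blast
  \<comment> \<open>Both \<open>T\<close> and \<open>S\<close> drop by \<open>d w\<close> from
    \<open>w\<close> to the next white triangle round its a-point or b-point beyond the
    \<gamma>-edge, so their difference agrees across that edge.\<close>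
  have "\<exists>u :: 'p \<Rightarrow> int. \<forall>w\<in>W. u (a w) - u (c w) = - T w \<and> u (b w) - u (c w) = - S w"
  proof (rule white_cohomology)
    show "- T w - - S w = - T w2 - - S w3"
      if "w \<in> W" "w2 \<in> W" "w3 \<in> W" "\<beta> w2 = \<gamma> w" "\<alpha> w3 = \<gamma> w" for w w2 w3
      using T[of w w2] S[of w w3] that by simp
  qed
  then obtain u :: "'p \<Rightarrow> int" where u: "\<And>w. w \<in> W \<Longrightarrow> u (a w) - u (c w) = - T w" by blast
  show ?thesis
  proof (intro exI ballI)
    fix w assume w: "w \<in> W"
    obtain w2 where w2: "w2 \<in> W" "\<beta> w2 = \<gamma> w" using \<beta>_surj w by metis
    have "a w2 = a w" "c w2 = c (\<gamma> w)" using w w2 a_\<beta>[of w2] a_\<gamma>[of w] c_\<beta>[of w2] by auto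
    then show "d w = u (c w) - u (c (\<gamma> w))"
      using u[OF w] u[OF w2(1)] T[of w w2] w w2 by simp
  qed
qed

text \<open>The arc \<open>w\<close> of \<open>G\<^sub>a\<^sup>*\<close> crosses the edge between
  \<open>b w\<close> and \<open>c w\<close>. Round an a-point, entering arcs alternate with leaving
  ones, and \<open>d\<close> is the value of a leaving arc minus that of the entering arc before it.
  Conservation at the point is the zero sum that allows \<open>d\<close> to be summed round
  it.\<close>

lemma circulation_potential:
  fixes k :: "'t \<Rightarrow> int"
  assumes circ: "\<And>r. sum k {w \<in> W. a w = r} = sum k {w \<in> W. a (\<alpha> w) = r}"
  shows "\<exists>u. \<forall>w\<in>W. k w = u (b w) - u (c w)"
proof -
  define d where "d w = k (inv_into W \<alpha> (\<gamma> w)) - k w" for w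
  have d: "d w = k w' - k w" if "w \<in> W" "w' \<in> W" "\<gamma> w = \<alpha> w'" for w w'
    using that by (simp add: d_def inv_\<alpha>)
  have "sum d {w \<in> W. a w = r} = 0" for r
  proof -
    have "(\<Sum>w | w \<in> W \<and> a w = r. k (inv_into W \<alpha> (\<gamma> w))) = sum k {w \<in> W. a (\<alpha> w) = r}"
    proof (rule sum.reindex_bij_betw)
      obtain s where s: "bij_betw s W W" "\<And>w w'. w \<in> W \<Longrightarrow> w' \<in> W \<Longrightarrow> \<gamma> w = \<alpha> w' \<longleftrightarrow> w' = s w"
        using bij_transfer[OF bij_\<gamma> bij_\<alpha>] by blast
      have sW: "s w \<in> W" if "w \<in> W" for w using s(1) that by (auto simp: bij_betw_def)
      have seq: "inv_into W \<alpha> (\<gamma> w) = s w" if "w \<in> W" for w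
        using s(2)[OF that sW[OF that]] sW[OF that] by (simp add: inv_\<alpha>)
      have as: "a (\<alpha> (s w)) = a w" if "w \<in> W" for w
        using s(2)[OF that sW[OF that]] a_\<gamma>[OF that] by simp
      have "bij_betw s {w \<in> W. a w = r} {w \<in> W. a (\<alpha> w) = r}"
        using s(1) as sW unfolding bij_betw_def inj_on_def by (auto simp: image_iff) (metis imageE)
      then show "bij_betw (\<lambda>w. inv_into W \<alpha> (\<gamma> w)) {w \<in> W. a w = r} {w \<in> W. a (\<alpha> w) = r}"
        by (subst bij_betw_cong[where g = s]) (auto simp: seq)
    qed
    then show ?thesis using circ[of r] by (simp add: d_def sum_subtractf)
  qed
  then obtain T where T: "\<And>w w'. w \<in> W \<Longrightarrow> w' \<in> W \<Longrightarrow> \<gamma> w = \<beta> w' \<Longrightarrow> T w - T w' = d w"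
    using link_coboundary_a[of d] by blast
  have "\<exists>u :: 'p \<Rightarrow> int. \<forall>w\<in>W. u (a w) - u (c w) = - T w \<and> u (b w) - u (c w) = k w"
  proof (rule white_cohomology)
    show "- T w - k w = - T w2 - k w3"
      if "w \<in> W" "w2 \<in> W" "w3 \<in> W" "\<beta> w2 = \<gamma> w" "\<alpha> w3 = \<gamma> w" for w w2 w3
      using T[of w w2] d[of w w3] that by simp
  qed
  then show ?thesis by metis
qed

end

section \<open>Arborescences and occurrence vectors\<close>

definition transversals :: "'t set \<Rightarrow> ('t \<Rightarrow> 'p) \<Rightarrow> 'p \<Rightarrow> 't set set" where
  "transversals W a r = {X. X \<subseteq> W \<and> bij_betw a X (a ` W - {r})}"

definition occ :: "('t \<Rightarrow> 'q) \<Rightarrow> 't set \<Rightarrow> 'q \<Rightarrow> nat" where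
  "occ b X e = card {x \<in> X. b x = e}"

text \<open>Hall-type description of hypertrees, see \<open>hypertrees_eq_profiles\<close>: for each root, the other
  \<open>a\<close>-points can be assigned to adjacent \<open>b\<close>-points with the prescribed multiplicities.\<close>

definition profiles :: "'t set \<Rightarrow> ('t \<Rightarrow> 'p) \<Rightarrow> ('t \<Rightarrow> 'q) \<Rightarrow> ('q \<Rightarrow> nat) set" where
  "profiles W a b =
     {g \<in> extensional (b ` W). \<forall>r\<in>a ` W. \<exists>X\<in>transversals W a r. \<forall>e\<in>b ` W. g e = occ b X e}"

lemma sum_occ:
  assumes "finite X" "finite S"
  shows "(\<Sum>e\<in>S. occ b X e) = card {x \<in> X. b x \<in> S}"
proof -
  have "{x \<in> X. b x \<in> S} = (\<Union>e\<in>S. {x \<in> X. b x = e})" by auto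
  then show ?thesis unfolding occ_def using assms by (simp add: card_UN_disjoint disjoint_iff)
qed

text \<open>This is where the choice of the root is used: a root that is incident to \<open>S\<close> makes the
  inequality strict.\<close>

lemma profiles_strict:
  assumes fin: "finite W" and g: "g \<in> profiles W a b"
    and X: "X \<subseteq> W" "\<And>e. e \<in> b ` W \<Longrightarrow> g e = occ b X e"
    and S: "S \<subseteq> b ` W" "S \<noteq> {}"
  shows "card {x \<in> X. b x \<in> S} < card (a ` {w \<in> W. b w \<in> S})"
proof -
  obtain w where w: "w \<in> W" "b w \<in> S" using S by blast
  then obtain Y where Y: "Y \<in> transversals W a (a w)" "\<forall>e\<in>b ` W. g e = occ b Y e"
    using g by (auto simp: profiles_def)
  then have YW: "Y \<subseteq> W" and bij: "bij_betw a Y (a ` W - {a w})" by (auto simp: transversals_def)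
  have finXY: "finite X" "finite Y" "finite S"
    using X YW S fin by (auto intro: finite_subset)
  have "card {x \<in> X. b x \<in> S} = (\<Sum>e\<in>S. g e)"
    using X S finXY by (subst sum_occ[symmetric]) (auto intro!: sum.cong)
  also have "\<dots> = card {x \<in> Y. b x \<in> S}"
    using Y S finXY by (subst sum_occ[symmetric]) (auto intro!: sum.cong)
  also have "\<dots> = card (a ` {x \<in> Y. b x \<in> S})"
    using bij by (intro card_image[symmetric]) (auto simp: bij_betw_def inj_on_def)
  also have "\<dots> < card (a ` {w \<in> W. b w \<in> S})"
  proof (rule psubset_card_mono)
    show "finite (a ` {w \<in> W. b w \<in> S})" using fin by simp
    have "a w \<notin> a ` Y" using bij by (auto simp: bij_betw_def)
    then show "a ` {x \<in> Y. b x \<in> S} \<subset> a ` {w \<in> W. b w \<in> S}" using YW w by blast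
  qed
  finally show ?thesis .
qed

text \<open>The rank counts the steps of \<open>\<pi>\<close> needed to leave \<open>R\<close>, and
  the orbit of a point that never leaves is invariant. With \<open>R\<close> the points other than
  the root and \<open>\<pi>\<close> the passage to the tail of the chosen arc, these are the acyclic
  and the cyclic case.\<close>

lemma rank_or_invariant_set:
  fixes \<pi> :: "'p \<Rightarrow> 'p"
  obtains (rank) rk :: "'p \<Rightarrow> nat" where "\<And>r. r \<in> R \<Longrightarrow> rk (\<pi> r) < rk r"
  | (invariant) C where "C \<subseteq> R" "C \<noteq> {}" "\<pi> ` C \<subseteq> C"
proof (cases "\<forall>r\<in>R. \<exists>n. (\<pi> ^^ n) r \<notin> R")
  case True
  define rk where "rk r = (LEAST n. (\<pi> ^^ n) r \<notin> R)" for r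
  have "rk (\<pi> r) < rk r" if rR: "r \<in> R" for r
  proof -
    have 1: "(\<pi> ^^ rk r) r \<notin> R" 
      unfolding rk_def by (rule LeastI_ex[of "\<lambda>n. (\<pi> ^^ n) r \<notin> R"]) (use True rR in blast)
    then obtain n where n: "rk r = Suc n" using rR by (cases "rk r") auto
    then have "(\<pi> ^^ n) (\<pi> r) \<notin> R" using 1 by (simp add: funpow_swap1)
    then have "rk (\<pi> r) \<le> n" unfolding rk_def by (rule Least_le)
    then show ?thesis using n by simp
  qed
  then show thesis by (rule rank)
next
  case False
  then obtain r where r: "\<And>n. (\<pi> ^^ n) r \<in> R" by blast
  show thesis
  proof (rule invariant)
    show "range (\<lambda>n. (\<pi> ^^ n) r) \<subseteq> R" using r by auto
    show "\<pi> ` range (\<lambda>n. (\<pi> ^^ n) r) \<subseteq> range (\<lambda>n. (\<pi> ^^ n) r)"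
    proof clarify
      fix n show "\<pi> ((\<pi> ^^ n) r) \<in> range (\<lambda>n. (\<pi> ^^ n) r)" by (rule range_eqI[of _ _ "Suc n"]) simp
    qed
  qed auto
qed

lemma sum_of_bool_eq_card:
  assumes "finite A"
  shows "(\<Sum>x\<in>A. of_bool (P x) :: int) = int (card {x \<in> A. P x})"
proof -
  have "(\<Sum>x\<in>A. of_bool (P x) :: int) = (\<Sum>x\<in>{x \<in> A. P x}. 1)"
    using assms by (subst sum.inter_filter) (simp_all add: of_bool_def)
  then show ?thesis by simp
qed

lemma card_fibre:
  assumes f: "bij_betw f A C"
  shows "card {x \<in> A. f x = r} = of_bool (r \<in> C)"
proof (cases "r \<in> C")
  case True
  then have "r \<in> f ` A" using f by (simp add: bij_betw_def)
  then obtain z where z: "z \<in> A" "f z = r" by auto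
  then have "{x \<in> A. f x = r} = {z}" using f by (auto simp: bij_betw_def inj_on_def)
  then show ?thesis using True by simp
next
  case False
  then have "{x \<in> A. f x = r} = {}" using f by (auto simp: bij_betw_def)
  then show ?thesis using False by (simp only: card.empty of_bool_eq)
qed

section \<open>Potential differences of two selections; uniqueness of the arborescence\<close>

context sphere_map begin

lemma link_induct_b:
  assumes "w \<in> W" "w' \<in> W" "b w = b w'" "P w"
    and step: "\<And>x y. \<lbrakk>x \<in> W; y \<in> W; b x = b w; b y = b w; \<gamma> x = \<alpha> y; P x\<rbrakk> \<Longrightarrow> P y"
  shows "P w'"
proof -
  interpret swp: sphere_map W Bl b a c \<beta> \<alpha> \<gamma> by (rule sphere_map_swap)
  show ?thesis using assms by (rule swp.link_induct_a)
qed

text \<open>Two triangles with a common a-point or b-point are joined by a sequence round that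
  point, in which the c-point changes only when a \<gamma>-edge is crossed; \<open>conn\<close> does
  the rest.\<close>

lemma constant_across_\<gamma>:
  assumes f: "\<And>w. w \<in> W \<Longrightarrow> f (c w) = f (c (\<gamma> w))" and w: "w \<in> W" "w' \<in> W"
  shows "f (c w) = f (c w')"
proof -
  have "(w, w') \<in> {(x, y). x \<in> W \<and> y \<in> W \<and> (a x = a y \<or> b x = b y \<or> c x = c y)}\<^sup>*" by (rule conn[OF w])
  then show ?thesis
  proof induction
    case (step y z)
    then have yz: "y \<in> W" "z \<in> W" by auto
    have "f (c z) = f (c y)" if "a y = a z"
      using yz that by (rule link_induct_a) (use f c_\<beta> in fastforce)+
    moreover have "f (c z) = f (c y)" if "b y = b z"
      using yz that by (rule link_induct_b) (use f c_\<alpha> in fastforce)+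
    ultimately show ?case using step by auto
  qed simp
qed

text \<open>Acyclicity is encoded by a rank that increases along every chosen arc. As exactly one
  arc enters each a-point other than the root, this describes the spanning arborescences without any
  walks; see \<open>spanning_arborescences_iff\<close>.\<close>

definition arbs :: "'p \<Rightarrow> 't set set" where
  "arbs r = {X \<in> transversals W a r. \<exists>rk :: 'p \<Rightarrow> nat. \<forall>x\<in>X. rk (a (\<alpha> x)) < rk (a x)}"

lemma transversalD:
  assumes "X \<in> transversals W a r"
  shows "X \<subseteq> W" "finite X" "\<And>x. x \<in> X \<Longrightarrow> a x \<noteq> r" "inj_on a X" "bij_betw a X (a ` W - {r})"
    "\<And>w. w \<in> W \<Longrightarrow> a w \<noteq> r \<Longrightarrow> \<exists>x\<in>X. a x = a w"
proof -
  show X: "X \<subseteq> W" and bij: "bij_betw a X (a ` W - {r})" using assms by (auto simp: transversals_def)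
  show "finite X" using X finite_W by (rule finite_subset)
  show "a x \<noteq> r" if "x \<in> X" for x using bij that by (auto simp: bij_betw_def)
  show "inj_on a X" using bij by (simp add: bij_betw_def)
  show "\<exists>x\<in>X. a x = a w" if "w \<in> W" "a w \<noteq> r" for w
    using bij that unfolding bij_betw_def by (metis DiffI image_eqI imageE singletonD)
qed

text \<open>Among the triangles with b-point in \<open>S\<close> take one whose a-point has least
  rank. The selected triangle at this a-point has its b-point in \<open>S\<close> too, and the tail
  of its arc is adjacent to that b-point and has smaller rank. The lemma allows an arborescence to
  be completed to a spanning tree of \<open>G\<^sub>c\<close>.\<close>

lemma arbs_no_closed_set:
  assumes X: "X \<in> arbs r0" and S: "w \<in> W" "b w \<in> S"
    and closed: "\<And>w. w \<in> W \<Longrightarrow> b w \<in> S \<Longrightarrow> a w \<noteq> r0 \<and> (\<forall>x\<in>X. a x = a w \<longrightarrow> b x \<in> S)"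
  shows False
proof -
  obtain rk :: "'p \<Rightarrow> nat" where tr: "X \<in> transversals W a r0" and rk: "\<forall>x\<in>X. rk (a (\<alpha> x)) < rk (a x)"
    using X by (auto simp: arbs_def)
  obtain w1 where w1: "w1 \<in> W \<and> b w1 \<in> S"
    and least: "\<And>w. w \<in> W \<and> b w \<in> S \<Longrightarrow> rk (a w1) \<le> rk (a w)"
    using ex_has_least_nat[of "\<lambda>w. w \<in> W \<and> b w \<in> S" w "\<lambda>w. rk (a w)"] S by blast
  obtain x where x: "x \<in> X" "a x = a w1" using transversalD(6)[OF tr] closed w1 by blast
  then have xW: "x \<in> W" and bx: "b x \<in> S" using transversalD(1)[OF tr] closed w1 by auto
  obtain w2 where w2: "w2 \<in> W" "\<gamma> w2 = \<alpha> x" using \<gamma>_surj[OF xW] by blast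
  then have "b w2 = b x" "a w2 = a (\<alpha> x)" using b_\<gamma> a_\<gamma> b_\<alpha> xW by metis+
  then show False using least[of w2] w2 bx rk x by fastforce
qed

text \<open>Where \<open>h\<close> attains a maximum exceeding its value at the root, the arborescence cannot leave
  the set of maximal points.\<close>

lemma potential_le_root:
  assumes X1: "X1 \<in> arbs r0" and X2: "X2 \<in> transversals W a r0"
    and h: "\<And>w. w \<in> W \<Longrightarrow> of_bool (w \<in> X1) - of_bool (w \<in> X2) = (h (c w) - h (c (\<gamma> w)) :: int)"
    and w0: "w0 \<in> W" "a w0 = r0" and w1: "w1 \<in> W"
  shows "h (c w1) \<le> h (c w0)"
proof (rule ccontr)
  assume not_le: "\<not> ?thesis"
  define m where "m = Max ((\<lambda>w. h (c w)) ` W)"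
  have le_m: "h (c w) \<le> m" if "w \<in> W" for w unfolding m_def using finite_W that by simp
  obtain wm where wm: "wm \<in> W" "h (c wm) = m"
    using Max_in[of "(\<lambda>w. h (c w)) ` W"] finite_W W_nonempty unfolding m_def by fastforce
  obtain rk :: "'p \<Rightarrow> nat" where tr: "X1 \<in> transversals W a r0" and rk: "\<forall>x\<in>X1. rk (a (\<alpha> x)) < rk (a x)"
    using X1 by (auto simp: arbs_def)
  \<comment> \<open>Neither choice selects a triangle at the root, so \<open>h\<close> does not
    change round the root.\<close>
  have at_root: "h (c w) = h (c w0)" if "w \<in> W" "a w = r0" for w
  proof -
    have "a w0 = a w" using that w0 by simp
    with w0(1) that(1) show ?thesis
    proof (rule link_induct_a)
      fix x y assume xy: "x \<in> W" "y \<in> W" "a x = a w0" "\<gamma> x = \<beta> y" "h (c x) = h (c w0)"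
      then have "x \<notin> X1" "x \<notin> X2" using transversalD(3)[OF tr] transversalD(3)[OF X2] w0 by auto
      then show "h (c y) = h (c w0)" using h[OF xy(1)] xy c_\<beta>[of y] by simp
    qed simp
  qed
  obtain w where w: "w \<in> W \<and> h (c w) = m"
    and least: "\<And>w'. w' \<in> W \<and> h (c w') = m \<Longrightarrow> rk (a w) \<le> rk (a w')"
    using ex_has_least_nat[of "\<lambda>w. w \<in> W \<and> h (c w) = m" wm "\<lambda>w. rk (a w)"] wm by blast
  have "a w \<noteq> r0" using at_root[of w] w le_m[OF w1] not_le by auto
  then obtain x where x: "x \<in> X1" "a x = a w" using transversalD(6)[OF tr] w by blast
  then have xW: "x \<in> W" using transversalD(1)[OF tr] by blast
  \<comment> \<open>Going round the a-point, \<open>h\<close> can drop only in passing a triangle of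
    \<open>X1\<close>, and \<open>x\<close> is the only one there. So the maximum persists from
    \<open>w\<close> up to \<open>x\<close>.\<close>
  have hx: "h (c x) = m"
  proof (rule ccontr)
    assume neq: "h (c x) \<noteq> m"
    have "h (c x) = m"
    proof (rule link_induct_a[of w x])
      fix y z assume yz: "y \<in> W" "z \<in> W" "a y = a w" "\<gamma> y = \<beta> z" "h (c y) = m"
      have "y \<notin> X1" using inj_onD[OF transversalD(4)[OF tr], of x y] x yz neq by auto
      then have "m \<le> h (c z)" using h[OF yz(1)] yz c_\<beta>[of z] by (auto simp: of_bool_def split: if_splits)
      then show "h (c z) = m" using le_m[OF yz(2)] by simp
    qed (use w xW x in auto)
    then show False using neq by simp
  qed
  \<comment> \<open>The triangle \<open>w'\<close> has the c-point of \<open>x\<close>, hence the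
    maximal value, and lies at the tail of the arc \<open>x\<close>, where the rank is
    smaller.\<close>
  obtain w' where w': "w' \<in> W" "\<beta> w' = \<alpha> x" using \<beta>_surj'[OF xW] by blast
  then have "c w' = c x" "a w' = a (\<alpha> x)" using c_\<beta>[of w'] a_\<beta>[of w'] c_\<alpha>[OF xW] by auto
  then show False using least[of w'] w' hx rk x by fastforce
qed

text \<open>Both selections take one triangle at each a-point but the root, and their b-counts
  agree, so their difference is a flow in \<open>G\<^sub>c\<close>.\<close>

lemma occ_eq_imp_potential:
  assumes X: "X \<in> transversals W a r0" and Y: "Y \<in> transversals W a r0"
    and occ: "\<And>e. e \<in> b ` W \<Longrightarrow> occ b X e = occ b Y e"
  shows "\<exists>h. \<forall>w\<in>W. of_bool (w \<in> X) - of_bool (w \<in> Y) = (h (c w) - h (c (\<gamma> w)) :: int)"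
proof (rule flow_potential)
  note XY = transversalD[OF X] transversalD[OF Y]
  have eq: "(\<Sum>w | w \<in> W \<and> P w. of_bool (w \<in> X) - of_bool (w \<in> Y) :: int) =
    int (card {x \<in> X. P x}) - int (card {x \<in> Y. P x})" for P
  proof -
    have "{x \<in> X. P x} = {w \<in> {w \<in> W. P w}. w \<in> X}" "{x \<in> Y. P x} = {w \<in> {w \<in> W. P w}. w \<in> Y}"
      using XY by auto
    moreover have "finite {w \<in> W. P w}" using finite_W by simp
    ultimately show ?thesis by (simp only: sum_subtractf sum_of_bool_eq_card)
  qed
  show "(\<Sum>w | w \<in> W \<and> b w = e. of_bool (w \<in> X) - of_bool (w \<in> Y) :: int) = 0" for e
  proof (cases "e \<in> b ` W")
    case True
    then show ?thesis unfolding eq using occ[of e] by (simp add: occ_def)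
  next
    case False
    then have "{w. w \<in> W \<and> b w = e} = {}" by auto
    then show ?thesis by (simp only: sum.empty)
  qed
  show "(\<Sum>w | w \<in> W \<and> a w = r. of_bool (w \<in> X) - of_bool (w \<in> Y) :: int) = 0" for r
    unfolding eq using card_fibre[OF transversalD(5)[OF X]] card_fibre[OF transversalD(5)[OF Y]] by simp
qed

text \<open>The bound \<open>potential_le_root\<close> applies to the potential and, with the roles
  exchanged, to its negative. So the potential is constant and the two indicator functions
  coincide.\<close>

lemma arbs_unique:
  assumes X: "X \<in> arbs r0" and Y: "Y \<in> arbs r0" and r0: "r0 \<in> a ` W"
    and occ: "\<And>e. e \<in> b ` W \<Longrightarrow> occ b X e = occ b Y e"
  shows "X = Y"
proof -
  have XT: "X \<in> transversals W a r0" and YT: "Y \<in> transversals W a r0" using X Y by (auto simp: arbs_def)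
  obtain w0 where w0: "w0 \<in> W" "a w0 = r0" using r0 by auto
  obtain h :: "'p \<Rightarrow> int" where h: "\<And>w. w \<in> W \<Longrightarrow> of_bool (w \<in> X) - of_bool (w \<in> Y) = h (c w) - h (c (\<gamma> w))"
    using occ_eq_imp_potential[OF XT YT occ] by blast
  have "h (c w) = h (c w0)" if w: "w \<in> W" for w
  proof (rule antisym)
    show "h (c w) \<le> h (c w0)" using potential_le_root[OF X YT h w0 w] .
    have "- h (c w) \<le> - h (c w0)"
    proof (rule potential_le_root[OF Y XT _ w0 w])
      show "of_bool (w \<in> Y) - of_bool (w \<in> X) = - h (c w) - - h (c (\<gamma> w))" if "w \<in> W" for w
        using h[OF that] by simp
    qed
    then show "h (c w0) \<le> h (c w)" by simp
  qed
  moreover have "\<exists>w'\<in>W. c w' = c (\<gamma> w)" if "w \<in> W" for w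
    using \<beta>_surj[OF that] c_\<beta> by metis
  ultimately have "of_bool (w \<in> X) = (of_bool (w \<in> Y) :: int)" if "w \<in> W" for w
    using h[OF that] that by (metis diff_self eq_iff_diff_eq_0)
  then have "w \<in> X \<longleftrightarrow> w \<in> Y" if "w \<in> W" for w using that by (metis of_bool_eq_iff)
  then show ?thesis using transversalD(1)[OF XT] transversalD(1)[OF YT] by blast
qed


section \<open>Cycle reversal and existence of the arborescence\<close>

text \<open>Here \<open>A\<close> is a directed cycle of the dual, and the two values of its potential \<open>u\<close> correspond to
  its two sides.\<close>

lemma cycle_potential:
  assumes X: "X \<in> transversals W a r0" and r0: "r0 \<in> a ` W" and not_arb: "X \<notin> arbs r0"
  obtains A u k where "A \<subseteq> X" "A \<noteq> {}" "bij_betw (\<lambda>x. a (\<alpha> x)) A (a ` A)"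
    "\<And>w. w \<in> W \<Longrightarrow> u (b w) - u (c w) = (of_bool (w \<in> A) :: int)"
    "\<And>x. x \<in> A \<Longrightarrow> u (c x) = k"
    "\<And>w. w \<in> W \<Longrightarrow> u (c w) = k \<or> u (c w) = k + 1"
proof -
  note XT = transversalD[OF X]
  let ?R = "a ` W - {r0}"
  let ?x = "inv_into X a"
  define \<pi> where "\<pi> r = a (\<alpha> (?x r))" for r
  have x_in: "?x r \<in> X" and a_x: "a (?x r) = r" if "r \<in> ?R" for r
  proof -
    have "r \<in> a ` X" using XT(5) that by (simp add: bij_betw_def)
    then show "?x r \<in> X" "a (?x r) = r" by (auto intro: inv_into_into f_inv_into_f)
  qed
  have x_a: "?x (a x) = x" if "x \<in> X" for x using XT(4) that by simp
  obtain C0 where C0: "C0 \<subseteq> ?R" "C0 \<noteq> {}" "\<pi> ` C0 \<subseteq> C0"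
  proof (rule rank_or_invariant_set[of ?R \<pi>])
    fix rk :: "'p \<Rightarrow> nat" assume "\<And>r. r \<in> ?R \<Longrightarrow> rk (\<pi> r) < rk r"
    then have "\<forall>x\<in>X. rk (a (\<alpha> x)) < rk (a x)" using XT x_a by (fastforce simp: \<pi>_def)
    then show thesis using not_arb X by (auto simp: arbs_def)
  qed blast
  \<comment> \<open>An invariant set of least size is a single directed cycle: \<open>\<pi>\<close>
    maps it onto itself, and no smaller part of it is invariant.\<close>
  define inv where "inv D \<longleftrightarrow> D \<subseteq> ?R \<and> D \<noteq> {} \<and> \<pi> ` D \<subseteq> D" for D
  obtain C where "inv C" and least: "\<And>D. inv D \<Longrightarrow> card C \<le> card D"
    using ex_has_least_nat[of inv C0 card] C0 unfolding inv_def[of C0] by blast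
  then have C: "C \<subseteq> ?R" "C \<noteq> {}" "\<pi> ` C \<subseteq> C" by (auto simp: inv_def)
  have finC: "finite C" using finite_subset[OF C(1)] finite_W by simp
  have minimal: "D = C" if "D \<subseteq> C" "D \<noteq> {}" "\<pi> ` D \<subseteq> D" for D
  proof (rule card_subset_eq[OF finC that(1)])
    have "inv D" using that C(1) by (auto simp: inv_def)
    then show "card D = card C" using least[of D] card_mono[OF finC that(1)] by simp
  qed
  have \<pi>C: "\<pi> ` C = C" using C by (intro minimal) auto
  have inj_\<pi>: "inj_on \<pi> C" using finC \<pi>C by (intro eq_card_imp_inj_on) auto
  define A where "A = ?x ` C"
  have xC: "?x r \<in> X" "a (?x r) = r" if "r \<in> C" for r using x_in[of r] a_x[of r] that C(1) by blast+
  have AX: "A \<subseteq> X" using xC by (auto simp: A_def)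
  have aA: "a ` A = C" using xC by (simp add: A_def image_image)
  have AW: "x \<in> W" if "x \<in> A" for x using AX XT(1) that by blast
  have \<pi>_A: "a (\<alpha> x) = \<pi> (a x)" if "x \<in> A" for x using that AX x_a by (auto simp: \<pi>_def)
  have inj_aA: "inj_on a A" using XT(4) AX by (rule inj_on_subset)
  have bijA: "bij_betw (\<lambda>x. a (\<alpha> x)) A (a ` A)"
  proof -
    have "bij_betw (\<pi> \<circ> a) A C" using inj_aA aA inj_\<pi> \<pi>C
      by (intro bij_betw_trans[of a A C]) (auto simp: bij_betw_def)
    then show ?thesis unfolding aA by (subst bij_betw_cong[where g = "\<pi> \<circ> a"]) (simp_all add: \<pi>_A)
  qed
  have sum_fibre: "(\<Sum>w | w \<in> W \<and> f w = r. of_bool (w \<in> A) :: int) = of_bool (r \<in> C)"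
    if "bij_betw f A C" for f r
  proof -
    have "{x \<in> {w \<in> W. f w = r}. x \<in> A} = {x \<in> A. f x = r}" using AW by auto
    then show ?thesis using finite_W card_fibre[OF that] by (subst sum_of_bool_eq_card) simp_all
  qed
  have "\<exists>u. \<forall>w\<in>W. of_bool (w \<in> A) = (u (b w) - u (c w) :: int)"
  proof (rule circulation_potential)
    have "bij_betw a A C" using inj_aA aA by (simp add: bij_betw_def)
    moreover have "bij_betw (\<lambda>x. a (\<alpha> x)) A C" using bijA aA by simp
    ultimately show "(\<Sum>w | w \<in> W \<and> a w = r. of_bool (w \<in> A) :: int) =
        (\<Sum>w | w \<in> W \<and> a (\<alpha> w) = r. of_bool (w \<in> A))" for r
      by (simp only: sum_fibre)
  qed
  then obtain u :: "'p \<Rightarrow> int" where u': "\<forall>w\<in>W. of_bool (w \<in> A) = u (b w) - u (c w)" ..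
  then have u: "u (b w) - u (c w) = of_bool (w \<in> A)" if "w \<in> W" for w using that by simp
  have step: "u (c (\<gamma> w)) = u (c w) + of_bool (w \<in> A) - of_bool (y \<in> A)"
    if "w \<in> W" "y \<in> W" "\<alpha> y = \<gamma> w" for w y
  proof -
    have "b y = b w" "c y = c (\<gamma> w)" using that b_\<alpha>[of y] b_\<gamma>[of w] c_\<alpha>[of y] by auto
    then show ?thesis using u[of w] u[of y] that by simp
  qed
  \<comment> \<open>Go round \<open>\<pi> r\<close> from \<open>z0\<close>, the triangle beside the
    arc from \<open>\<pi> r\<close> to \<open>r\<close> that has the same c-point. Only two arcs of
    \<open>A\<close> can change \<open>u\<close> here: at the entering one the goal is reached, and
    passing the leaving one means arriving at \<open>z0\<close> again. So \<open>u\<close> keeps its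
    value.\<close>
  have next_eq: "u (c (?x r)) = u (c (?x (\<pi> r)))" if r: "r \<in> C" for r
  proof (rule ccontr)
    assume neq: "u (c (?x r)) \<noteq> u (c (?x (\<pi> r)))"
    have xA: "?x r \<in> A" "?x (\<pi> r) \<in> A" using r C(3) by (auto simp: A_def)
    obtain z0 where z0: "z0 \<in> W" "\<beta> z0 = \<alpha> (?x r)" using \<beta>_surj' AW[OF xA(1)] by blast
    have z0': "c z0 = c (?x r)" "a z0 = \<pi> r"
      using z0 c_\<beta>[of z0] a_\<beta>[of z0] c_\<alpha>[OF AW[OF xA(1)]] by (auto simp: \<pi>_def)
    have ax': "a (?x (\<pi> r)) = \<pi> r" using r C by (intro a_x) auto
    have "u (c (?x (\<pi> r))) = u (c z0)"
    proof (rule link_induct_a[of z0 _ "\<lambda>y. u (c y) = u (c z0)"])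
      fix y z assume yz: "y \<in> W" "z \<in> W" "a y = a z0" "\<gamma> y = \<beta> z" "u (c y) = u (c z0)"
      obtain y' where y': "y' \<in> W" "\<alpha> y' = \<gamma> y" using \<alpha>_surj[OF yz(1)] by blast
      have "c z = c (\<gamma> y)" using yz c_\<beta>[of z] by simp
      then have eq: "u (c z) = u (c y) + of_bool (y \<in> A) - of_bool (y' \<in> A)"
        using step[OF yz(1) y'] by simp
      have "y \<notin> A"
      proof
        assume "y \<in> A"
        then have "y = ?x (\<pi> r)" using inj_onD[OF inj_aA, of y "?x (\<pi> r)"] xA yz z0' ax' by simp
        then show False using yz neq z0' by simp
      qed
      show "u (c z) = u (c z0)"
      proof (cases "y' \<in> A")
        case True
        have "a (\<alpha> y') = a (\<alpha> (?x r))" using y' yz a_\<gamma>[of y] z0' by (simp add: \<pi>_def)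
        then have "y' = ?x r" using bijA True xA by (auto simp: bij_betw_def inj_on_def)
        then have "\<beta> z = \<beta> z0" using y' yz z0 by simp
        then have "z = z0" using bij_\<beta> yz z0 by (auto simp: bij_betw_def inj_on_def)
        then show ?thesis by simp
      next
        case False
        then show ?thesis using eq \<open>y \<notin> A\<close> yz by simp
      qed
    qed (use z0 z0' ax' AW xA in auto)
    then show False using neq z0' by simp
  qed
  obtain r1 where r1: "r1 \<in> C" using C(2) by blast
  define k where "k = u (c (?x r1))"
  have "{r \<in> C. u (c (?x r)) = k} = C"
    using r1 C(3) next_eq by (intro minimal) (auto simp: k_def)
  then have k: "u (c x) = k" if "x \<in> A" for x using that by (auto simp: A_def)
  \<comment> \<open>Crossing a \<gamma>-edge changes \<open>u\<close> by at most 1, and where it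
    does, one of the two c-points belongs to a triangle of \<open>A\<close> and has the lower value
    \<open>k\<close>.\<close>
  have "(u (c w) = k \<or> u (c w) = k + 1) = (u (c (?x r1)) = k \<or> u (c (?x r1)) = k + 1)" if "w \<in> W" for w
  proof (rule constant_across_\<gamma>[where f = "\<lambda>v. u v = k \<or> u v = k + 1"])
    show "?x r1 \<in> W" using r1 AW by (auto simp: A_def)
    fix w assume w: "w \<in> W"
    obtain y where y: "y \<in> W" "\<alpha> y = \<gamma> w" using \<alpha>_surj[OF w] by blast
    have "c y = c (\<gamma> w)" using y c_\<alpha>[of y] by simp
    then show "(u (c w) = k \<or> u (c w) = k + 1) = (u (c (\<gamma> w)) = k \<or> u (c (\<gamma> w)) = k + 1)"
      using step[OF w y] k[of w] k[of y] by (cases "w \<in> A"; cases "y \<in> A") auto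
  qed (rule that)
  then have "u (c w) = k \<or> u (c w) = k + 1" if "w \<in> W" for w using that k_def by simp
  moreover have "A \<noteq> {}" using C(2) by (simp add: A_def)
  ultimately show thesis using that[OF AX _ bijA u k] by blast
qed

lemma a\<alpha>: assumes "w \<in> W" shows "a (\<alpha> w) \<in> a ` W"
proof -
  obtain w' where "w' \<in> W" "\<beta> w' = \<alpha> w" using \<beta>_surj'[OF assms] by blast
  then show ?thesis using a_\<beta>[of w'] by force
qed

text \<open>Reversing a cycle of \<open>X\<close> moves the selected edge of each point on it to the next triangle
  along the cycle, which lowers the potential on the side of the cycle away from the root.\<close>

lemma reverse_cycle:
  assumes X: "X \<in> transversals W a r0" and AX: "A \<subseteq> X"
    and bijA: "bij_betw (\<lambda>x. a (\<alpha> x)) A (a ` A)"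
    and u: "\<And>w. w \<in> W \<Longrightarrow> u (b w) - u (c w) = (of_bool (w \<in> A) :: int)"
  obtains Y where "Y \<in> transversals W a r0" "\<And>e. occ b Y e = occ b X e"
    "\<And>w. w \<in> W \<Longrightarrow> of_bool (w \<in> Y) - of_bool (w \<in> X) = u (c w) - u (c (\<gamma> w))"
proof
  note XT = transversalD[OF X]
  have AW: "x \<in> W" if "x \<in> A" for x using that AX XT(1) by blast
  \<comment> \<open>The white triangle beyond the \<gamma>-edge of \<open>\<alpha> x\<close> lies at
    the tail of the arc \<open>x\<close> and has the same b-point. So the a-points of the cycle are
    permuted and the occurrence vector is unchanged.\<close>
  define \<phi> where "\<phi> x = (if x \<in> A then inv_into W \<gamma> (\<alpha> x) else x)" for x
  have \<phi>A: "\<phi> x \<in> W" "\<gamma> (\<phi> x) = \<alpha> x" if xA: "x \<in> A" for x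
  proof -
    obtain w where w: "w \<in> W" "\<gamma> w = \<alpha> x" using \<gamma>_surj[OF AW[OF xA]] by blast
    then have "\<phi> x = w" using that bij_\<gamma> by (simp add: \<phi>_def w(2)[symmetric] bij_betw_inv_into_left)
    then show "\<phi> x \<in> W" "\<gamma> (\<phi> x) = \<alpha> x" using w by auto
  qed
  have a\<phi>A: "a (\<phi> x) = a (\<alpha> x)" if "x \<in> A" for x using a_\<gamma>[OF \<phi>A(1)[OF that]] \<phi>A[OF that] by simp
  have b\<phi>: "b (\<phi> x) = b x" if "x \<in> X" for x
  proof (cases "x \<in> A")
    case True
    then show ?thesis using b_\<gamma>[of "\<phi> x"] b_\<alpha>[of x] \<phi>A AW by simp
  qed (simp add: \<phi>_def)
  have \<phi>_id: "\<phi> x = x" if "x \<notin> A" for x using that by (simp add: \<phi>_def)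
  have img_a\<phi>: "(\<lambda>x. a (\<phi> x)) ` A = a ` A"
    using bijA a\<phi>A by (auto simp: bij_betw_def image_def)
  have inj_A: "inj_on (\<lambda>x. a (\<phi> x)) A"
    using bijA a\<phi>A by (auto simp: bij_betw_def inj_on_def)
  have notA: "a x \<notin> a ` A" if "x \<in> X - A" for x
    using XT(4) AX that by (auto simp: inj_on_def)
  have inj: "inj_on (\<lambda>x. a (\<phi> x)) X"
  proof (rule inj_onI)
    fix x y assume xy: "x \<in> X" "y \<in> X" and eq: "a (\<phi> x) = a (\<phi> y)"
    have mem: "a (\<phi> z) \<in> a ` A \<longleftrightarrow> z \<in> A" if "z \<in> X" for z
      using img_a\<phi> notA[of z] \<phi>_id[of z] that by (cases "z \<in> A") auto
    show "x = y"
    proof (cases "x \<in> A")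
      case True
      then have "y \<in> A" using mem xy eq by metis
      then show ?thesis using True inj_A eq by (auto simp: inj_on_def)
    next
      case False
      then have "y \<notin> A" using mem xy eq by metis
      then show ?thesis using False \<phi>_id eq XT(4) xy by (auto simp: inj_on_def)
    qed
  qed
  have "(\<lambda>x. a (\<phi> x)) ` X = (\<lambda>x. a (\<phi> x)) ` A \<union> (\<lambda>x. a (\<phi> x)) ` (X - A)"
    using AX by blast
  also have "(\<lambda>x. a (\<phi> x)) ` (X - A) = a ` (X - A)" using \<phi>_id by (intro image_cong) auto
  finally have img: "(\<lambda>x. a (\<phi> x)) ` X = a ` X" unfolding img_a\<phi> using AX by blast
  have inj_\<phi>: "inj_on \<phi> X" using inj by (auto simp: inj_on_def)
  have "inj_on a (\<phi> ` X)" using inj by (auto simp: inj_on_def)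
  then have "bij_betw a (\<phi> ` X) (a ` W - {r0})"
    using img XT(5) by (simp add: bij_betw_def image_image)
  moreover have "\<phi> ` X \<subseteq> W" using \<phi>A XT(1) \<phi>_id by (metis image_subsetI subsetD)
  ultimately show "\<phi> ` X \<in> transversals W a r0" by (simp add: transversals_def)
  show "occ b (\<phi> ` X) e = occ b X e" for e
  proof -
    have "{y \<in> \<phi> ` X. b y = e} = \<phi> ` {x \<in> X. b x = e}" using b\<phi> by force
    then show ?thesis unfolding occ_def
      using inj_on_subset[OF inj_\<phi>, of "{x \<in> X. b x = e}"] by (simp add: card_image)
  qed
  show "of_bool (w \<in> \<phi> ` X) - of_bool (w \<in> X) = u (c w) - u (c (\<gamma> w))" if w: "w \<in> W" for w
  proof -
    obtain y where y: "y \<in> W" "\<alpha> y = \<gamma> w" using \<alpha>_surj[OF w] by blast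
    have "b y = b w" "c y = c (\<gamma> w)" using y b_\<alpha>[of y] b_\<gamma>[of w] c_\<alpha>[of y] w by auto
    then have eq: "u (c w) - u (c (\<gamma> w)) = of_bool (y \<in> A) - of_bool (w \<in> A)"
      using u[of w] u[of y] w y by simp
    have yA: "w \<in> \<phi> ` A \<longleftrightarrow> y \<in> A"
    proof
      assume "w \<in> \<phi> ` A"
      then obtain x where "x \<in> A" "\<alpha> x = \<alpha> y" using \<phi>A y by auto
      then show "y \<in> A" using bij_\<alpha> AW y by (metis inv_\<alpha>)
    next
      assume "y \<in> A"
      then have "\<gamma> (\<phi> y) = \<gamma> w" using \<phi>A y by simp
      then have "\<phi> y = w" using bij_\<gamma> \<phi>A(1)[OF \<open>y \<in> A\<close>] w by (auto simp: bij_betw_def inj_on_def)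
      then show "w \<in> \<phi> ` A" using \<open>y \<in> A\<close> by blast
    qed
    have "\<phi> ` X = \<phi> ` A \<union> \<phi> ` (X - A)" using AX by blast
    also have "\<phi> ` (X - A) = X - A" using \<phi>_id by auto
    finally have "w \<in> \<phi> ` X \<longleftrightarrow> y \<in> A \<or> (w \<in> X \<and> w \<notin> A)" using yA by blast
    moreover have "w \<notin> X - A" if "y \<in> A"
    proof
      assume wX: "w \<in> X - A"
      have "w \<in> \<phi> ` A" using yA that by blast
      then have "a w \<in> a ` A" using img_a\<phi> by auto
      then show False using notA wX by blast
    qed
    ultimately show ?thesis using eq AX by (cases "y \<in> A"; cases "w \<in> A"; cases "w \<in> X") auto
  qed
qed

text \<open>The total potential is minimised over all selections with occurrence vector
  \<open>g\<close>, measured against a fixed one and normalised to 0 at a triangle of the root. A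
  directed cycle in the minimiser contradicts the strict Hall inequality or minimality, according to
  the side on which the root lies.\<close>

lemma arbs_exists:
  assumes g: "g \<in> profiles W a b" and r0: "r0 \<in> a ` W"
  shows "\<exists>X\<in>arbs r0. \<forall>e\<in>b ` W. g e = occ b X e"
proof -
  obtain w0 where w0: "w0 \<in> W" "a w0 = r0" using r0 by auto
  define XX where "XX = {X \<in> transversals W a r0. \<forall>e\<in>b ` W. g e = occ b X e}"
  have "XX \<subseteq> Pow W" by (auto simp: XX_def transversals_def)
  then have "finite XX" using finite_W by (simp add: finite_subset)
  obtain X0 where X0: "X0 \<in> XX" using g r0 by (auto simp: profiles_def XX_def)
  have "\<exists>h :: 'p \<Rightarrow> int. h (c w0) = 0 \<and>
      (\<forall>w\<in>W. of_bool (w \<in> X) - of_bool (w \<in> X0) = h (c w) - h (c (\<gamma> w)))" if XXX: "X \<in> XX" for X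
  proof -
    obtain h :: "'p \<Rightarrow> int" where "\<forall>w\<in>W. of_bool (w \<in> X) - of_bool (w \<in> X0) = h (c w) - h (c (\<gamma> w))"
      using occ_eq_imp_potential[of X r0 X0] XXX X0 by (auto simp: XX_def)
    then show ?thesis by (intro exI[of _ "\<lambda>v. h v - h (c w0)"]) simp
  qed
  then have "\<forall>X\<in>XX. \<exists>h :: 'p \<Rightarrow> int. h (c w0) = 0 \<and>
      (\<forall>w\<in>W. of_bool (w \<in> X) - of_bool (w \<in> X0) = h (c w) - h (c (\<gamma> w)))" by blast
  from bchoice[OF this] obtain H :: "'t set \<Rightarrow> 'p \<Rightarrow> int" where
    H: "\<forall>X\<in>XX. H X (c w0) = 0 \<and>
      (\<forall>w\<in>W. of_bool (w \<in> X) - of_bool (w \<in> X0) = H X (c w) - H X (c (\<gamma> w)))" ..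
  define \<Phi> where "\<Phi> X = (\<Sum>v\<in>c ` W. H X v)" for X
  obtain X where X: "X \<in> XX" and least: "\<And>Y. Y \<in> XX \<Longrightarrow> \<Phi> X \<le> \<Phi> Y"
    using arg_min_if_finite(1)[OF \<open>finite XX\<close>, of \<Phi>] arg_min_least[OF \<open>finite XX\<close>, of _ \<Phi>] X0 by blast
  then have XT: "X \<in> transversals W a r0" and Xg: "\<And>e. e \<in> b ` W \<Longrightarrow> g e = occ b X e" by (auto simp: XX_def)
  have "X \<in> arbs r0"
  proof (rule ccontr)
    assume "X \<notin> arbs r0"
    then obtain A u k where AX: "A \<subseteq> X" and A: "A \<noteq> {}" and bijA: "bij_betw (\<lambda>x. a (\<alpha> x)) A (a ` A)"
      and u: "\<And>w. w \<in> W \<Longrightarrow> u (b w) - u (c w) = (of_bool (w \<in> A) :: int)"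
      and k: "\<And>x. x \<in> A \<Longrightarrow> u (c x) = k"
      and k01: "\<And>w. w \<in> W \<Longrightarrow> u (c w) = k \<or> u (c w) = k + 1"
      using cycle_potential[OF XT r0] by blast
    obtain x1 where x1: "x1 \<in> A" using A by blast
    have x1W: "x1 \<in> W" using x1 AX transversalD(1)[OF XT] by blast
    \<comment> \<open>At an a-point off the cycle no arc of \<open>A\<close> enters or leaves, so
      \<open>u\<close> is constant round it, on b-points and c-points alike.\<close>
    have around: "u (c w) = u (c w') \<and> u (b w) = u (c w)"
      if w: "w \<in> W" "w' \<in> W" "a w = a w'" and out: "a w \<notin> a ` A" for w w'
    proof -
      have noA: "y \<notin> A" if "a y = a w" for y using out that by (metis imageI)
      have "u (c w') = u (c w)"
      proof (rule link_induct_a[OF w, of "\<lambda>y. u (c y) = u (c w)"])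
        fix y z assume yz: "y \<in> W" "z \<in> W" "a y = a w" "\<gamma> y = \<beta> z" "u (c y) = u (c w)"
        obtain y' where y': "y' \<in> W" "\<alpha> y' = \<gamma> y" using \<alpha>_surj[OF yz(1)] by blast
        have "a (\<alpha> y') = a w" using y' a_\<gamma>[of y] yz by simp
        then have "y' \<notin> A" using bij_betw_apply[OF bijA, of y'] out by auto
        moreover have "b y' = b y" "c y' = c z"
          using y' yz b_\<alpha>[of y'] b_\<gamma>[of y] c_\<alpha>[of y'] c_\<beta>[of z] by auto
        ultimately show "u (c z) = u (c w)" using u[of y] u[of y'] noA yz y' by simp
      qed simp
      then show ?thesis using u[OF w(1)] noA[of w] by simp
    qed
    have r0_out: "r0 \<notin> a ` A" using transversalD(3)[OF XT] AX by auto
    show False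
    proof (cases "u (c w0) = k")
      case True
      \<comment> \<open>The root is on the lower side. At every a-point adjacent to the upper
        b-points \<open>S\<close>, the selected triangle again has its b-point in \<open>S\<close>:
        on the cycle because \<open>u\<close> rises from \<open>k\<close> to \<open>k + 1\<close>
        across a triangle of \<open>A\<close>, elsewhere by \<open>around\<close>. That is too many
        triangles for \<open>profiles_strict\<close>.\<close>
      define S where "S = {e \<in> b ` W. u e = k + 1}"
      have ux1: "u (b x1) = k + 1" using u[OF x1W] k x1 by simp
      have sel: "\<exists>x\<in>X. a x = a w \<and> b x \<in> S" if w: "w \<in> W" "b w \<in> S" for w
      proof -
        have "a w \<noteq> r0" using around[of w w0] w w0 r0_out True by (auto simp: S_def)
        then obtain x where x: "x \<in> X" "a x = a w" using transversalD(6)[OF XT w(1)] by blast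
        have xW: "x \<in> W" using x transversalD(1)[OF XT] by blast
        have "u (b x) = k + 1"
        proof (cases "a w \<in> a ` A")
          case True
          then obtain y where "y \<in> A" "a y = a x" using x by auto
          then have "x \<in> A" using inj_onD[OF transversalD(4)[OF XT], of y x] AX x by auto
          then show ?thesis using u[OF xW] k by simp
        next
          case False
          then show ?thesis using around[of w x] around[of x w] x w xW by (auto simp: S_def)
        qed
        then show ?thesis using x xW by (auto simp: S_def)
      qed
      have "card {x \<in> X. b x \<in> S} < card (a ` {w \<in> W. b w \<in> S})"
        by (rule profiles_strict[OF finite_W g transversalD(1)[OF XT] Xg])
          (use ux1 x1W in \<open>auto simp: S_def\<close>)
      moreover have "card (a ` {w \<in> W. b w \<in> S}) \<le> card (a ` {x \<in> X. b x \<in> S})"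
        using transversalD(2)[OF XT] sel by (intro card_mono) (auto simp: image_iff, metis)
      moreover have "\<dots> \<le> card {x \<in> X. b x \<in> S}" using transversalD(2)[OF XT] by (simp add: card_image_le)
      ultimately show False by simp
    next
      case False
      then have uw0: "u (c w0) = k + 1" using k01[OF w0(1)] by simp
      obtain Y where Y: "Y \<in> transversals W a r0" "\<And>e. occ b Y e = occ b X e"
        and Yu: "\<And>w. w \<in> W \<Longrightarrow> of_bool (w \<in> Y) - of_bool (w \<in> X) = u (c w) - u (c (\<gamma> w))"
        using reverse_cycle[OF XT AX bijA u] by blast
      have YXX: "Y \<in> XX" using Y Xg by (simp add: XX_def)
      \<comment> \<open>Both normalised potentials vanish at \<open>c w0\<close>, where
        \<open>u\<close> has its upper value \<open>k + 1\<close>. So no value of the potential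
        increases, and the one at \<open>c x1\<close> falls by 1.\<close>
      have HY: "H Y (c w) = H X (c w) + u (c w) - (k + 1)" if "w \<in> W" for w
      proof -
        have "H Y (c w) - H X (c w) - u (c w) = H Y (c w0) - H X (c w0) - u (c w0)"
        proof (rule constant_across_\<gamma>[where f = "\<lambda>v. H Y v - H X v - u v"])
          fix w assume w: "w \<in> W"
          have "of_bool (w \<in> Y) - of_bool (w \<in> X0) = H Y (c w) - H Y (c (\<gamma> w))"
            "of_bool (w \<in> X) - of_bool (w \<in> X0) = H X (c w) - H X (c (\<gamma> w))"
            using H X YXX w by blast+
          then show "H Y (c w) - H X (c w) - u (c w) = H Y (c (\<gamma> w)) - H X (c (\<gamma> w)) - u (c (\<gamma> w))"
            using Yu[OF w] by simp
        qed (use that w0 in auto)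
        then show ?thesis using H X YXX uw0 by simp
      qed
      have "\<Phi> Y < \<Phi> X" unfolding \<Phi>_def
      proof (rule sum_strict_mono_ex1)
        show "finite (c ` W)" using finite_W by simp
        show "\<forall>v\<in>c ` W. H Y v \<le> H X v" using HY k01 by fastforce
        show "\<exists>v\<in>c ` W. H Y v < H X v" using HY[OF x1W] k[OF x1] x1W by (intro bexI[of _ "c x1"]) auto
      qed
      then show False using least[OF YXX] by simp
    qed
  qed
  then show ?thesis using Xg by blast
qed

end

section \<open>Spanning trees and hypertrees\<close>

definition adj :: "('e \<Rightarrow> 'v set) \<Rightarrow> 'e set \<Rightarrow> ('v \<times> 'v) set" where
  "adj en F = {(u, v). \<exists>e\<in>F. en e = {u, v}}"

lemma sym_adj: "sym (adj en F)"
  by (auto simp: sym_def adj_def insert_commute)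

lemma adj_rtrancl_sym: "(u, v) \<in> (adj en F)\<^sup>* \<Longrightarrow> (v, u) \<in> (adj en F)\<^sup>*"
  using sym_adj[of en F] by (meson sym_rtrancl symD)

lemma walk_append: "walk en F u (xs @ ys) v \<longleftrightarrow> (\<exists>m. walk en F u xs m \<and> walk en F m ys v)"
  by (induction en F u xs v rule: walk.induct) auto

lemma walk_imp_rtrancl: "walk en F u xs v \<Longrightarrow> (u, v) \<in> (adj en F)\<^sup>*"
  by (induction en F u xs v rule: walk.induct) (auto simp: adj_def intro: converse_rtrancl_into_rtrancl)

lemma rtrancl_imp_simple_walk:
  assumes "(u, v) \<in> (adj en F)\<^sup>*" shows "\<exists>xs. simple_walk en F u xs v"
  using assms
proof (induction rule: converse_rtrancl_induct)
  case base
  show ?case by (rule exI[of _ "[]"]) (simp add: simple_walk_def)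
next
  case (step u w)
  then obtain e xs where e: "e \<in> F" "en e = {u, w}" and xs: "walk en F w xs v" "distinct (w # map snd xs)"
    by (auto simp: adj_def simple_walk_def)
  show ?case
  proof (cases "u \<in> set (w # map snd xs)")
    case False
    then show ?thesis using e xs by (intro exI[of _ "(e, w) # xs"]) (auto simp: simple_walk_def)
  next
    case True
    show ?thesis
    proof (cases "u = w")
      case True then show ?thesis using xs by (auto simp: simple_walk_def)
    next
      case False
      then obtain ys zs e' where "xs = ys @ (e', u) # zs" using True by (auto dest!: split_list)
      then show ?thesis using xs by (intro exI[of _ zs]) (auto simp: simple_walk_def walk_append)
    qed
  qed
qed

lemma walk_ends_subset:
  "walk en F u xs v \<Longrightarrow> e \<in> fst ` set xs \<Longrightarrow> e \<in> F \<and> en e \<subseteq> insert u (snd ` set xs)"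
  by (induction en F u xs v rule: walk.induct) auto

lemma walk_target: "walk en F u xs v \<Longrightarrow> v \<in> insert u (snd ` set xs)"
  by (induction en F u xs v rule: walk.induct) auto

lemma walk_target': "walk en F u xs v \<Longrightarrow> xs \<noteq> [] \<Longrightarrow> v \<in> snd ` set xs"
  by (cases xs) (auto dest: walk_target)

lemma walk_mono: "walk en F u xs v \<Longrightarrow> F \<subseteq> F' \<Longrightarrow> walk en F' u xs v"
  by (induction en F u xs v rule: walk.induct) auto

lemma simple_walk_distinct_edges:
  "walk en F u xs v \<Longrightarrow> distinct (u # map snd xs) \<Longrightarrow> distinct (map fst xs)"
proof (induction en F u xs v rule: walk.induct)
  case (2 en F u e w xs v)
  have "e \<notin> fst ` set xs"
  proof
    assume "e \<in> fst ` set xs"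
    then have "en e \<subseteq> insert w (snd ` set xs)" using walk_ends_subset 2 by fastforce
    then show False using 2 by auto
  qed
  then show ?case using 2 by auto
qed simp

text \<open>The rank is the distance from \<open>r\<close>, and \<open>u\<close> is the last vertex
  but one on a shortest path.\<close>

lemma reachability_rank:
  "\<exists>rk :: 'v \<Rightarrow> nat. \<forall>v. (r, v) \<in> D\<^sup>* \<longrightarrow> v \<noteq> r \<longrightarrow> (\<exists>u. (u, v) \<in> D \<and> rk u < rk v)"
proof -
  define rk where "rk v = (LEAST n. (r, v) \<in> D ^^ n)" for v
  have "\<exists>u. (u, v) \<in> D \<and> rk u < rk v" if v: "(r, v) \<in> D\<^sup>*" "v \<noteq> r" for v
  proof -
    have "\<exists>n. (r, v) \<in> D ^^ n" using v by (simp add: rtrancl_power)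
    then have 1: "(r, v) \<in> D ^^ rk v" unfolding rk_def by (rule LeastI_ex)
    obtain n where n: "rk v = Suc n" using 1 v by (cases "rk v") auto
    then obtain u where u: "(r, u) \<in> D ^^ n" "(u, v) \<in> D" using 1 by auto
    have "rk u \<le> n" unfolding rk_def by (rule Least_le) (rule u)
    then show ?thesis using u n by auto
  qed
  then show ?thesis by blast
qed

lemma parents_exist:
  assumes conn: "\<And>v. v \<in> V \<Longrightarrow> (r, v) \<in> (adj en K)\<^sup>*" and sub: "\<And>e. e \<in> K \<Longrightarrow> en e \<subseteq> V"
  shows "\<exists>par (rk :: _ \<Rightarrow> nat). \<forall>v\<in>V - {r}. par v \<in> K \<and> (\<exists>w\<in>V. en (par v) = {v, w} \<and> rk w < rk v)"
proof -
  obtain rk :: "'a \<Rightarrow> nat" where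
    rk: "\<forall>v. (r, v) \<in> (adj en K)\<^sup>* \<longrightarrow> v \<noteq> r \<longrightarrow> (\<exists>u. (u, v) \<in> adj en K \<and> rk u < rk v)"
    using reachability_rank[of r "adj en K"] ..
  have "\<exists>e. e \<in> K \<and> (\<exists>w\<in>V. en e = {v, w} \<and> rk w < rk v)" if v: "v \<in> V - {r}" for v
  proof -
    obtain w where w: "(w, v) \<in> adj en K" "rk w < rk v" using rk conn v by blast
    then obtain e where e: "e \<in> K" "en e = {w, v}" by (auto simp: adj_def)
    then show ?thesis using w sub[OF e(1)] by (intro exI[of _ e]) (auto simp: insert_commute)
  qed
  then have "\<forall>v\<in>V - {r}. \<exists>e. e \<in> K \<and> (\<exists>w\<in>V. en e = {v, w} \<and> rk w < rk v)" by blast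
  from bchoice[OF this] show ?thesis by blast
qed

text \<open>A substitute for walks and cycles: the decreasing rank gives connectedness to the root,
  and the bijection says that each edge is the parent edge of exactly one vertex, which excludes
  cycles.\<close>

definition rooted_tree :: "('e \<Rightarrow> 'v set) \<Rightarrow> 'v set \<Rightarrow> 'e set \<Rightarrow> 'v \<Rightarrow> ('v \<Rightarrow> 'e) \<Rightarrow> ('v \<Rightarrow> nat) \<Rightarrow> bool" where
  "rooted_tree en V F r par rk \<longleftrightarrow>
     r \<in> V \<and> bij_betw par (V - {r}) F \<and> (\<forall>v\<in>V - {r}. \<exists>w\<in>V. en (par v) = {v, w} \<and> rk w < rk v)"

text \<open>Two vertices with a common parent edge would be its two ends, each of smaller rank than
  the other.\<close>

lemma inj_on_parents:
  fixes rk :: "'v \<Rightarrow> nat"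
  assumes "\<forall>v\<in>U. \<exists>w. en (par v) = {v, w} \<and> rk w < rk v"
  shows "inj_on par U"
proof (rule inj_onI, rule ccontr)
  fix v v' assume v: "v \<in> U" "v' \<in> U" "par v = par v'" "v \<noteq> v'"
  obtain w w' where "en (par v) = {v, w}" "rk w < rk v" "en (par v') = {v', w'}" "rk w' < rk v'"
    using assms v by metis
  then show False using v by (auto simp: doubleton_eq_iff)
qed

lemma parents_connected:
  fixes rk :: "'v \<Rightarrow> nat"
  assumes "\<forall>v\<in>V - {r}. \<exists>w\<in>V. en (par v) = {v, w} \<and> rk w < rk v" and "v \<in> V"
  shows "(v, r) \<in> (adj en (par ` (V - {r})))\<^sup>*"
  using \<open>v \<in> V\<close>
proof (induction "rk v" arbitrary: v rule: less_induct)
  case less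
  show ?case
  proof (cases "v = r")
    case False
    then obtain w where w: "w \<in> V" "en (par v) = {v, w}" "rk w < rk v" using assms less by blast
    then have "(v, w) \<in> adj en (par ` (V - {r}))" using False less by (auto simp: adj_def)
    then show ?thesis using less(1)[OF w(3,1)] by (rule converse_rtrancl_into_rtrancl)
  qed simp
qed

lemma spanning_tree_imp_rooted_tree:
  assumes T: "is_spanning_tree G F" and r: "r \<in> gverts G"
    and en: "\<And>e. e \<in> gedges G \<Longrightarrow> \<exists>u\<in>gverts G. \<exists>v\<in>gverts G. gends G e = {u, v}"
  shows "\<exists>par rk. rooted_tree (gends G) (gverts G) F r par rk"
proof -
  let ?V = "gverts G"
  have F: "F \<subseteq> gedges G" and nocycle: "\<And>u xs. \<not> is_cycle (gends G) F u xs"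
    using T by (auto simp: is_spanning_tree_def)
  have "(r, v) \<in> (adj (gends G) F)\<^sup>*" if "v \<in> ?V" for v
    using T r that walk_imp_rtrancl unfolding is_spanning_tree_def simple_walk_def by metis
  moreover have "gends G e \<subseteq> ?V" if "e \<in> F" for e using en F that by fastforce
  ultimately obtain par and rk :: "'a \<Rightarrow> nat" where
    par: "\<forall>v\<in>?V - {r}. par v \<in> F \<and> (\<exists>w\<in>?V. gends G (par v) = {v, w} \<and> rk w < rk v)"
    using parents_exist[of ?V r "gends G" F] by blast
  have inj: "inj_on par (?V - {r})" using par by (intro inj_on_parents[of _ "gends G" par rk]) blast
  \<comment> \<open>An edge that is no parent edge would be a loop or close a cycle with the path
    between its ends along parent edges.\<close>
  have "e \<in> par ` (?V - {r})" if e: "e \<in> F" for e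
  proof (rule ccontr)
    assume notin: "e \<notin> par ` (?V - {r})"
    obtain u w where uw: "u \<in> ?V" "w \<in> ?V" "gends G e = {u, w}" using en F e by blast
    show False
    proof (cases "u = w")
      case True
      then have "is_cycle (gends G) F u [(e, u)]" using e uw by (simp add: is_cycle_def)
      then show False using nocycle by blast
    next
      case False
      have "(v, r) \<in> (adj (gends G) (par ` (?V - {r})))\<^sup>*" if "v \<in> ?V" for v
        using par that by (intro parents_connected[of _ _ _ _ rk]) blast+
      then have "(w, u) \<in> (adj (gends G) (par ` (?V - {r})))\<^sup>*"
        using uw by (meson adj_rtrancl_sym rtrancl_trans)
      then obtain xs where xs: "walk (gends G) (par ` (?V - {r})) w xs u" "distinct (w # map snd xs)"
        using rtrancl_imp_simple_walk unfolding simple_walk_def by metis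
      have "e \<notin> set (map fst xs)" using walk_ends_subset[OF xs(1), of e] notin by auto
      moreover have "walk (gends G) F w xs u" using xs(1) par by (intro walk_mono[OF xs(1)]) auto
      ultimately have "is_cycle (gends G) F u ((e, w) # xs)"
        using xs simple_walk_distinct_edges[OF xs] e uw by (auto simp: is_cycle_def)
      then show False using nocycle by blast
    qed
  qed
  then have "bij_betw par (?V - {r}) F" using inj par by (auto simp: bij_betw_def)
  then have "rooted_tree (gends G) ?V F r par rk" using r par by (auto simp: rooted_tree_def)
  then show ?thesis by blast
qed

text \<open>On a cycle, sending each edge to the endpoint whose parent edge it is would be a bijection onto
  the vertices, which is impossible at a vertex of least rank.\<close>

lemma rooted_tree_imp_spanning_tree:
  assumes T: "rooted_tree (gends G) (gverts G) F r par rk" and F: "F \<subseteq> gedges G"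
  shows "is_spanning_tree G F"
  unfolding is_spanning_tree_def
proof (intro conjI F ballI)
  let ?V = "gverts G"
  have r: "r \<in> ?V" and bij: "bij_betw par (?V - {r}) F"
    and par: "\<forall>v\<in>?V - {r}. \<exists>w\<in>?V. gends G (par v) = {v, w} \<and> rk w < rk v"
    using T by (auto simp: rooted_tree_def)
  then have img: "par ` (?V - {r}) = F" by (simp add: bij_betw_def)
  show "?V \<noteq> {}" using r by auto
  have "(v, r) \<in> (adj (gends G) F)\<^sup>*" if "v \<in> ?V" for v
    using parents_connected[where en = "gends G" and rk = rk, OF par that] unfolding img .
  then show "\<exists>xs. simple_walk (gends G) F u xs v" if "u \<in> ?V" "v \<in> ?V" for u v
    using that by (meson adj_rtrancl_sym rtrancl_trans rtrancl_imp_simple_walk)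
  show "\<nexists>u xs. is_cycle (gends G) F u xs"
  proof clarify
    fix u xs assume "is_cycle (gends G) F u xs"
    then have ne: "xs \<noteq> []" and wk: "walk (gends G) F u xs u"
      and dist: "distinct (map fst xs)" "distinct (map snd xs)" by (auto simp: is_cycle_def)
    define U where "U = snd ` set xs"
    define A where "A = fst ` set xs"
    have fin: "finite U" "finite A" by (simp_all add: U_def A_def)
    have card: "card A = card U"
      using dist unfolding U_def A_def by (metis distinct_card length_map set_map)
    have "u \<in> U" using walk_target'[OF wk ne] by (simp add: U_def)
    then have sub: "e \<in> F" "gends G e \<subseteq> U" if "e \<in> A" for e
      using walk_ends_subset[OF wk] that by (auto simp: U_def A_def)
    define child where "child = inv_into (?V - {r}) par"
    have child: "child e \<in> ?V - {r}" "par (child e) = e" if "e \<in> F" for e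
      using that img unfolding child_def by (metis inv_into_into, metis f_inv_into_f)
    have "child e \<in> U" if eA: "e \<in> A" for e
    proof -
      obtain w where "gends G (par (child e)) = {child e, w}" using par child(1)[OF sub(1)[OF eA]] by blast
      then have "child e \<in> gends G e" using child(2)[OF sub(1)[OF that]] by simp
      then show ?thesis using sub(2)[OF that] by blast
    qed
    moreover have "inj_on child A" using child sub by (metis inj_onI)
    ultimately have surj: "child ` A = U"
      using card fin by (metis card_image card_subset_eq image_subsetI)
    obtain v where v: "v \<in> U" and least: "\<And>w. w \<in> U \<Longrightarrow> rk v \<le> rk w"
      using ex_has_least_nat[of "\<lambda>v. v \<in> U" u rk] \<open>u \<in> U\<close> by blast
    obtain e where e: "e \<in> A" "v = child e" using surj v by blast
    obtain w where w: "gends G (par v) = {v, w}" "rk w < rk v" using par child[OF sub(1)[OF e(1)]] e by blast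
    then have "w \<in> U" using child[OF sub(1)[OF e(1)]] sub(2)[OF e(1)] e by auto
    then show False using least[of w] w by simp
  qed
qed


text \<open>A spanning tree of the bipartite graph rooted at the a-point \<open>r\<close>:
  \<open>X\<close> holds the parent edges of the other a-points, \<open>Y\<close> those of the
  b-points. A b-point has one parent edge, and its other edges are parent edges of a-points, so its
  degree minus 1 is its count in \<open>X\<close>.\<close>

definition rooted_pair :: "'t set \<Rightarrow> ('t \<Rightarrow> 'p) \<Rightarrow> ('t \<Rightarrow> 'q) \<Rightarrow> 'p \<Rightarrow> 't set \<Rightarrow> 't set \<Rightarrow> ('p + 'q \<Rightarrow> nat) \<Rightarrow> bool" where
  "rooted_pair W a b r X Y rk \<longleftrightarrow> X \<in> transversals W a r \<and> Y \<subseteq> W \<and> bij_betw b Y (b ` W) \<and>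
     (\<forall>x\<in>X. rk (Inr (b x)) < rk (Inl (a x))) \<and> (\<forall>y\<in>Y. rk (Inl (a y)) < rk (Inr (b y)))"

lemma rooted_pairD:
  assumes "rooted_pair W a b r X Y rk"
  shows "X \<subseteq> W" "Y \<subseteq> W" "bij_betw a X (a ` W - {r})" "bij_betw b Y (b ` W)"
    "\<And>x. x \<in> X \<Longrightarrow> rk (Inr (b x)) < rk (Inl (a x))" "\<And>y. y \<in> Y \<Longrightarrow> rk (Inl (a y)) < rk (Inr (b y))"
  using assms by (simp_all add: rooted_pair_def transversals_def)

text \<open>In \<open>bip\<close> each pair is joined at most once, while several triangles may
  realise the same pair. A tree contains no parallel edges, so choosing one triangle for each edge
  loses nothing.\<close>

definition represents :: "('p, 'q) hypergraph \<Rightarrow> 't set \<Rightarrow> ('t \<Rightarrow> 'p) \<Rightarrow> ('t \<Rightarrow> 'q) \<Rightarrow> bool" where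
  "represents H W a b \<longleftrightarrow> hverts H = a ` W \<and> hedges H = b ` W \<and>
     (\<forall>p\<in>a ` W. \<forall>q\<in>b ` W. p \<in> hinc H q \<longleftrightarrow> (\<exists>w\<in>W. a w = p \<and> b w = q))"

lemma represents_bip:
  assumes "represents H W a b"
  shows "gverts (bip H) = Inl ` a ` W \<union> Inr ` b ` W" "gedges (bip H) = (\<lambda>w. (a w, b w)) ` W"
    "gends (bip H) = (\<lambda>(p, q). {Inl p, Inr q})"
proof -
  have "{(p, q). p \<in> a ` W \<and> q \<in> b ` W \<and> p \<in> hinc H q} = (\<lambda>w. (a w, b w)) ` W"
  proof (intro set_eqI, clarify)
    fix p q
    have "p \<in> hinc H q \<longleftrightarrow> (\<exists>w\<in>W. a w = p \<and> b w = q)" if "p \<in> a ` W" "q \<in> b ` W"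
      using assms that unfolding represents_def by blast
    then show "(p, q) \<in> {(p, q). p \<in> a ` W \<and> q \<in> b ` W \<and> p \<in> hinc H q} \<longleftrightarrow> (p, q) \<in> (\<lambda>w. (a w, b w)) ` W"
      unfolding image_iff by (simp add: Bex_def) metis
  qed
  then show "gedges (bip H) = (\<lambda>w. (a w, b w)) ` W"
    using assms by (simp add: bip_def represents_def)
  show "gverts (bip H) = Inl ` a ` W \<union> Inr ` b ` W"
    using assms by (simp add: bip_def represents_def)
qed (simp add: bip_def)

lemma hypertree_imp_rooted_pair:
  assumes H: "represents H W a b" and fin: "finite W" and g: "g \<in> hypertrees H" and r: "r \<in> a ` W"
  shows "\<exists>X Y rk. rooted_pair W a b r X Y rk \<and> (\<forall>e\<in>b ` W. g e = occ b X e)"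
proof -
  note bip = represents_bip[OF H]
  obtain F where F: "is_spanning_tree (bip H) F" and deg: "\<forall>e\<in>b ` W. degree_in (bip H) F (Inr e) = g e + 1"
    using g H by (auto simp: hypertrees_def represents_def)
  have "\<exists>par rk. rooted_tree (gends (bip H)) (gverts (bip H)) F (Inl r) par rk"
    using r by (intro spanning_tree_imp_rooted_tree[OF F]) (auto simp: bip)
  then obtain par rk where T: "rooted_tree (gends (bip H)) (gverts (bip H)) F (Inl r) par rk" by blast
  have bij: "bij_betw par (gverts (bip H) - {Inl r}) F"
    and par: "\<forall>v\<in>gverts (bip H) - {Inl r}. \<exists>w\<in>gverts (bip H). gends (bip H) (par v) = {v, w} \<and> rk w < rk v"
    using T by (simp_all add: rooted_tree_def)
  have FW: "F \<subseteq> (\<lambda>w. (a w, b w)) ` W" using F bip(2) by (simp add: is_spanning_tree_def)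
  define lift where "lift = inv_into W (\<lambda>w. (a w, b w))"
  have lift: "lift e \<in> W" "(a (lift e), b (lift e)) = e" if "e \<in> F" for e
  proof -
    have e: "e \<in> (\<lambda>w. (a w, b w)) ` W" using FW that by blast
    show "lift e \<in> W" unfolding lift_def using e by (rule inv_into_into)
    show "(a (lift e), b (lift e)) = e" unfolding lift_def using f_inv_into_f[OF e] .
  qed
  have parF: "par v \<in> F" if "v \<in> gverts (bip H) - {Inl r}" for v using bij that by (auto simp: bij_betw_def)
  define x where "x p = lift (par (Inl p))" for p
  define y where "y q = lift (par (Inr q))" for q
  have x: "x p \<in> W" "par (Inl p) = (a (x p), b (x p))" "a (x p) = p" "rk (Inr (b (x p))) < rk (Inl p)"
    if "p \<in> a ` W - {r}" for p
  proof -
    have v: "Inl p \<in> gverts (bip H) - {Inl r}" using that by (auto simp: bip)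
    show xW: "x p \<in> W" and eq: "par (Inl p) = (a (x p), b (x p))" using lift[OF parF[OF v]] by (simp_all add: x_def)
    obtain w where "gends (bip H) (par (Inl p)) = {Inl p, w}" "rk w < rk (Inl p)" using par v by blast
    then show "a (x p) = p" "rk (Inr (b (x p))) < rk (Inl p)" by (auto simp: bip eq doubleton_eq_iff)
  qed
  have y: "y q \<in> W" "par (Inr q) = (a (y q), b (y q))" "b (y q) = q" "rk (Inl (a (y q))) < rk (Inr q)"
    if "q \<in> b ` W" for q
  proof -
    have v: "Inr q \<in> gverts (bip H) - {Inl r}" using that by (auto simp: bip)
    show yW: "y q \<in> W" and eq: "par (Inr q) = (a (y q), b (y q))" using lift[OF parF[OF v]] by (simp_all add: y_def)
    obtain w where "gends (bip H) (par (Inr q)) = {Inr q, w}" "rk w < rk (Inr q)" using par v by blast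
    then show "b (y q) = q" "rk (Inl (a (y q))) < rk (Inr q)" by (auto simp: bip eq doubleton_eq_iff)
  qed
  define X where "X = x ` (a ` W - {r})"
  define Y where "Y = y ` (b ` W)"
  have "bij_betw a X (a ` W - {r})" unfolding X_def using x(3)
    by (auto simp: bij_betw_def inj_on_def image_image)
  then have "X \<in> transversals W a r" using x(1) by (auto simp: transversals_def X_def)
  moreover have "Y \<subseteq> W" "bij_betw b Y (b ` W)" unfolding Y_def using y(1,3)
    by (auto simp: bij_betw_def inj_on_def image_image)
  ultimately have "rooted_pair W a b r X Y rk"
    using x(3,4) y(3,4) by (auto simp: rooted_pair_def X_def Y_def)
  moreover have "g e = occ b X e" if e: "e \<in> b ` W" for e
  proof -
    have verts: "gverts (bip H) - {Inl r} = Inl ` (a ` W - {r}) \<union> Inr ` b ` W" by (auto simp: bip)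
    have "F = par ` (gverts (bip H) - {Inl r})" using bij by (simp add: bij_betw_def)
    also have "\<dots> = (\<lambda>w. (a w, b w)) ` X \<union> (\<lambda>w. (a w, b w)) ` Y"
      unfolding verts image_Un X_def Y_def image_image
      using x(2) y(2) by (intro arg_cong2[where f = "(\<union>)"] image_cong) auto
    \<comment> \<open>The tree edges at \<open>e\<close> are its own parent edge and the parent
      edges of its children; the former accounts for the 1 in the degree condition.\<close>
    finally have "{f \<in> F. Inr e \<in> gends (bip H) f} =
        insert (par (Inr e)) ((\<lambda>w. (a w, b w)) ` {w \<in> X. b w = e})"
      using y(2,3) e by (auto simp: bip Y_def)
    moreover have "par (Inr e) \<notin> (\<lambda>w. (a w, b w)) ` {w \<in> X. b w = e}"
    proof
      assume "par (Inr e) \<in> (\<lambda>w. (a w, b w)) ` {w \<in> X. b w = e}"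
      then obtain p where p: "p \<in> a ` W - {r}" "par (Inr e) = par (Inl p)" using x(2) by (auto simp: X_def)
      then have "Inr e = (Inl p :: 'a + 'b)"
        using bij e by (intro inj_onD[of par "gverts (bip H) - {Inl r}"]) (auto simp: bij_betw_def bip)
      then show False by simp
    qed
    moreover have "inj_on (\<lambda>w. (a w, b w)) {w \<in> X. b w = e}"
      using \<open>bij_betw a X (a ` W - {r})\<close> by (auto simp: bij_betw_def inj_on_def)
    moreover have "finite X" using fin by (simp add: X_def)
    ultimately have "degree_in (bip H) F (Inr e) = Suc (occ b X e)"
      using card_image[of "\<lambda>w. (a w, b w)" "{w \<in> X. b w = e}"] by (simp add: degree_in_def occ_def)
    then show ?thesis using deg e by simp
  qed
  ultimately show ?thesis by blast
qed

lemma rooted_pair_imp_hypertree: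
  assumes H: "represents H W a b" and fin: "finite W" and r: "r \<in> a ` W"
    and XY: "rooted_pair W a b r X Y rk"
  shows "restrict (occ b X) (b ` W) \<in> hypertrees H"
proof -
  note bip = represents_bip[OF H]
  note X = rooted_pairD(1,3)[OF XY] and Y = rooted_pairD(2,4)[OF XY]
    and rkX = rooted_pairD(5)[OF XY] and rkY = rooted_pairD(6)[OF XY]
  let ?e = "\<lambda>w. (a w, b w)"
  define F where "F = ?e ` X \<union> ?e ` Y"
  define par where "par = case_sum (\<lambda>p. ?e (inv_into X a p)) (\<lambda>q. ?e (inv_into Y b q))"
  have xp: "inv_into X a p \<in> X" "a (inv_into X a p) = p" if "p \<in> a ` W - {r}" for p
    using that X(2) by (auto simp: bij_betw_def intro: inv_into_into f_inv_into_f)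
  have yq: "inv_into Y b q \<in> Y" "b (inv_into Y b q) = q" if "q \<in> b ` W" for q
    using that Y(2) by (auto simp: bij_betw_def intro: inv_into_into f_inv_into_f)
  have verts: "gverts (bip H) - {Inl r} = Inl ` (a ` W - {r}) \<union> Inr ` b ` W" by (auto simp: bip)
  have par: "\<exists>w\<in>gverts (bip H). gends (bip H) (par v) = {v, w} \<and> rk w < rk v"
    if "v \<in> gverts (bip H) - {Inl r}" for v
  proof (cases v)
    case (Inl p)
    then have p: "p \<in> a ` W - {r}" using that verts by auto
    show ?thesis using xp[OF p] rkX[OF xp(1)[OF p]] X(1) Inl
      by (intro bexI[of _ "Inr (b (inv_into X a p))"]) (auto simp: bip par_def)
  next
    case (Inr q)
    then have q: "q \<in> b ` W" using that verts by auto
    show ?thesis using yq[OF q] rkY[OF yq(1)[OF q]] Y(1) Inr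
      by (intro bexI[of _ "Inl (a (inv_into Y b q))"]) (auto simp: bip par_def)
  qed
  have inj: "inj_on par (gverts (bip H) - {Inl r})"
    using par by (intro inj_on_parents[of _ "gends (bip H)" _ rk]) blast
  have "par ` Inl ` (a ` W - {r}) = ?e ` X"
  proof -
    have "par ` Inl ` (a ` W - {r}) = ?e ` inv_into X a ` (a ` W - {r})" by (simp add: par_def image_image)
    also have "inv_into X a ` (a ` W - {r}) = X" using X(2) by (metis bij_betw_def bij_betw_inv_into)
    finally show ?thesis .
  qed
  moreover have "par ` Inr ` b ` W = ?e ` Y"
  proof -
    have "par ` Inr ` b ` W = ?e ` inv_into Y b ` (b ` W)" by (simp add: par_def image_image)
    also have "inv_into Y b ` (b ` W) = Y" using Y(2) by (metis bij_betw_def bij_betw_inv_into)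
    finally show ?thesis .
  qed
  ultimately have "par ` (gverts (bip H) - {Inl r}) = F" unfolding verts F_def by (simp only: image_Un)
  then have "rooted_tree (gends (bip H)) (gverts (bip H)) F (Inl r) par rk"
    using inj par r by (auto simp: rooted_tree_def bij_betw_def bip)
  moreover have "F \<subseteq> gedges (bip H)" using X Y by (auto simp: F_def bip)
  ultimately have "is_spanning_tree (bip H) F" by (rule rooted_tree_imp_spanning_tree)
  moreover have "degree_in (bip H) F (Inr e) = occ b X e + 1" if e: "e \<in> b ` W" for e
  proof -
    let ?y = "inv_into Y b e"
    have "{f \<in> F. Inr e \<in> gends (bip H) f} = insert (?e ?y) (?e ` {w \<in> X. b w = e})"
      using yq[OF e] Y(2) by (auto simp: bip F_def bij_betw_def inj_on_def)
    \<comment> \<open>Parallel edges in \<open>X\<close> and \<open>Y\<close> would demand opposite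
      inequalities between the ranks of their ends.\<close>
    moreover have "?e ?y \<notin> ?e ` {w \<in> X. b w = e}"
    proof
      assume "?e ?y \<in> ?e ` {w \<in> X. b w = e}"
      then obtain x where "x \<in> X" "a x = a ?y" "b x = b ?y" by auto
      then show False using rkX[of x] rkY[OF yq(1)[OF e]] by simp
    qed
    moreover have "inj_on ?e {w \<in> X. b w = e}" using X(2) by (auto simp: bij_betw_def inj_on_def)
    moreover have "finite X" using fin X(1) by (rule rev_finite_subset)
    ultimately show ?thesis using card_image[of ?e "{w \<in> X. b w = e}"]
      by (simp add: degree_in_def occ_def)
  qed
  ultimately show ?thesis using H by (auto simp: hypertrees_def represents_def intro!: exI[of _ F])
qed

text \<open>The tree is found by searching from the root along all edges from \<open>a\<close>-points to \<open>b\<close>-points,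
  but only along the edges of \<open>X\<close> in the other direction.\<close>

lemma transversal_imp_rooted_pair:
  assumes X: "X \<in> transversals W a r"
    and no_closed: "\<And>S. \<lbrakk>S \<subseteq> b ` W; S \<noteq> {}\<rbrakk> \<Longrightarrow>
      \<exists>w\<in>W. b w \<in> S \<and> (a w = r \<or> (\<exists>x\<in>X. a x = a w \<and> b x \<notin> S))"
  shows "\<exists>Y rk. rooted_pair W a b r X Y rk"
proof -
  have XW: "X \<subseteq> W" and bij: "bij_betw a X (a ` W - {r})" using X by (auto simp: transversals_def)
  define D where "D = {(Inl (a w), Inr (b w)) | w. w \<in> W} \<union> {(Inr (b x), Inl (a x)) | x. x \<in> X}"
  define S where "S = {q \<in> b ` W. (Inl r, Inr q) \<notin> D\<^sup>*}"
  have "S = {}"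
  proof (rule ccontr)
    assume "S \<noteq> {}"
    then obtain w where w: "w \<in> W" "b w \<in> S" "a w = r \<or> (\<exists>x\<in>X. a x = a w \<and> b x \<notin> S)"
      using no_closed[of S] by (auto simp: S_def)
    have "(Inl r, Inl (a w)) \<in> D\<^sup>*"
    proof (cases "a w = r")
      case False
      then obtain x where x: "x \<in> X" "a x = a w" "b x \<notin> S" using w by blast
      then have "(Inl r, Inr (b x)) \<in> D\<^sup>*" using XW by (auto simp: S_def)
      moreover have "(Inr (b x), Inl (a w)) \<in> D" using x by (force simp: D_def)
      ultimately show ?thesis by (rule rtrancl_into_rtrancl)
    qed simp
    moreover have "(Inl (a w), Inr (b w)) \<in> D" using w by (force simp: D_def)
    ultimately have "(Inl r, Inr (b w)) \<in> D\<^sup>*" by (rule rtrancl_into_rtrancl)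
    then show False using w by (simp add: S_def)
  qed
  then have reach_b: "(Inl r, Inr q) \<in> D\<^sup>*" if "q \<in> b ` W" for q using that by (auto simp: S_def)
  have reach_a: "(Inl r, Inl (a x)) \<in> D\<^sup>*" if "x \<in> X" for x
  proof (rule rtrancl_into_rtrancl)
    show "(Inl r, Inr (b x)) \<in> D\<^sup>*" using reach_b that XW by blast
    show "(Inr (b x), Inl (a x)) \<in> D" using that by (force simp: D_def)
  qed
  obtain rk :: "_ \<Rightarrow> nat" where "\<forall>v. (Inl r, v) \<in> D\<^sup>* \<longrightarrow> v \<noteq> Inl r \<longrightarrow> (\<exists>u. (u, v) \<in> D \<and> rk u < rk v)"
    using reachability_rank[of "Inl r" D] ..
  then have pred: "\<exists>u. (u, v) \<in> D \<and> rk u < rk v" if "(Inl r, v) \<in> D\<^sup>*" "v \<noteq> Inl r" for v using that by blast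
  have "\<forall>q\<in>b ` W. \<exists>w. w \<in> W \<and> b w = q \<and> rk (Inl (a w)) < rk (Inr q)"
    using pred[OF reach_b] by (fastforce simp: D_def)
  from bchoice[OF this] obtain y where
    y: "\<forall>q\<in>b ` W. y q \<in> W \<and> b (y q) = q \<and> rk (Inl (a (y q))) < rk (Inr q)" ..
  have "rk (Inr (b x)) < rk (Inl (a x))" if x: "x \<in> X" for x
  proof -
    have "a x \<noteq> r" using bij x by (auto simp: bij_betw_def)
    then obtain x' where "x' \<in> X" "a x' = a x" "rk (Inr (b x')) < rk (Inl (a x))"
      using pred[OF reach_a[OF x]] by (auto simp: D_def)
    then show ?thesis using bij x by (auto simp: bij_betw_def dest: inj_onD)
  qed
  moreover have "bij_betw b (y ` (b ` W)) (b ` W)" using y by (auto simp: bij_betw_def inj_on_def image_image)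
  ultimately have "rooted_pair W a b r X (y ` (b ` W)) rk" using X y by (auto simp: rooted_pair_def)
  then show ?thesis by blast
qed

text \<open>The tree of a hypertree can be rooted at every a-point, which gives the selections for
  all roots. Conversely, one selection extends to a tree unless some \<open>S\<close> is closed, and
  a closed \<open>S\<close> contradicts \<open>profiles_strict\<close>.\<close>

lemma hypertrees_eq_profiles:
  assumes H: "represents H W a b" and fin: "finite W" and ne: "W \<noteq> {}"
  shows "hypertrees H = profiles W a b"
proof (intro set_eqI iffI)
  fix g assume g: "g \<in> hypertrees H"
  then have "g \<in> extensional (b ` W)" using H by (auto simp: hypertrees_def represents_def PiE_def)
  then show "g \<in> profiles W a b"
    using hypertree_imp_rooted_pair[OF H fin g] unfolding profiles_def rooted_pair_def by blast
next
  fix g assume g: "g \<in> profiles W a b"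
  obtain r where r: "r \<in> a ` W" using ne by blast
  obtain X where X: "X \<in> transversals W a r" and gX: "\<And>e. e \<in> b ` W \<Longrightarrow> g e = occ b X e"
    using g r unfolding profiles_def by blast
  have XW: "X \<subseteq> W" using X by (simp add: transversals_def)
  have "\<exists>Y rk. rooted_pair W a b r X Y rk"
  proof (rule transversal_imp_rooted_pair[OF X], rule ccontr)
    fix S assume S: "S \<subseteq> b ` W" "S \<noteq> {}"
      and "\<not> (\<exists>w\<in>W. b w \<in> S \<and> (a w = r \<or> (\<exists>x\<in>X. a x = a w \<and> b x \<notin> S)))"
    then have closed: "a w \<noteq> r \<and> (\<forall>x\<in>X. a x = a w \<longrightarrow> b x \<in> S)" if "w \<in> W" "b w \<in> S" for w using that by blast
    have finX: "finite X" using fin XW by (rule rev_finite_subset)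
    have "a ` {w \<in> W. b w \<in> S} \<subseteq> a ` {x \<in> X. b x \<in> S}"
    proof clarify
      fix w assume w: "w \<in> W" "b w \<in> S"
      then have "a w \<in> a ` X" using closed X by (auto simp: transversals_def bij_betw_def)
      then show "a w \<in> a ` {x \<in> X. b x \<in> S}" using closed[OF w] by (auto simp: image_iff)
    qed
    then have "card (a ` {w \<in> W. b w \<in> S}) \<le> card (a ` {x \<in> X. b x \<in> S})"
      using finX by (intro card_mono) auto
    also have "\<dots> \<le> card {x \<in> X. b x \<in> S}" using finX by (simp add: card_image_le)
    finally show False using profiles_strict[OF fin g XW gX S] by simp
  qed
  then obtain Y rk where "rooted_pair W a b r X Y rk" by blast
  from rooted_pair_imp_hypertree[OF H fin r this] have "restrict (occ b X) (b ` W) \<in> hypertrees H" .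
  moreover have "g = restrict (occ b X) (b ` W)"
    using g gX by (intro extensionalityI[of _ "b ` W"]) (auto simp: profiles_def)
  ultimately show "g \<in> hypertrees H" by simp
qed

section \<open>Spanning arborescences\<close>

text \<open>Once a simple walk has descended to a child it cannot climb back without revisiting the
  parent, so it goes on descending. A walk from \<open>r\<close> begins in this way.\<close>

lemma rooted_tree_walk:
  assumes T: "rooted_tree en V F r par rk"
  shows "\<lbrakk>walk en F u xs v; distinct (u # map snd xs); u \<in> V; \<forall>e\<in>F. en e \<subseteq> V;
    u = r \<or> (\<forall>y. en (par u) = {u, y} \<longrightarrow> y \<notin> snd ` set xs)\<rbrakk> \<Longrightarrow> \<forall>(e, w)\<in>set xs. w \<in> V - {r} \<and> e = par w"
proof (induction xs arbitrary: u)
  case (Cons x xs)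
  obtain e w where x: "x = (e, w)" by (cases x)
  have e: "e \<in> F" "en e = {u, w}" and wk: "walk en F w xs v" using Cons.prems(1) by (auto simp: x)
  have "e \<in> par ` (V - {r})" using T e(1) by (simp add: rooted_tree_def bij_betw_def)
  then obtain z where z: "z \<in> V - {r}" "e = par z" by blast
  then obtain y where y: "en e = {z, y}" "rk y < rk z" using T by (auto simp: rooted_tree_def)
  have zw: "z = w"
  proof (rule ccontr)
    assume "z \<noteq> w"
    then have "z = u" "y = w" using y(1) e(2) by (auto simp: doubleton_eq_iff)
    then show False using Cons.prems(5) z y by (auto simp: x)
  qed
  then have "y = u" using y e(2) by (auto simp: doubleton_eq_iff)
  have "\<forall>(e, w)\<in>set xs. w \<in> V - {r} \<and> e = par w"
  proof (rule Cons.IH[OF wk])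
    show "distinct (w # map snd xs)" "w \<in> V" "\<forall>e\<in>F. en e \<subseteq> V" using Cons.prems e by (auto simp: x)
    have "y' = u" if "en (par w) = {w, y'}" for y'
      using that z zw y \<open>y = u\<close> by (auto simp: doubleton_eq_iff)
    then show "w = r \<or> (\<forall>y. en (par w) = {w, y} \<longrightarrow> y \<notin> snd ` set xs)"
      using Cons.prems(2) by (auto simp: x)
  qed
  then show ?case using z zw by (simp add: x)
qed simp

lemma walk_imp_awalk:
  assumes "walk (gends (underlying D)) F u xs v" "\<forall>(e, w)\<in>set xs. head D e = w"
    "F \<subseteq> arcs D" "u \<in> verts D" "\<forall>e\<in>arcs D. head D e \<in> verts D" "distinct (u # map snd xs)"
  shows "pre_digraph.awalk D u (map fst xs) v"
  using assms
proof (induction xs arbitrary: u)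
  case Nil
  then show ?case by (simp add: pre_digraph.awalk_def pre_digraph.cas.simps)
next
  case (Cons x xs)
  obtain e w where x: "x = (e, w)" by (cases x)
  have e: "e \<in> F" "{tail D e, head D e} = {u, w}" "head D e = w" "u \<noteq> w"
    and wk: "walk (gends (underlying D)) F w xs v" using Cons.prems by (auto simp: x underlying_def)
  have "pre_digraph.awalk D w (map fst xs) v"
    using Cons.prems e wk by (intro Cons.IH) (auto simp: x)
  moreover have "tail D e = u" using e by (auto simp: doubleton_eq_iff)
  ultimately show ?case using e Cons.prems(3,4)
    by (auto simp: x pre_digraph.awalk_def pre_digraph.cas.simps)
qed

text \<open>In the tree rooted at \<open>r\<close>, the walk from \<open>r\<close> to
  \<open>v\<close> ends with the parent edge of \<open>v\<close>, so directed walks force this edge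
  to have head \<open>v\<close>. Thus \<open>head\<close> inverts the parent map, and the rank of
  the tree increases along the arcs.\<close>

lemma spanning_arborescences_iff:
  assumes r: "r \<in> verts D" and wf: "\<forall>e\<in>arcs D. tail D e \<in> verts D \<and> head D e \<in> verts D"
  shows "F \<in> spanning_arborescences D r \<longleftrightarrow>
    F \<subseteq> arcs D \<and> bij_betw (head D) F (verts D - {r}) \<and> (\<exists>rk :: 'v \<Rightarrow> nat. \<forall>e\<in>F. rk (tail D e) < rk (head D e))"
    (is "?L \<longleftrightarrow> ?R")
proof
  let ?G = "underlying D"
  have G: "gverts ?G = verts D" "gedges ?G = arcs D" "gends ?G = (\<lambda>e. {tail D e, head D e})"
    by (simp_all add: underlying_def)
  {
    assume ?L
    then have T: "is_spanning_tree ?G F"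
      and aw: "\<And>v xs. v \<in> verts D \<Longrightarrow> simple_walk (gends ?G) F r xs v \<Longrightarrow> pre_digraph.awalk D r (map fst xs) v"
      by (auto simp: spanning_arborescences_def)
    have F: "F \<subseteq> arcs D" using T G by (auto simp: is_spanning_tree_def)
    have "\<exists>par rk. rooted_tree (gends ?G) (gverts ?G) F r par rk"
      using wf r by (intro spanning_tree_imp_rooted_tree[OF T]) (auto simp: G)
    then obtain par rk where RT: "rooted_tree (gends ?G) (verts D) F r par rk" by (auto simp: G)
    then have bij: "bij_betw par (verts D - {r}) F"
      and par: "\<forall>v\<in>verts D - {r}. \<exists>w\<in>verts D. {tail D (par v), head D (par v)} = {v, w} \<and> rk w < rk v"
      by (simp_all add: rooted_tree_def G)
    have hd: "head D (par v) = v" if v: "v \<in> verts D - {r}" for v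
    proof -
      obtain xs where xs: "simple_walk (gends ?G) F r xs v"
        using T v r unfolding is_spanning_tree_def G(1) by blast
      then have wk: "walk (gends ?G) F r xs v" "distinct (r # map snd xs)" by (auto simp: simple_walk_def)
      have par_xs: "\<forall>(e, w)\<in>set xs. w \<in> verts D - {r} \<and> e = par w"
        using wf F by (intro rooted_tree_walk[OF RT wk r]) (auto simp: G)
      have "xs \<noteq> []" using wk v by auto
      then obtain ys e w where ys: "xs = ys @ [(e, w)]" by (cases xs rule: rev_cases) auto
      then have "w = v" using wk(1) by (auto simp: walk_append)
      then have "e = par v" using par_xs ys by auto
      have "pre_digraph.cas D r (map fst ys @ [e]) v"
        using aw[of v xs] xs v ys by (simp add: pre_digraph.awalk_def)
      then have "head D e = v" by (simp add: pre_digraph.cas_append_iff pre_digraph.cas.simps)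
      then show ?thesis using \<open>e = par v\<close> by simp
    qed
    have img: "F = par ` (verts D - {r})" using bij by (simp add: bij_betw_def)
    have "bij_betw (head D) F (verts D - {r})"
      unfolding img using hd by (auto simp: bij_betw_def inj_on_def image_image)
    moreover have "rk (tail D e) < rk (head D e)" if eF: "e \<in> F" for e
    proof -
      obtain v where v: "v \<in> verts D - {r}" "e = par v" using img eF by blast
      obtain w where "{tail D e, head D e} = {v, w}" "rk w < rk v" using par v by blast
      then show ?thesis using hd[OF v(1)] v(2) by (auto simp: doubleton_eq_iff)
    qed
    ultimately show ?R using F by blast
  }
  {
    assume ?R
    then have F: "F \<subseteq> arcs D" and bij: "bij_betw (head D) F (verts D - {r})"
      and ex: "\<exists>rk :: 'v \<Rightarrow> nat. \<forall>e\<in>F. rk (tail D e) < rk (head D e)" by simp_all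
    from ex obtain rk :: "'v \<Rightarrow> nat" where rk: "\<forall>e\<in>F. rk (tail D e) < rk (head D e)" ..
    define par where "par = inv_into F (head D)"
    have par: "par v \<in> F" "head D (par v) = v" if "v \<in> verts D - {r}" for v
      using that bij unfolding par_def by (auto simp: bij_betw_def intro: inv_into_into f_inv_into_f)
    have "\<exists>w\<in>verts D. {tail D (par v), head D (par v)} = {v, w} \<and> rk w < rk v" if "v \<in> verts D - {r}" for v
      using par[OF that] rk wf F by (intro bexI[of _ "tail D (par v)"]) auto
    moreover have "bij_betw par (verts D - {r}) F" unfolding par_def using bij by (rule bij_betw_inv_into)
    ultimately have RT: "rooted_tree (gends ?G) (gverts ?G) F r par rk"
      using r by (simp add: rooted_tree_def G)
    have "is_spanning_tree ?G F" using F by (intro rooted_tree_imp_spanning_tree[OF RT]) (simp add: G)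
    moreover have "pre_digraph.awalk D r (map fst xs) v" if "simple_walk (gends ?G) F r xs v" for v xs
    proof -
      have wk: "walk (gends ?G) F r xs v" "distinct (r # map snd xs)" using that by (auto simp: simple_walk_def)
      have "\<forall>(e, w)\<in>set xs. w \<in> gverts ?G - {r} \<and> e = par w"
        using wf F r by (intro rooted_tree_walk[OF RT wk]) (auto simp: G)
      then have "\<forall>(e, w)\<in>set xs. head D e = w" using par by (auto simp: G)
      then show ?thesis using wk F r wf by (intro walk_imp_awalk) auto
    qed
    ultimately show ?L by (simp add: spanning_arborescences_def)
  }
qed

section \<open>Counting arborescences by occurrence vectors\<close>

context sphere_map begin

lemma card_arbs:
  assumes r: "r \<in> a ` W"
  shows "card (arbs r) = card (profiles W a b)"
proof (rule bij_betw_same_card)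
  let ?f = "\<lambda>X. restrict (occ b X) (b ` W)"
  have arbs_sub: "X \<in> transversals W a r" if "X \<in> arbs r" for X using that by (simp add: arbs_def)
  have "inj_on ?f (arbs r)"
  proof (rule inj_onI)
    fix X Y assume XY: "X \<in> arbs r" "Y \<in> arbs r" "?f X = ?f Y"
    have "occ b X e = occ b Y e" if "e \<in> b ` W" for e using fun_cong[OF XY(3), of e] that by simp
    then show "X = Y" by (rule arbs_unique[OF XY(1,2) r])
  qed
  moreover have "?f X \<in> profiles W a b" if X: "X \<in> arbs r" for X
  proof -
    \<comment> \<open>A profile needs a selection for every root, whereas \<open>X\<close> serves
      the root \<open>r\<close> only. Completing \<open>X\<close> to a spanning tree, hence to a
      hypertree of this auxiliary hypergraph, allows the tree to be rooted elsewhere.\<close>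
    define H where "H = \<lparr>hverts = a ` W, hedges = b ` W, hinc = \<lambda>q. {p. \<exists>w\<in>W. a w = p \<and> b w = q}\<rparr>"
    have H: "represents H W a b" by (auto simp: represents_def H_def)
    have "\<exists>Y rk. rooted_pair W a b r X Y rk"
    proof (rule transversal_imp_rooted_pair[OF arbs_sub[OF X]], rule ccontr)
      fix S assume S: "S \<subseteq> b ` W" "S \<noteq> {}"
        and *: "\<not> (\<exists>w\<in>W. b w \<in> S \<and> (a w = r \<or> (\<exists>x\<in>X. a x = a w \<and> b x \<notin> S)))"
      obtain w where w: "w \<in> W" "b w \<in> S" using S by blast
      show False by (rule arbs_no_closed_set[OF X w]) (use * in blast)
    qed
    then have "?f X \<in> hypertrees H" using rooted_pair_imp_hypertree[OF H finite_W r] by blast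
    then show ?thesis using hypertrees_eq_profiles[OF H finite_W W_nonempty] by simp
  qed
  moreover have "g \<in> ?f ` arbs r" if g: "g \<in> profiles W a b" for g
  proof -
    obtain X where X: "X \<in> arbs r" "\<forall>e\<in>b ` W. g e = occ b X e" using arbs_exists[OF g r] by blast
    have "g = ?f X" using g X by (intro extensionalityI[of _ "b ` W"]) (auto simp: profiles_def)
    then show ?thesis using X by blast
  qed
  ultimately show "bij_betw ?f (arbs r) (profiles W a b)" unfolding bij_betw_def by blast
qed

lemma arborescence_number_eq_card_profiles:
  assumes D: "verts D = a ` W" "arcs D = \<epsilon> ` W" and inj: "inj_on \<epsilon> W"
    and hd: "\<And>w. w \<in> W \<Longrightarrow> head D (\<epsilon> w) = a w" and tl: "\<And>w. w \<in> W \<Longrightarrow> tail D (\<epsilon> w) = a (\<alpha> w)"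
  shows "arborescence_number D = card (profiles W a b)"
proof -
  have "card (spanning_arborescences D r) = card (profiles W a b)" if r: "r \<in> verts D" for r
  proof -
    have wf: "\<forall>e\<in>arcs D. tail D e \<in> verts D \<and> head D e \<in> verts D" using hd tl a\<alpha> by (auto simp: D)
    have iff: "\<epsilon> ` X \<in> spanning_arborescences D r \<longleftrightarrow> X \<in> arbs r" if X: "X \<subseteq> W" for X
    proof -
      have "bij_betw (head D) (\<epsilon> ` X) (verts D - {r}) \<longleftrightarrow> bij_betw a X (a ` W - {r})"
      proof -
        have "head D ` \<epsilon> ` X = a ` X" using hd X by (force simp: image_image intro!: image_cong)
        moreover have "inj_on (head D) (\<epsilon> ` X) \<longleftrightarrow> inj_on a X"
        proof -
          have "inj_on (head D) (\<epsilon> ` X) \<longleftrightarrow> inj_on (head D \<circ> \<epsilon>) X"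
            using inj_on_subset[OF inj X] by (auto simp: inj_on_def)
          moreover have "inj_on (head D \<circ> \<epsilon>) X \<longleftrightarrow> inj_on a X"
            using hd X by (intro inj_on_cong) auto
          ultimately show ?thesis by simp
        qed
        ultimately show ?thesis by (simp add: bij_betw_def D)
      qed
      moreover have "(\<forall>e\<in>\<epsilon> ` X. rk (tail D e) < rk (head D e)) \<longleftrightarrow> (\<forall>x\<in>X. rk (a (\<alpha> x)) < rk (a x))" for rk :: "'p \<Rightarrow> nat"
        using hd tl X by (auto simp: subset_iff)
      ultimately show ?thesis using X
        unfolding spanning_arborescences_iff[OF r wf] arbs_def transversals_def by (auto simp: D)
    qed
    have "bij_betw ((`) \<epsilon>) (arbs r) (spanning_arborescences D r)"
    proof (rule bij_betw_imageI)
      show "inj_on ((`) \<epsilon>) (arbs r)"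
      proof (rule inj_onI)
        fix X Y assume "X \<in> arbs r" "Y \<in> arbs r" "\<epsilon> ` X = \<epsilon> ` Y"
        then show "X = Y" using inj_on_image_eq_iff[OF inj] by (auto simp: arbs_def transversals_def)
      qed
      show "(`) \<epsilon> ` arbs r = spanning_arborescences D r"
      proof (intro set_eqI iffI)
        fix F assume "F \<in> (`) \<epsilon> ` arbs r"
        then show "F \<in> spanning_arborescences D r" using iff by (auto simp: arbs_def transversals_def)
      next
        fix F assume F: "F \<in> spanning_arborescences D r"
        then have "F \<subseteq> \<epsilon> ` W" unfolding spanning_arborescences_iff[OF r wf] by (simp add: D)
        then obtain X where "X \<subseteq> W" "F = \<epsilon> ` X" by (auto simp: subset_image_iff)
        then show "F \<in> (`) \<epsilon> ` arbs r" using iff F by auto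
      qed
    qed
    from bij_betw_same_card[OF this] show ?thesis using card_arbs r by (simp add: D)
  qed
  moreover have "verts D \<noteq> {}" using W_nonempty D by simp
  ultimately show ?thesis unfolding arborescence_number_def by (intro the_equality) auto
qed

end

section \<open>Complementary spanning trees\<close>

context sphere_map begin

text \<open>Crossing the \<alpha>-edge and returning across a \<gamma>-edge (round a b-point) or a
  \<beta>-edge (round a c-point) permutes the white triangles there, and
  \<open>a (\<alpha> w)\<close> is the a-point of the image of \<open>w\<close>. Consequently the
  differences of \<open>h\<close> along the arcs of the dual form a flow in
  \<open>G\<^sub>a\<close>.\<close>

lemma sum_across_\<alpha>:
  fixes h :: "'p \<Rightarrow> int"
  shows "(\<Sum>w | w \<in> W \<and> b w = e. h (a (\<alpha> w))) = (\<Sum>w | w \<in> W \<and> b w = e. h (a w))"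
    and "(\<Sum>w | w \<in> W \<and> c w = e. h (a (\<alpha> w))) = (\<Sum>w | w \<in> W \<and> c w = e. h (a w))"
proof -
  have *: "(\<Sum>w | w \<in> W \<and> f w = e. h (a (\<alpha> w))) = (\<Sum>w | w \<in> W \<and> f w = e. h (a w))"
    if \<delta>: "bij_betw \<delta> W Bl" "\<And>w. w \<in> W \<Longrightarrow> a (\<delta> w) = a w" "\<And>w. w \<in> W \<Longrightarrow> f (\<delta> w) = f w"
      "\<And>w. w \<in> W \<Longrightarrow> f (\<alpha> w) = f w" for \<delta> and f :: "'t \<Rightarrow> 'p"
  proof -
    obtain s where s: "bij_betw s W W" "\<And>w w'. w \<in> W \<Longrightarrow> w' \<in> W \<Longrightarrow> \<alpha> w = \<delta> w' \<longleftrightarrow> w' = s w"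
      using bij_transfer[OF bij_\<alpha> \<delta>(1)] by blast
    have sW: "s w \<in> W" if "w \<in> W" for w using s(1) that by (auto simp: bij_betw_def)
    have s\<delta>: "\<delta> (s w) = \<alpha> w" if "w \<in> W" for w using s(2)[OF that sW[OF that]] by simp
    have as: "a (s w) = a (\<alpha> w)" "f (s w) = f w" if "w \<in> W" for w
      using \<delta>(2,3)[OF sW[OF that]] \<delta>(4)[OF that] s\<delta>[OF that] by simp_all
    have surj: "\<exists>w'. w' \<in> W \<and> s w' = w" if "w \<in> W" for w
    proof -
      have "w \<in> s ` W" using s(1) that by (simp add: bij_betw_def)
      then show ?thesis by blast
    qed
    have "bij_betw s {w \<in> W. f w = e} {w \<in> W. f w = e}"
    proof (rule bij_betw_imageI)
      show "inj_on s {w \<in> W. f w = e}" using s(1) by (auto simp: bij_betw_def inj_on_def)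
      show "s ` {w \<in> W. f w = e} = {w \<in> W. f w = e}"
      proof (intro equalityI subsetI)
        fix w assume w: "w \<in> {w \<in> W. f w = e}"
        then obtain w' where "w' \<in> W" "s w' = w" using surj by blast
        then show "w \<in> s ` {w \<in> W. f w = e}" using w as by auto
      qed (use as sW in auto)
    qed
    from sum.reindex_bij_betw[OF this, of "\<lambda>w. h (a w)"] show ?thesis using as by simp
  qed
  show "(\<Sum>w | w \<in> W \<and> b w = e. h (a (\<alpha> w))) = (\<Sum>w | w \<in> W \<and> b w = e. h (a w))"
    by (rule *[OF bij_\<gamma> a_\<gamma> b_\<gamma> b_\<alpha>])
  show "(\<Sum>w | w \<in> W \<and> c w = e. h (a (\<alpha> w))) = (\<Sum>w | w \<in> W \<and> c w = e. h (a w))"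
    by (rule *[OF bij_\<beta> a_\<beta> c_\<beta> c_\<alpha>])
qed

definition boundary :: "('t \<Rightarrow> int) \<Rightarrow> 'p \<Rightarrow> int" where
  "boundary k r = (\<Sum>w\<in>W. k w * (of_bool (a w = r) - of_bool (a (\<alpha> w) = r)))"

lemma boundary_alt:
  "boundary k r = sum k {w \<in> W. a w = r} - sum k {w \<in> W. a (\<alpha> w) = r}"
proof -
  have "sum k {w \<in> W. Q w} = (\<Sum>w\<in>W. k w * of_bool (Q w))" for Q
    unfolding sum.inter_filter[OF finite_W] by (intro sum.cong) auto
  then show ?thesis by (simp only: boundary_def right_diff_distrib sum_subtractf)
qed

lemma chain_exists:
  assumes "(u, v) \<in> (adj (\<lambda>w. {a w, a (\<alpha> w)}) P)\<^sup>*" and P: "P \<subseteq> W"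
  shows "\<exists>k. (\<forall>w. w \<notin> P \<longrightarrow> k w = 0) \<and> (\<forall>r. boundary k r = of_bool (u = r) - of_bool (v = r))"
  using assms(1)
proof induction
  case base
  show ?case by (rule exI[of _ "\<lambda>_. 0"]) (simp add: boundary_def)
next
  case (step y z)
  then obtain k where k: "\<forall>w. w \<notin> P \<longrightarrow> k w = 0" "\<forall>r. boundary k r = of_bool (u = r) - of_bool (y = r)" by blast
  obtain w where w: "w \<in> P" "{a w, a (\<alpha> w)} = {y, z}" using step(2) by (auto simp: adj_def)
  \<comment> \<open>As \<open>boundary\<close> counts heads positively, an arc passed from its head
    to its tail enters the chain with sign +1.\<close>
  define s :: int where "s = (if a w = y \<and> a (\<alpha> w) = z then 1 else - 1)"
  have s: "s * (of_bool (a w = r) - of_bool (a (\<alpha> w) = r)) = of_bool (y = r) - of_bool (z = r)" for r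
    using w(2) by (auto simp: s_def doubleton_eq_iff)
  define k' where "k' x = k x + (if x = w then s else 0)" for x
  have "boundary k' r = boundary k r + s * (of_bool (a w = r) - of_bool (a (\<alpha> w) = r))" for r
  proof -
    have "(\<Sum>x\<in>W. (if x = w then s else 0) * (of_bool (a x = r) - of_bool (a (\<alpha> x) = r))) =
      (\<Sum>x\<in>W. if x = w then s * (of_bool (a w = r) - of_bool (a (\<alpha> w) = r)) else 0)"
      by (intro sum.cong) auto
    also have "\<dots> = s * (of_bool (a w = r) - of_bool (a (\<alpha> w) = r))" using w P finite_W by (subst sum.delta) auto
    finally show ?thesis unfolding boundary_def k'_def by (simp only: distrib_right sum.distrib)
  qed
  then have "\<forall>r. boundary k' r = of_bool (u = r) - of_bool (z = r)" using k s by simp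
  moreover have "\<forall>x. x \<notin> P \<longrightarrow> k' x = 0" using k w by (auto simp: k'_def)
  ultimately show ?case by blast
qed

text \<open>Consider an edge with nonzero flow that is furthest from the root.\<close>

lemma flow_on_tree_zero:
  fixes k :: "'t \<Rightarrow> int"
  assumes T: "rooted_pair W c b q X Y rk" and supp: "\<And>w. w \<in> W \<Longrightarrow> w \<notin> X \<union> Y \<Longrightarrow> k w = 0"
    and b0: "\<And>e. sum k {w \<in> W. b w = e} = 0" and c0: "\<And>e. sum k {w \<in> W. c w = e} = 0"
    and w: "w \<in> W"
  shows "k w = 0"
proof (rule ccontr)
  assume "k w \<noteq> 0"
  \<comment> \<open>The rank of the vertex whose parent edge \<open>w\<close> is. Any other tree
    edge at this vertex is the parent edge of a child, of larger rank; so where the rank is largest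
    among edges with nonzero flow, conservation leaves a single term.\<close>
  define crk where "crk w = (if w \<in> X then rk (Inl (c w)) else rk (Inr (b w)))" for w
  note rkX = rooted_pairD(5)[OF T] and rkY = rooted_pairD(6)[OF T]
  have inj: "inj_on c X" "inj_on b Y" using rooted_pairD(3,4)[OF T] by (simp_all add: bij_betw_def)
  define N where "N = {w \<in> W. k w \<noteq> 0}"
  have N: "finite N" "N \<noteq> {}" using finite_W w \<open>k w \<noteq> 0\<close> by (auto simp: N_def)
  have "Max (crk ` N) \<in> crk ` N" using N by (intro Max_in) auto
  then obtain m where m: "m \<in> N" "crk m = Max (crk ` N)" by auto
  have max: "crk w \<le> crk m" if "w \<in> N" for w using m(2) N(1) that by simp
  have mW: "m \<in> W" "k m \<noteq> 0" "m \<in> X \<or> m \<in> Y" using m(1) supp[of m] by (auto simp: N_def)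
  show False
  proof (cases "m \<in> X")
    case True
    have "k w = 0" if "w \<in> {w \<in> W. c w = c m}" "w \<noteq> m" for w
    proof (rule ccontr)
      assume "k w \<noteq> 0"
      then have wN: "w \<in> N" "w \<in> X \<or> w \<in> Y" using that supp[of w] by (auto simp: N_def)
      have "w \<notin> X" using inj_onD[OF inj(1), of w m] that True by auto
      then have "crk w > crk m" using rkY[of w] wN True that by (simp add: crk_def)
      then show False using max[OF wN(1)] by simp
    qed
    then have "sum k {w \<in> W. c w = c m} = k m"
      using finite_W mW by (subst sum.remove[of _ m]) (auto intro!: sum.neutral)
    then show False using c0[of "c m"] mW by simp
  next
    case False
    then have mY: "m \<in> Y" using mW by blast
    have "k w = 0" if "w \<in> {w \<in> W. b w = b m}" "w \<noteq> m" for w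
    proof (rule ccontr)
      assume "k w \<noteq> 0"
      then have wN: "w \<in> N" "w \<in> X \<or> w \<in> Y" using that supp[of w] by (auto simp: N_def)
      have "w \<notin> Y" using inj_onD[OF inj(2), of w m] that mY by auto
      then have "crk w > crk m" using rkX[of w] wN False that by (simp add: crk_def)
      then show False using max[OF wN(1)] by simp
    qed
    then have "sum k {w \<in> W. b w = b m} = k m"
      using finite_W mW by (subst sum.remove[of _ m]) (auto intro!: sum.neutral)
    then show False using b0[of "b m"] mW by simp
  qed
qed

lemma potential_on_tree_constant:
  assumes T: "rooted_pair W c b q X Y rk" and eq: "\<And>w. w \<in> X \<union> Y \<Longrightarrow> u (b w) = u (c w)" and w: "w \<in> W"
  shows "u (b w) = u (c w)"
proof -
  note X = rooted_pairD(3)[OF T] and Y = rooted_pairD(4,1,2)[OF T]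
    and rkX = rooted_pairD(5)[OF T] and rkY = rooted_pairD(6)[OF T]
  have "\<forall>v \<in> Inl ` c ` W \<union> Inr ` b ` W. rk v = n \<longrightarrow> case_sum u u v = u q" for n
  proof (induction n rule: less_induct)
    case (less n)
    show ?case
    proof (intro ballI impI)
      fix v assume v: "v \<in> Inl ` c ` W \<union> Inr ` b ` W" "rk v = n"
      show "case_sum u u v = u q"
      proof (cases v)
        case (Inl p)
        show ?thesis
        proof (cases "p = q")
          case False
          then have "p \<in> c ` X" using v Inl X by (auto simp: bij_betw_def)
          then obtain x where x: "x \<in> X" "p = c x" by blast
          then have "u (b x) = u q" using less[of "rk (Inr (b x))"] rkX[of x] v Inl Y by fastforce
          then show ?thesis using eq[of x] x Inl by simp
        qed (simp add: Inl)
      next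
        case (Inr e)
        then have "e \<in> b ` Y" using v Y by (auto simp: bij_betw_def)
        then obtain y where y: "y \<in> Y" "e = b y" by blast
        then have "u (c y) = u q" using less[of "rk (Inl (c y))"] rkY[of y] v Inr Y by fastforce
        then show ?thesis using eq[of y] y Inr by simp
      qed
    qed
  qed
  then have "case_sum u u v = u q" if "v \<in> Inl ` c ` W \<union> Inr ` b ` W" for v using that by blast
  from this[of "Inl (c w)"] this[of "Inr (b w)"] show ?thesis using w by simp
qed

text \<open>The indicator of the points reachable from \<open>r\<close> does not change along arcs
  that avoid the tree, so its differences are supported on the tree, and they form a flow by
  \<open>sum_across_\<alpha>\<close>. Such a flow is 0, so no arc at all leaves the reachable
  set.\<close>

lemma complement_of_tree_connected:
  assumes T: "rooted_pair W c b q X Y rk" and r: "r \<in> a ` W" "r' \<in> a ` W"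
  shows "(r, r') \<in> (adj (\<lambda>w. {a w, a (\<alpha> w)}) (W - (X \<union> Y)))\<^sup>*"
proof -
  interpret rot: sphere_map W Bl b c a \<beta> \<gamma> \<alpha> by (rule sphere_map_rotate)
  let ?D = "adj (\<lambda>w. {a w, a (\<alpha> w)}) (W - (X \<union> Y))"
  define R where "R = {r'. (r, r') \<in> ?D\<^sup>*}"
  define k :: "'t \<Rightarrow> int" where "k w = of_bool (a w \<in> R) - of_bool (a (\<alpha> w) \<in> R)" for w
  have "k w = 0" if "w \<in> W" "w \<notin> X \<union> Y" for w
  proof -
    have "(a w, a (\<alpha> w)) \<in> ?D" "(a (\<alpha> w), a w) \<in> ?D" using that by (auto simp: adj_def insert_commute)
    then have "a w \<in> R \<longleftrightarrow> a (\<alpha> w) \<in> R" unfolding R_def by (auto intro: rtrancl_into_rtrancl)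
    then show ?thesis by (simp add: k_def)
  qed
  moreover have "sum k {w \<in> W. b w = e} = 0" "sum k {w \<in> W. c w = e} = 0" for e
    using sum_across_\<alpha>[of "\<lambda>r. of_bool (r \<in> R)" e] by (simp_all add: k_def sum_subtractf)
  ultimately have "k w = 0" if "w \<in> W" for w using flow_on_tree_zero[OF T _ _ _ that] by blast
  then have *: "(a w \<in> R) = (a (\<alpha> w) \<in> R)" if "w \<in> W" for w using that by (force simp: k_def)
  have "(a w \<in> R) = (a w' \<in> R)" if "w \<in> W" "w' \<in> W" for w w'
    by (rule rot.constant_across_\<gamma>[where f = "\<lambda>r. r \<in> R", OF * that])
  moreover have "r \<in> R" by (simp add: R_def)
  ultimately have "r' \<in> R" using r by blast
  then show ?thesis by (simp add: R_def)
qed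

text \<open>The edges of \<open>G\<^sub>a\<close> outside a spanning tree form a spanning tree of the dual; directed away
  from the root, each of its edges is replaced by the edge of \<open>G\<^sub>c\<close> at its far end that lies in the
  same triangle.\<close>

lemma complementary_profile:
  assumes f: "f \<in> profiles W c b"
  shows "restrict (\<lambda>e. card {w \<in> W. b w = e} - 1 - f e) (b ` W) \<in> profiles W a b"
    and "\<And>e. e \<in> b ` W \<Longrightarrow> f e < card {w \<in> W. b w = e}"
proof -
  define H where "H = \<lparr>hverts = c ` W, hedges = b ` W, hinc = \<lambda>q. {p. \<exists>w\<in>W. c w = p \<and> b w = q}\<rparr>"
  have H: "represents H W c b" by (auto simp: represents_def H_def)
  obtain q where q: "q \<in> c ` W" using W_nonempty by blast
  obtain X Y rk where T: "rooted_pair W c b q X Y rk" and fX: "\<forall>e\<in>b ` W. f e = occ b X e"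
    using hypertree_imp_rooted_pair[OF H finite_W _ q] hypertrees_eq_profiles[OF H finite_W W_nonempty] f by blast
  note XW = rooted_pairD(1)[OF T] and YW = rooted_pairD(2)[OF T] and Y = rooted_pairD(4)[OF T]
    and rkX = rooted_pairD(5)[OF T] and rkY = rooted_pairD(6)[OF T]
  have disj: "X \<inter> Y = {}" using rkX rkY by fastforce
  define A where "A = W - (X \<union> Y)"
  have AW: "A \<subseteq> W" by (auto simp: A_def)
  have fin: "finite X" "finite Y" "finite A" using finite_W XW YW AW by (auto intro: finite_subset)
  \<comment> \<open>At \<open>e\<close> the tree has one edge of \<open>Y\<close> and
    \<open>f e\<close> edges of \<open>X\<close>. This is the origin of \<open>- 1 - f e\<close> and
    shows that the subtraction does not truncate.\<close>
  have split: "card {w \<in> W. b w = e} = card {w \<in> A. b w = e} + 1 + f e" if e: "e \<in> b ` W" for e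
  proof -
    have "{w \<in> W. b w = e} = {w \<in> A. b w = e} \<union> ({w \<in> Y. b w = e} \<union> {w \<in> X. b w = e})"
      using XW YW by (auto simp: A_def)
    then have "card {w \<in> W. b w = e} = card {w \<in> A. b w = e} + card ({w \<in> Y. b w = e} \<union> {w \<in> X. b w = e})"
      using fin by (simp only:) (subst card_Un_disjoint, auto simp: A_def)
    also have "card ({w \<in> Y. b w = e} \<union> {w \<in> X. b w = e}) = card {w \<in> Y. b w = e} + card {w \<in> X. b w = e}"
      using fin disj by (subst card_Un_disjoint) auto
    also have "card {w \<in> Y. b w = e} = 1" using card_fibre[OF Y, of e] e by simp
    finally show ?thesis using bspec[OF fX e] by (simp add: occ_def)
  qed
  then show "f e < card {w \<in> W. b w = e}" if "e \<in> b ` W" for e using that by simp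
  have "\<exists>Z\<in>transversals W a r. \<forall>e\<in>b ` W. card {w \<in> W. b w = e} - 1 - f e = occ b Z e" if r: "r \<in> a ` W" for r
  proof -
    let ?en = "\<lambda>w. {a w, a (\<alpha> w)}"
    have "\<exists>par (rk :: 'p \<Rightarrow> nat). \<forall>v\<in>a ` W - {r}. par v \<in> A \<and> (\<exists>w\<in>a ` W. ?en (par v) = {v, w} \<and> rk w < rk v)"
      using complement_of_tree_connected[OF T r] a\<alpha> AW unfolding A_def[symmetric]
      by (intro parents_exist) auto
    then obtain par and rk' :: "'p \<Rightarrow> nat" where
      par: "\<forall>v\<in>a ` W - {r}. par v \<in> A \<and> (\<exists>w\<in>a ` W. ?en (par v) = {v, w} \<and> rk' w < rk' v)" by blast
    have inj: "inj_on par (a ` W - {r})" using par by (intro inj_on_parents[of _ ?en par rk']) blast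
    define P where "P = par ` (a ` W - {r})"
    have PA: "P \<subseteq> A" using par by (auto simp: P_def)
    \<comment> \<open>An arc of \<open>A\<close> outside the dual tree \<open>P\<close> would close
      a cycle with it. The potential of this cycle is constant along the tree
      \<open>X \<union> Y\<close>, which the cycle does not cross, hence constant altogether; but it
      jumps by 1 across \<open>y\<close>.\<close>
    have "y \<in> P" if y: "y \<in> A" for y
    proof (rule ccontr)
      assume yP: "y \<notin> P"
      have yW: "y \<in> W" using y AW by blast
      have toroot: "(v, r) \<in> (adj ?en P)\<^sup>*" if "v \<in> a ` W" for v
        unfolding P_def using par that by (intro parents_connected[of _ _ _ _ rk']) blast+
      have "(a y, a (\<alpha> y)) \<in> (adj ?en P)\<^sup>*"
        using toroot[of "a y"] adj_rtrancl_sym[OF toroot[OF a\<alpha>[OF yW]]] yW by (meson imageI rtrancl_trans)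
      then obtain k where k: "\<forall>w. w \<notin> P \<longrightarrow> k w = 0"
        "\<forall>r. boundary k r = of_bool (a y = r) - of_bool (a (\<alpha> y) = r)"
        using chain_exists PA AW by (meson subset_trans)
      define k' :: "'t \<Rightarrow> int" where "k' w = (if w = y then 1 else 0) - k w" for w
      have "boundary k' v = 0" for v
      proof -
        have "(\<Sum>x\<in>W. (if x = y then 1 else 0) * (of_bool (a x = v) - of_bool (a (\<alpha> x) = v) :: int)) =
            (\<Sum>x\<in>W. if x = y then of_bool (a y = v) - of_bool (a (\<alpha> y) = v) else 0)"
          by (intro sum.cong) auto
        also have "\<dots> = of_bool (a y = v) - of_bool (a (\<alpha> y) = v)" using yW finite_W by (subst sum.delta) auto
        finally have "boundary k' v = of_bool (a y = v) - of_bool (a (\<alpha> y) = v) - boundary k v"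
          unfolding boundary_def k'_def by (simp only: left_diff_distrib sum_subtractf)
        then show ?thesis using k(2) by simp
      qed
      then obtain u where u: "\<forall>w\<in>W. k' w = u (b w) - u (c w)"
        using circulation_potential[of k'] unfolding boundary_alt by auto
      have "u (b w) = u (c w)" if "w \<in> X \<union> Y" for w
      proof -
        have "w \<in> W" "w \<notin> P" "w \<noteq> y" using that PA y XW YW by (auto simp: A_def)
        then show ?thesis using u k by (force simp: k'_def)
      qed
      then have "u (b y) = u (c y)" using potential_on_tree_constant[OF T _ yW] by blast
      then show False using u k yP yW by (force simp: k'_def)
    qed
    then have PA: "P = A" using PA by blast
    \<comment> \<open>A parent arc that leaves \<open>v\<close> instead of entering it is exchanged
      for a white triangle at \<open>v\<close> with the same b-point, so the counts at the b-points
      remain those of \<open>A\<close>.\<close>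
    define \<phi> where "\<phi> v = (if a (par v) = v then par v else inv_into W \<gamma> (\<alpha> (par v)))" for v
    have \<phi>: "\<phi> v \<in> W" "a (\<phi> v) = v" "b (\<phi> v) = b (par v)" if v: "v \<in> a ` W - {r}" for v
    proof -
      have pW: "par v \<in> W" using par v AW by blast
      obtain w where w: "w \<in> W" "\<gamma> w = \<alpha> (par v)" using \<gamma>_surj[OF pW] by blast
      have inv: "inv_into W \<gamma> (\<alpha> (par v)) = w" using w bij_\<gamma> by (metis bij_betw_inv_into_left)
      have "v \<in> {a (par v), a (\<alpha> (par v))}" using par v by auto
      then have "a w = v" if "a (par v) \<noteq> v" using that a_\<gamma>[OF w(1)] w by auto
      moreover have "b w = b (par v)" using b_\<gamma>[OF w(1)] b_\<alpha>[OF pW] w by simp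
      ultimately show "\<phi> v \<in> W" "a (\<phi> v) = v" "b (\<phi> v) = b (par v)" using pW w inv by (auto simp: \<phi>_def)
    qed
    define Z where "Z = \<phi> ` (a ` W - {r})"
    have "bij_betw a Z (a ` W - {r})" unfolding Z_def using \<phi> by (auto simp: bij_betw_def inj_on_def image_image)
    then have "Z \<in> transversals W a r" using \<phi>(1) by (auto simp: transversals_def Z_def)
    moreover have "card {w \<in> W. b w = e} - 1 - f e = occ b Z e" if e: "e \<in> b ` W" for e
    proof -
      let ?V = "{v \<in> a ` W - {r}. b (par v) = e}"
      have "{z \<in> Z. b z = e} = \<phi> ` ?V" using \<phi> by (auto simp: Z_def)
      moreover have "inj_on \<phi> ?V" using \<phi>(2) by (intro inj_on_inverseI[of _ a]) auto
      moreover have "{w \<in> A. b w = e} = par ` ?V" unfolding PA[symmetric] P_def by auto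
      moreover have "inj_on par ?V" using inj by (rule inj_on_subset) auto
      ultimately have "occ b Z e = card {w \<in> A. b w = e}" by (simp add: occ_def card_image)
      then show ?thesis using split[OF e] by simp
    qed
    ultimately show ?thesis by blast
  qed
  then show "restrict (\<lambda>e. card {w \<in> W. b w = e} - 1 - f e) (b ` W) \<in> profiles W a b"
    by (auto simp: profiles_def)
qed

lemma finite_profiles: "finite (profiles W a b)"
proof (rule finite_subset)
  show "profiles W a b \<subseteq> PiE (b ` W) (\<lambda>_. {..card W})"
  proof
    fix g assume g: "g \<in> profiles W a b"
    obtain r where "r \<in> a ` W" using W_nonempty by blast
    then obtain X where X: "X \<in> transversals W a r" "\<forall>e\<in>b ` W. g e = occ b X e"
      using g unfolding profiles_def by blast
    have "occ b X e \<le> card W" for e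
      unfolding occ_def using X finite_W by (intro card_mono) (auto simp: transversals_def)
    then show "g \<in> PiE (b ` W) (\<lambda>_. {..card W})" using g X by (auto simp: profiles_def PiE_def)
  qed
  show "finite (PiE (b ` W) (\<lambda>_. {..card W}))" using finite_W by (intro finite_PiE) auto
qed

text \<open>By the second part of \<open>complementary_profile\<close> no subtraction truncates, so
  passing to the complement is injective. Exchanging \<open>a\<close> and \<open>c\<close> later
  gives the reverse inequality.\<close>

lemma card_profiles_le:
  "card (profiles W c b) \<le> card (profiles W a b)"
proof (rule card_inj_on_le[OF _ _ finite_profiles])
  let ?\<Phi> = "\<lambda>f. restrict (\<lambda>e. card {w \<in> W. b w = e} - 1 - f e) (b ` W)"
  show "?\<Phi> ` profiles W c b \<subseteq> profiles W a b" using complementary_profile(1) by blast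
  show "inj_on ?\<Phi> (profiles W c b)"
  proof (rule inj_onI)
    fix f g assume fg: "f \<in> profiles W c b" "g \<in> profiles W c b" "?\<Phi> f = ?\<Phi> g"
    show "f = g"
    proof (rule extensionalityI[of _ "b ` W"])
      show "f \<in> extensional (b ` W)" "g \<in> extensional (b ` W)" using fg by (auto simp: profiles_def)
      fix e assume e: "e \<in> b ` W"
      show "f e = g e" using fun_cong[OF fg(3), of e] e complementary_profile(2)[OF fg(1) e]
          complementary_profile(2)[OF fg(2) e] by simp
    qed
  qed
qed

end

lemma (in sphere_map) card_profiles_eq: "card (profiles W c b) = card (profiles W a b)"
proof (rule antisym[OF card_profiles_le])
  interpret rev: sphere_map W Bl c b a \<gamma> \<beta> \<alpha>
    by (rule sphere_map.sphere_map_swap[OF sphere_map_rotate])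
  show "card (profiles W a b) \<le> card (profiles W c b)" by (rule rev.card_profiles_le)
qed

section \<open>Triangulations of the sphere\<close>

lemma triangle_side:
  fixes a b c :: "real^2"
  assumes nc: "\<not> collinear {a, b, c}"
  shows "closed_segment a b face_of convex hull {a, b, c}" "c \<notin> closed_segment a b"
    "closed_segment a b \<subseteq> convex hull {a, b, c}"
    "closed_segment a b \<inter> interior (convex hull {a, b, c}) = {}"
proof -
  have ind: "\<not> affine_dependent {a, b, c}" using nc by (simp add: collinear_3_eq_affine_dependent)
  show face: "closed_segment a b face_of convex hull {a, b, c}"
    unfolding face_of_convex_hull_affine_independent[OF ind] segment_convex_hull
    by (rule exI[of _ "{a, b}"]) auto
  show c: "c \<notin> closed_segment a b"
  proof
    assume "c \<in> closed_segment a b"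
    then have "between (a, b) c" by (simp add: between_mem_segment)
    then have "collinear {a, c, b}" by (rule between_imp_collinear)
    then show False using nc by (simp add: insert_commute)
  qed
  show "closed_segment a b \<subseteq> convex hull {a, b, c}" using face by (rule face_of_imp_subset)
  have "c \<in> convex hull {a, b, c}" by (simp add: hull_inc)
  then show "closed_segment a b \<inter> interior (convex hull {a, b, c}) = {}"
    using c face by (intro face_of_disjoint_interior) auto
qed

text \<open>Removing the antipode of \<open>p\<close> turns the sphere into a plane, where a ball
  minus its centre is connected.\<close>

lemma sphere_punctured_neighbourhood:
  fixes p :: "real^3"
  assumes O: "openin (top_of_set (sphere 0 1)) U" and p: "p \<in> U"
  obtains N where "openin (top_of_set (sphere 0 1)) N" "p \<in> N" "N \<subseteq> U" "connected (N - {p})"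
proof -
  let ?S = "sphere (0 :: real^3) 1"
  have pS: "p \<in> ?S" using O p openin_subset by fastforce
  define q where "q = - p"
  have "p - q = 2 *\<^sub>R p" by (simp add: q_def scaleR_2)
  then have q: "q \<in> ?S" "q \<noteq> p" using pS by (auto simp: q_def)
  have "(?S - {q}) homeomorphic (UNIV :: (real^2) set)"
    by (rule homeomorphic_punctured_sphere_affine) (use q in auto)
  then obtain f g where fg: "homeomorphism (?S - {q}) (UNIV :: (real^2) set) f g"
    by (auto simp: homeomorphic_def)
  have openS: "openin (top_of_set ?S) (?S - {q})" by (simp add: openin_delete)
  have "openin (top_of_set (?S - {q})) (U - {q})"
  proof (rule openin_subset_trans)
    show "openin (top_of_set ?S) (U - {q})" using O by (rule openin_delete)
    show "U - {q} \<subseteq> ?S - {q}" using openin_imp_subset[OF O] by blast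
  qed blast
  then have "openin (top_of_set UNIV) (f ` (U - {q}))" by (rule homeomorphism_imp_open_map[OF fg])
  then have "open (f ` (U - {q}))" by simp
  moreover have "f p \<in> f ` (U - {q})" using p q by blast
  ultimately obtain e where e: "e > 0" "ball (f p) e \<subseteq> f ` (U - {q})" by (meson open_contains_ball)
  have gf: "g (f x) = x" if "x \<in> ?S - {q}" for x using fg that by (auto simp: homeomorphism_def)
  have US: "U \<subseteq> ?S" using O openin_imp_subset by blast
  have contg: "continuous_on UNIV g" using fg by (simp add: homeomorphism_def)
  show thesis
  proof
    show "openin (top_of_set ?S) (g ` ball (f p) e)"
    proof (rule openin_trans[OF _ openS])
      have "openin (top_of_set UNIV) (ball (f p) e)" by simp
      then show "openin (top_of_set (?S - {q})) (g ` ball (f p) e)"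
        by (rule homeomorphism_imp_open_map[OF homeomorphism_symD[OF fg]])
    qed
    show "p \<in> g ` ball (f p) e" using gf[of p] pS q e(1) by (intro image_eqI[of _ _ "f p"]) auto
    show "g ` ball (f p) e \<subseteq> U" using e(2) gf US by fastforce
    have inj: "g y = p \<longleftrightarrow> y = f p" for y using fg gf[of p] pS q by (auto simp: homeomorphism_def)
    have "g ` ball (f p) e - {p} = g ` (ball (f p) e - {f p})" using inj by auto
    moreover have "connected (ball (f p) e - {f p})"
      by (rule connected_punctured_ball) simp
    ultimately show "connected (g ` ball (f p) e - {p})"
      using contg by (metis connected_continuous_image continuous_on_subset subset_UNIV)
  qed
qed

locale triangulation =
  fixes P :: "(real^3) set" and E F :: "(real^3) set set"
  assumes triangulation: "sphere_triangulation P E F"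
begin

abbreviation "S \<equiv> sphere (0 :: real^3) 1"

lemma triangulationD:
  "finite P" "finite E" "finite F" "P \<subseteq> S" "\<forall>e\<in>E. sphere_edge P e" "\<forall>t\<in>F. sphere_triangle P E t"
  "\<forall>e\<in>E. \<forall>e'\<in>E. e \<noteq> e' \<longrightarrow> e \<inter> e' \<subseteq> P" "\<forall>t\<in>F. \<forall>t'\<in>F. t \<noteq> t' \<longrightarrow> t \<inter> t' \<subseteq> \<Union>E" "\<Union>F = S"
proof -
  note T = triangulation[unfolded sphere_triangulation_def]
  show "finite P" using T by (elim conjE)
  show "finite E" using T by (elim conjE)
  show "finite F" using T by (elim conjE)
  show "P \<subseteq> S" using T by (elim conjE)
  show "\<forall>e\<in>E. sphere_edge P e" using T by (elim conjE)
  show "\<forall>t\<in>F. sphere_triangle P E t" using T by (elim conjE)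
  show "\<forall>e\<in>E. \<forall>e'\<in>E. e \<noteq> e' \<longrightarrow> e \<inter> e' \<subseteq> P" using T by (elim conjE)
  show "\<forall>t\<in>F. \<forall>t'\<in>F. t \<noteq> t' \<longrightarrow> t \<inter> t' \<subseteq> \<Union>E" using T by (elim conjE)
  show "\<Union>F = S" using T by (elim conjE)
qed

lemmas finite_P = triangulationD(1) and finite_E = triangulationD(2) and finite_F = triangulationD(3)
  and P_sub = triangulationD(4) and cover = triangulationD(9)
  and edge = triangulationD(5)[rule_format] and triangle = triangulationD(6)[rule_format]
  and edge_Int = triangulationD(7)[rule_format] and triangle_Int = triangulationD(8)[rule_format]

lemma edge_facts:
  assumes "e \<in> E"
  shows "compact e" "\<not> e \<subseteq> P" "\<exists>p q. p \<noteq> q \<and> P \<inter> e = {p, q}"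
proof -
  obtain g where g: "arc g" "path_image g = e" "P \<inter> e = {pathstart g, pathfinish g}"
    using edge[OF assms] by (auto simp: sphere_edge_def)
  show "compact e" using g compact_arc_image by auto
  have ne: "pathstart g \<noteq> pathfinish g" using arc_distinct_ends[OF g(1)] by simp
  then show "\<exists>p q. p \<noteq> q \<and> P \<inter> e = {p, q}" using g by blast
  have "connected e" using g connected_arc_image by auto
  moreover have "pathstart g \<in> e" "pathfinish g \<in> e" using g by auto
  ultimately have "infinite e" using ne connected_finite_iff_sing[of e] by auto
  then show "\<not> e \<subseteq> P" using finite_P finite_subset by blast
qed

lemma triangle_facts:
  assumes t: "t \<in> F"
  obtains x y z exy eyz ezx where "compact t" "connected t" "t \<subseteq> S" "x \<noteq> y" "y \<noteq> z" "z \<noteq> x" "P \<inter> t = {x, y, z}"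
    "exy \<in> E" "eyz \<in> E" "ezx \<in> E" "exy \<subseteq> t" "eyz \<subseteq> t" "ezx \<subseteq> t"
    "P \<inter> exy = {x, y}" "P \<inter> eyz = {y, z}" "P \<inter> ezx = {z, x}" "\<Union>E \<inter> t = exy \<union> eyz \<union> ezx"
    "\<And>U. openin (top_of_set S) U \<Longrightarrow> U \<subseteq> t \<Longrightarrow> U \<inter> (exy \<union> eyz \<union> ezx) = {}"
proof -
  obtain a b c :: "real^2" and h k where tS: "t \<subseteq> S" and nc: "\<not> collinear {a, b, c}"
    and hom: "homeomorphism (convex hull {a, b, c}) t h k" and Pt: "P \<inter> t = h ` {a, b, c}"
    and sides: "{h ` closed_segment a b, h ` closed_segment b c, h ` closed_segment c a} \<subseteq> E"
    and U: "\<Union>E \<inter> t = h ` (closed_segment a b \<union> closed_segment b c \<union> closed_segment c a)"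
    using triangle[OF t] unfolding sphere_triangle_def by (elim conjE exE) (rule that; assumption)
  let ?T = "convex hull {a, b, c}"
  have nc': "\<not> collinear {b, c, a}" "\<not> collinear {c, a, b}" using nc by (simp_all add: insert_commute)
  have eq: "{b, c, a} = {a, b, c}" "{c, a, b} = {a, b, c}" by auto
  note sd = triangle_side[OF nc] triangle_side[OF nc'(1), unfolded eq] triangle_side[OF nc'(2), unfolded eq]
  have kh: "\<And>x. x \<in> ?T \<Longrightarrow> k (h x) = x" and hk: "\<And>y. y \<in> t \<Longrightarrow> h (k y) = y"
    and cont: "continuous_on ?T h" "continuous_on t k" and kt: "k ` t = ?T"
    using hom by (simp_all add: homeomorphism_def)
  have inj: "inj_on h ?T" using kh by (rule inj_on_inverseI)
  have vT: "a \<in> ?T" "b \<in> ?T" "c \<in> ?T" by (simp_all add: hull_inc)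
  have ne: "a \<noteq> b" "b \<noteq> c" "c \<noteq> a" using sd(2,6,10) by auto
  have img: "h ` ?T = t" using hom by (simp add: homeomorphism_def)
  have Pside: "P \<inter> h ` closed_segment u v = {h u, h v}"
    if uvw: "{u, v, w} = {a, b, c}" "w \<notin> closed_segment u v" "closed_segment u v \<subseteq> ?T" for u v w
  proof -
    have "P \<inter> h ` closed_segment u v = h ` {u, v, w} \<inter> h ` closed_segment u v"
      using Pt img that(3) uvw(1) by blast
    also have "\<dots> = h ` ({u, v, w} \<inter> closed_segment u v)"
      using inj_on_image_Int[OF inj, of "{u, v, w}" "closed_segment u v"] uvw vT by auto
    also have "{u, v, w} \<inter> closed_segment u v = {u, v}" using uvw(2) by auto
    finally show ?thesis by simp
  qed
  show thesis
  proof
    show "compact t" "connected t"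
      unfolding img[symmetric]
      by (rule compact_continuous_image[OF cont(1)], simp add: finite_imp_compact_convex_hull,
          rule connected_continuous_image[OF cont(1)], simp add: convex_connected)
    show "t \<subseteq> S" by (rule tS)
    show "h a \<noteq> h b" "h b \<noteq> h c" "h c \<noteq> h a" using inj vT ne by (auto dest: inj_onD)
    show "P \<inter> t = {h a, h b, h c}" using Pt by simp
    show "h ` closed_segment a b \<in> E" "h ` closed_segment b c \<in> E" "h ` closed_segment c a \<in> E"
      using sides by auto
    show "h ` closed_segment a b \<subseteq> t" "h ` closed_segment b c \<subseteq> t" "h ` closed_segment c a \<subseteq> t"
      using sd img by blast+
    show "P \<inter> h ` closed_segment a b = {h a, h b}" by (rule Pside[of _ _ c]) (use sd in auto)
    show "P \<inter> h ` closed_segment b c = {h b, h c}" by (rule Pside[of _ _ a]) (use sd in auto)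
    show "P \<inter> h ` closed_segment c a = {h c, h a}" by (rule Pside[of _ _ b]) (use sd in auto)
    show "\<Union>E \<inter> t = h ` closed_segment a b \<union> h ` closed_segment b c \<union> h ` closed_segment c a"
      using U by (simp add: image_Un)
    fix U assume U: "openin (top_of_set S) U" "U \<subseteq> t"
    \<comment> \<open>By invariance of domain the image in the plane is open, hence contained in the
      interior of the plane triangle, which the sides avoid.\<close>
    have "openin (top_of_set (UNIV :: (real^2) set)) (k ` U)"
    proof (rule invariance_of_domain_sphere_affine_set[OF _ _ _ _ _ _ U(1)])
      show "continuous_on U k" using cont(2) U(2) by (rule continuous_on_subset)
      show "inj_on k U" using hk U(2) by (intro inj_on_inverseI[of _ h]) auto
    qed (auto simp: aff_dim_UNIV)
    then have "open (k ` U)" by simp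
    moreover have "k ` U \<subseteq> ?T" using kt U(2) by blast
    ultimately have int: "k ` U \<subseteq> interior ?T" by (rule interior_maximal[rotated])
    have "x \<notin> h ` s" if "x \<in> U" "s \<subseteq> ?T" "s \<inter> interior ?T = {}" for x s
    proof
      assume "x \<in> h ` s"
      then obtain y where y: "y \<in> s" "x = h y" by blast
      then have "k x = y" using kh that(2) by auto
      then show False using int that y by blast
    qed
    then show "U \<inter> (h ` closed_segment a b \<union> h ` closed_segment b c \<union> h ` closed_segment c a) = {}"
      using sd by blast
  qed
qed

lemma triangle_topology:
  assumes "t \<in> F" shows "compact t" "connected t" "t \<subseteq> S"
proof -
  show "compact t" by (rule triangle_facts[OF assms])
  show "connected t" by (rule triangle_facts[OF assms])
  show "t \<subseteq> S" by (rule triangle_facts[OF assms])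
qed

section \<open>Incidence of edges and triangles\<close>

lemma edge_sub_triangle:
  assumes "t \<in> F" "e \<in> E" "x \<in> e" "x \<in> t" "x \<notin> P"
  shows "e \<subseteq> t"
proof -
  obtain exy eyz ezx where s: "exy \<in> E" "eyz \<in> E" "ezx \<in> E" "exy \<subseteq> t" "eyz \<subseteq> t" "ezx \<subseteq> t"
    and "\<Union>E \<inter> t = exy \<union> eyz \<union> ezx" using triangle_facts[OF assms(1)] by metis
  then have "x \<in> exy \<union> eyz \<union> ezx" using assms by blast
  then show ?thesis using edge_Int[OF assms(2)] s assms by blast
qed

lemma common_point_cases:
  assumes "t \<in> F" "t' \<in> F" "t \<noteq> t'" "x \<in> t" "x \<in> t'" "x \<notin> P"
  obtains e where "e \<in> E" "x \<in> e" "e \<subseteq> t" "e \<subseteq> t'"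
proof -
  obtain e where "e \<in> E" "x \<in> e" using triangle_Int[OF assms(1-3)] assms by blast
  then show thesis using that edge_sub_triangle assms by blast
qed

text \<open>If \<open>t\<close> were the only triangle at an inner point of the edge, the complement
  of the other triangles would be a neighbourhood of that point inside \<open>t\<close>. But a set
  that is open in the sphere and contained in a triangle misses its sides.\<close>

lemma edge_in_two_triangles:
  assumes e: "e \<in> E"
  obtains t t' where "t \<in> F" "t' \<in> F" "t \<noteq> t'" "e \<subseteq> t" "e \<subseteq> t'"
proof -
  obtain x where x: "x \<in> e" "x \<notin> P" using edge_facts(2)[OF e] by blast
  have "e \<subseteq> S" using edge[OF e] unfolding sphere_edge_def by (rule conjunct1)
  then have "x \<in> S" using x by blast
  then obtain t where t: "t \<in> F" "x \<in> t" using cover by blast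
  have et: "e \<subseteq> t" using edge_sub_triangle t e x by blast
  have "\<exists>t'\<in>F. t' \<noteq> t \<and> x \<in> t'"
  proof (rule ccontr)
    assume no: "\<not> ?thesis"
    define U where "U = S - \<Union>(F - {t})"
    have "closed (\<Union>(F - {t}))" using finite_F triangle_topology(1) by (intro closed_Union) (auto simp: compact_imp_closed)
    then have "openin (top_of_set S) U" unfolding U_def by (metis Diff_eq open_Compl openin_open_Int)
    moreover have "U \<subseteq> t" using cover by (auto simp: U_def)
    moreover have "x \<in> U" using no \<open>x \<in> S\<close> by (auto simp: U_def)
    moreover have "x \<in> \<Union>E \<inter> t" using x e t by blast
    ultimately show False using triangle_facts[OF t(1)] by (metis IntI empty_iff)
  qed
  then show thesis using that t et edge_sub_triangle e x by metis
qed

section \<open>Connectedness of links and of the sphere\<close>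

lemma closed_Union_triangles: "G \<subseteq> F \<Longrightarrow> closed (\<Union>G)"
  using finite_F triangle_topology(1) by (intro closed_Union) (auto intro: finite_subset compact_imp_closed)

lemma closed_Union_edges: "G \<subseteq> E \<Longrightarrow> closed (\<Union>G)"
  using finite_E edge_facts(1) by (intro closed_Union) (auto intro: finite_subset compact_imp_closed)

text \<open>Away from the closed set \<open>C\<close> of all triangles, edges and points that avoid
  \<open>p\<close>, a triangle of \<open>K\<close> and another triangle at \<open>p\<close> could
  meet only in \<open>p\<close> or along an edge at \<open>p\<close>, and the latter is excluded by
  closedness of \<open>K\<close>. So a connected punctured neighbourhood of \<open>p\<close> would
  split into two closed pieces.\<close>

lemma link_connected:
  assumes p: "p \<in> P" and K: "K \<subseteq> {t \<in> F. p \<in> t}" "K \<noteq> {}"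
    and closed: "\<And>t t' e. \<lbrakk>t \<in> K; t' \<in> F; e \<in> E; p \<in> e; e \<subseteq> t; e \<subseteq> t'\<rbrakk> \<Longrightarrow> t' \<in> K"
  shows "K = {t \<in> F. p \<in> t}"
proof (rule ccontr)
  assume neq: "K \<noteq> {t \<in> F. p \<in> t}"
  define K' where "K' = {t \<in> F. p \<in> t} - K"
  have K': "K' \<noteq> {}" using neq K by (auto simp: K'_def)
  define C where "C = \<Union>{t \<in> F. p \<notin> t} \<union> \<Union>{e \<in> E. p \<notin> e} \<union> (P - {p})"
  have "closed (\<Union>{e \<in> E. p \<notin> e})" by (rule closed_Union_edges) blast
  then have "closed C" unfolding C_def using closed_Union_triangles[of "{t \<in> F. p \<notin> t}"] finite_P by (intro closed_Un) (auto intro: finite_imp_closed)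
  then have "openin (top_of_set S) (S - C)" by (metis Diff_eq open_Compl openin_open_Int)
  moreover have "p \<in> S - C" using p P_sub by (auto simp: C_def)
  ultimately obtain N where N: "openin (top_of_set S) N" "p \<in> N" "N \<subseteq> S - C" "connected (N - {p})"
    by (rule sphere_punctured_neighbourhood)
  obtain O' where O': "open O'" "N = S \<inter> O'" using N(1) by (auto simp: openin_open)
  \<comment> \<open>A triangle is connected with more than one point, so \<open>p\<close> is a limit
    point of each triangle containing it; hence both pieces meet the punctured
    neighbourhood.\<close>
  have ne: "(N - {p}) \<inter> \<Union>G \<noteq> {}" if "G \<subseteq> {t \<in> F. p \<in> t}" "G \<noteq> {}" for G
  proof -
    obtain t where t: "t \<in> G" "t \<in> F" "p \<in> t" using \<open>G \<noteq> {}\<close> \<open>G \<subseteq> _\<close> by blast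
    obtain x y z where "x \<noteq> y" "P \<inter> t = {x, y, z}" using triangle_facts[OF t(2)] by metis
    then have "x \<in> t" "y \<in> t" "x \<noteq> y" by blast+
    then have "\<nexists>u. t = {u}" by blast
    then have "p islimpt t" using connected_imp_perfect triangle_topology(2) t by blast
    then obtain y where "y \<in> t" "y \<in> O'" "y \<noteq> p" using O' N(2) by (meson IntE islimptE)
    then show ?thesis using t O' triangle_topology(3)[OF t(2)] by blast
  qed
  have "N - {p} \<subseteq> \<Union>K \<union> \<Union>K'" 
  proof
    fix x assume x: "x \<in> N - {p}"
    then have "x \<in> S" using N(3) by blast
    then obtain t where t: "t \<in> F" "x \<in> t" using cover by blast
    then have "p \<in> t" using x N(3) by (auto simp: C_def)
    then show "x \<in> \<Union>K \<union> \<Union>K'" using t by (auto simp: K'_def)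
  qed
  moreover have "\<Union>K \<inter> \<Union>K' \<inter> (N - {p}) = {}"
  proof (rule ccontr)
    assume "\<not> ?thesis"
    then obtain x t t' where x: "t \<in> K" "t' \<in> K'" "x \<in> t" "x \<in> t'" "x \<in> N" "x \<noteq> p" by blast
    then have tF: "t \<in> F" "t' \<in> F" "t \<noteq> t'" using K by (auto simp: K'_def)
    have "x \<notin> P" using x N(3) by (auto simp: C_def)
    then obtain e where e: "e \<in> E" "x \<in> e" "e \<subseteq> t" "e \<subseteq> t'" using common_point_cases[OF tF x(3,4) \<open>x \<notin> P\<close>] by blast
    then have "p \<in> e" using x N(3) by (auto simp: C_def)
    then show False using closed[OF x(1) tF(2) e(1)] e x by (auto simp: K'_def)
  qed
  moreover have "closed (\<Union>K)" "closed (\<Union>K')" using K by (auto intro!: closed_Union_triangles simp: K'_def)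
  moreover have "\<Union>K \<inter> (N - {p}) \<noteq> {}" using ne[OF K] by (simp add: Int_commute)
  moreover have "\<Union>K' \<inter> (N - {p}) \<noteq> {}" using ne[of K'] K' by (simp add: Int_commute K'_def)
  ultimately show False using N(4) unfolding connected_closed by blast
qed

text \<open>Triangles that meet outside \<open>P\<close> share an edge and hence its ends, so all
  triangles that meet have a common point in \<open>P\<close>. The unions of \<open>K\<close> and of
  its complement are then disjoint closed sets covering the connected sphere.\<close>

lemma triangles_connected:
  assumes K: "K \<subseteq> F" "K \<noteq> {}" and closed: "\<And>t t'. \<lbrakk>t \<in> K; t' \<in> F; P \<inter> t \<inter> t' \<noteq> {}\<rbrakk> \<Longrightarrow> t' \<in> K"
  shows "K = F"
proof (rule ccontr)
  assume "K \<noteq> F"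
  then have ne: "F - K \<noteq> {}" using K by blast
  have nonempty: "t \<inter> S \<noteq> {}" if t: "t \<in> F" for t
  proof -
    obtain x y z where "P \<inter> t = {x, y, z}" using triangle_facts[OF t] by metis
    then show ?thesis using P_sub by blast
  qed
  have "\<Union>K \<inter> \<Union>(F - K) \<inter> S = {}"
  proof (rule ccontr)
    assume "\<not> ?thesis"
    then obtain x t t' where x: "t \<in> K" "t' \<in> F - K" "x \<in> t" "x \<in> t'" by blast
    have "P \<inter> t \<inter> t' \<noteq> {}"
    proof (cases "x \<in> P")
      case False
      obtain e where "e \<in> E" "e \<subseteq> t" "e \<subseteq> t'"
        by (rule common_point_cases[of t t' x]) (use x K False in auto)
      then show ?thesis using edge_facts(3)[of e] by blast
    qed (use x in blast)
    then show False using closed x by blast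
  qed
  moreover have "connected S" by (rule connected_sphere) simp
  moreover have "S \<subseteq> \<Union>K \<union> \<Union>(F - K)" using cover K by auto
  moreover have "\<Union>K \<inter> S \<noteq> {}" "\<Union>(F - K) \<inter> S \<noteq> {}" using nonempty K ne by blast+
  moreover have "closed (\<Union>K)" "closed (\<Union>(F - K))" using closed_Union_triangles K by auto
  ultimately show False unfolding connected_closed by blast
qed

section \<open>Vanishing of the first cohomology of the triangulated sphere\<close>

text \<open>Normalise the distances to the union of all edges and points that avoid \<open>p\<close>.\<close>

lemma barycentric_functions:
  "\<exists>l :: real^3 \<Rightarrow> real^3 \<Rightarrow> real. (\<forall>p\<in>P. continuous_on S (l p)) \<and> (\<forall>p\<in>P. \<forall>q\<in>P. l p q = of_bool (p = q)) \<and>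
     (\<forall>e\<in>E. \<forall>x\<in>e. (\<forall>p\<in>P - e. l p x = 0) \<and> (\<Sum>p\<in>P \<inter> e. l p x) = 1)"
proof -
  define Z where "Z p = \<Union>{e \<in> E. p \<notin> e} \<union> (P - {p})" for p
  define \<mu> where "\<mu> p x = infdist x (Z p)" for p x
  have closedZ: "closed (Z p)" for p
  proof -
    have "closed (\<Union>{e \<in> E. p \<notin> e})" by (rule closed_Union_edges) blast
    moreover have "closed (P - {p})" using finite_P by (intro finite_imp_closed) simp
    ultimately show ?thesis unfolding Z_def by (rule closed_Un)
  qed
  have "S \<noteq> {}" by simp
  then obtain t where t: "t \<in> F" using cover by blast
  obtain x y z where "x \<noteq> y" "P \<inter> t = {x, y, z}" using triangle_facts[OF t] by metis
  then have "x \<in> P" "y \<in> P" "x \<noteq> y" by blast+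
  then have neZ: "Z p \<noteq> {}" for p by (auto simp: Z_def)
  have \<mu>0: "\<mu> p x = 0 \<longleftrightarrow> x \<in> Z p" for p x
    unfolding \<mu>_def using in_closed_iff_infdist_zero[OF closedZ neZ] by simp
  have \<mu>_ge: "\<mu> p x \<ge> 0" for p x by (simp add: \<mu>_def infdist_nonneg)
  have cont\<mu>: "continuous_on A (\<mu> p)" for p A unfolding \<mu>_def by (intro continuous_intros)
  define s where "s x = (\<Sum>p\<in>P. \<mu> p x)" for x
  have s_pos: "s x > 0" if x: "x \<in> S" for x
  proof -
    have "\<exists>p\<in>P. x \<notin> Z p"
    proof (cases "x \<in> P")
      case True
      then show ?thesis by (intro bexI[of _ x]) (auto simp: Z_def)
    next
      case xP: False
      show ?thesis
      proof (cases "x \<in> \<Union>E")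
        case True
        then obtain e where e: "e \<in> E" "x \<in> e" by blast
        obtain p where p: "p \<in> P" "p \<in> e" using edge_facts(3)[OF e(1)] by blast
        have "x \<notin> e'" if "e' \<in> E" "p \<notin> e'" for e' using edge_Int[of e e'] e that p xP by blast
        then show ?thesis using p xP by (intro bexI[of _ p]) (auto simp: Z_def)
      next
        case False
        have "P \<noteq> {}" using \<open>P \<inter> t = _\<close> by blast
        then show ?thesis using False xP by (auto simp: Z_def)
      qed
    qed
    then obtain p where p: "p \<in> P" "\<mu> p x \<noteq> 0" using \<mu>0 by blast
    then have "0 < \<mu> p x" using \<mu>_ge[of p x] by simp
    then show ?thesis unfolding s_def using finite_P p \<mu>_ge by (intro sum_pos2[of P p]) auto
  qed
  have conts: "continuous_on S s" unfolding s_def using cont\<mu> by (intro continuous_on_sum) auto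
  have PS: "q \<in> S" if "q \<in> P" for q using that P_sub by blast
  have eS: "x \<in> S" if "e \<in> E" "x \<in> e" for e x
    using edge[OF that(1)] that(2) unfolding sphere_edge_def by blast
  show ?thesis
  proof (intro exI[of _ "\<lambda>p x. \<mu> p x / s x"] conjI ballI)
    show "continuous_on S (\<lambda>x. \<mu> p x / s x)" if "p \<in> P" for p
      using s_pos by (intro continuous_on_divide cont\<mu> conts) force
    have \<mu>P: "\<mu> p q = 0" if "p \<in> P" "q \<in> P" "p \<noteq> q" for p q using that unfolding \<mu>0 by (auto simp: Z_def)
    show "\<mu> p q / s q = of_bool (p = q)" if "p \<in> P" "q \<in> P" for p q
    proof (cases "p = q")
      case True
      have "s q = \<mu> q q" unfolding s_def using finite_P that \<mu>P
        by (subst sum.remove[of _ q]) (auto intro!: sum.neutral)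
      then show ?thesis using True s_pos[OF PS[OF that(2)]] by simp
    next
      case False
      then show ?thesis using \<mu>P that by simp
    qed
    have \<mu>e: "\<mu> p x = 0" if "e \<in> E" "x \<in> e" "p \<in> P" "p \<notin> e" for e x p
      using that unfolding \<mu>0 by (auto simp: Z_def)
    show "\<mu> p x / s x = 0" if "e \<in> E" "x \<in> e" "p \<in> P - e" for e x p
      using \<mu>e that by simp
    show "(\<Sum>p\<in>P \<inter> e. \<mu> p x / s x) = 1" if e: "e \<in> E" "x \<in> e" for e x
    proof -
      have "s x = (\<Sum>p\<in>P \<inter> e. \<mu> p x)" unfolding s_def using finite_P \<mu>e[OF e]
        by (intro sum.mono_neutral_right) auto
      then show ?thesis using s_pos[OF eS[OF e]] by (simp flip: sum_divide_distrib)
    qed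
  qed
qed

text \<open>The cocycle is realised by a map from the sphere to the circle, which lifts to the reals because
  the sphere is simply connected; the values of the lift at the points form the potential.\<close>

lemma cohomology:
  fixes A :: "(real^3) set \<Rightarrow> real^3 \<Rightarrow> int"
  assumes A: "\<And>t t' e p q. \<lbrakk>t \<in> F; t' \<in> F; e \<in> E; e \<subseteq> t; e \<subseteq> t'; p \<in> P \<inter> e; q \<in> P \<inter> e\<rbrakk> \<Longrightarrow>
    A t p - A t q = A t' p - A t' q"
  shows "\<exists>u :: real^3 \<Rightarrow> int. \<forall>t\<in>F. \<forall>p\<in>P \<inter> t. \<forall>q\<in>P \<inter> t. u p - u q = A t p - A t q"
proof -
  obtain l :: "real^3 \<Rightarrow> real^3 \<Rightarrow> real" where cont_l': "\<forall>p\<in>P. continuous_on S (l p)"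
    and l_P': "\<forall>p\<in>P. \<forall>q\<in>P. l p q = of_bool (p = q)"
    and l_e: "\<forall>e\<in>E. \<forall>x\<in>e. (\<forall>p\<in>P - e. l p x = 0) \<and> (\<Sum>p\<in>P \<inter> e. l p x) = 1"
    using barycentric_functions by (elim exE conjE) (rule that)
  have cont_l: "continuous_on S (l p)" if "p \<in> P" for p using cont_l' that by simp
  have l_P: "l p q = of_bool (p = q)" if "p \<in> P" "q \<in> P" for p q using l_P' that by simp
  have l_0: "l p x = 0" if "e \<in> E" "x \<in> e" "p \<in> P" "p \<notin> e" for e x p using l_e that by simp
  have l_1: "(\<Sum>p\<in>P \<inter> e. l p x) = 1" if "e \<in> E" "x \<in> e" for e x using l_e that by simp
  \<comment> \<open>Interpolation of the corner values on each triangle. On an edge the functions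
    \<open>l\<close> are weights with sum 1; inside a triangle only continuity matters.\<close>
  define g where "g t x = (\<Sum>p\<in>P \<inter> t. of_int (A t p) * l p x)" for t x
  have cont_g: "continuous_on t (g t)" if t: "t \<in> F" for t
  proof -
    have "continuous_on t (l p)" if "p \<in> P \<inter> t" for p
      using cont_l[of p] triangle_topology(3)[OF t] that by (auto intro: continuous_on_subset)
    then show ?thesis unfolding g_def by (intro continuous_on_sum continuous_on_mult continuous_on_const)
  qed
  have g_P: "g t p = of_int (A t p)" if "t \<in> F" "p \<in> P \<inter> t" for t p
  proof -
    have "g t p = (\<Sum>q\<in>P \<inter> t. if q = p then of_int (A t p) else 0)"
      unfolding g_def using that l_P by (intro sum.cong) auto
    also have "\<dots> = of_int (A t p)" using that finite_P by (subst sum.delta) auto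
    finally show ?thesis .
  qed
  have g_edge: "g t x = (\<Sum>p\<in>P \<inter> e. of_int (A t p) * l p x)" if "t \<in> F" "e \<in> E" "e \<subseteq> t" "x \<in> e" for t e x
    unfolding g_def using finite_P that l_0 by (intro sum.mono_neutral_right) auto
  \<comment> \<open>On a common edge the corner values of the two triangles differ by one integer,
    and so do the interpolations because the weights add up to 1. Thus \<open>g\<close> is well
    defined modulo integers.\<close>
  have g_diff: "\<exists>n :: int. g t x - g t' x = of_int n" if tt: "t \<in> F" "t' \<in> F" "x \<in> t" "x \<in> t'" for t t' x
  proof (cases "x \<in> P")
    case True
    then show ?thesis using g_P[of t x] g_P[of t' x] that by (intro exI[of _ "A t x - A t' x"]) simp
  next
    case xP: False
    show ?thesis
    proof (cases "t = t'")
      case False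
      obtain e where e: "e \<in> E" "x \<in> e" "e \<subseteq> t" "e \<subseteq> t'"
        by (rule common_point_cases[of t t' x]) (use tt xP False in simp_all)
      obtain q where q: "q \<in> P \<inter> e" using edge_facts(3)[OF e(1)] by blast
      define n where "n = A t q - A t' q"
      have n: "A t p - A t' p = n" if "p \<in> P \<inter> e" for p
        using A[OF \<open>t \<in> F\<close> \<open>t' \<in> F\<close> e(1,3,4) that q] by (simp add: n_def)
      have "g t x - g t' x = (\<Sum>p\<in>P \<inter> e. of_int (A t p - A t' p) * l p x)"
        using g_edge e tt by (simp add: sum_subtractf left_diff_distrib)
      also have "\<dots> = (\<Sum>p\<in>P \<inter> e. of_int n * l p x)" using n by (intro sum.cong) auto
      also have "\<dots> = of_int n" using l_1[OF e(1,2)] by (simp flip: sum_distrib_left)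
      finally show ?thesis by blast
    qed (auto intro: exI[of _ 0])
  qed
  define E1 where "E1 y = exp (2 * of_real pi * \<i> * complex_of_real y)" for y
  have E1_eq: "E1 y = E1 z \<longleftrightarrow> (\<exists>n :: int. y - z = of_int n)" for y z
  proof -
    have "E1 y = E1 z \<longleftrightarrow> (\<exists>n :: int. 2 * of_real pi * \<i> * complex_of_real y =
        2 * of_real pi * \<i> * complex_of_real z + of_int (2 * n) * pi * \<i>)"
      unfolding E1_def by (rule exp_eq)
    also have "\<dots> \<longleftrightarrow> (\<exists>n :: int. y - z = of_int n)"
    proof (intro ex_cong1)
      fix n :: int
      have "2 * of_real pi * \<i> * complex_of_real z + of_int (2 * n) * pi * \<i> =
          2 * of_real pi * \<i> * complex_of_real (z + of_int n)" by (simp add: algebra_simps)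
      then have "(2 * of_real pi * \<i> * complex_of_real y =
        2 * of_real pi * \<i> * complex_of_real z + of_int (2 * n) * pi * \<i>) \<longleftrightarrow>
        complex_of_real y = complex_of_real (z + of_int n)" by (simp del: of_real_add)
      also have "\<dots> \<longleftrightarrow> y - z = of_int n" unfolding of_real_eq_iff by auto
      finally show "(2 * of_real pi * \<i> * complex_of_real y =
        2 * of_real pi * \<i> * complex_of_real z + of_int (2 * n) * pi * \<i>) \<longleftrightarrow> y - z = of_int n" .
    qed
    finally show ?thesis .
  qed
  have "\<exists>f. continuous_on (\<Union>F) f \<and> (\<forall>t\<in>F. \<forall>x\<in>t. f x = E1 (g t x))"
  proof -
    define f where "f x = E1 (g (SOME t. t \<in> F \<and> x \<in> t) x)" for x
    have f: "f x = E1 (g t x)" if "t \<in> F" "x \<in> t" for t x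
    proof -
      have "(SOME t. t \<in> F \<and> x \<in> t) \<in> F \<and> x \<in> (SOME t. t \<in> F \<and> x \<in> t)" by (rule someI[of _ t]) (use that in blast)
      then show ?thesis unfolding f_def E1_eq using g_diff that by blast
    qed
    have "continuous_on t f" if "t \<in> F" for t
    proof -
      have "continuous_on t (\<lambda>x. E1 (g t x))" unfolding E1_def by (intro continuous_intros cont_g that)
      then show ?thesis using f[OF that] by (simp cong: continuous_on_cong)
    qed
    then have "continuous_on (\<Union>t\<in>F. t) f"
      using finite_F triangle_topology(1) by (intro continuous_on_closed_Union) (auto intro: compact_imp_closed)
    then show ?thesis using f by auto
  qed
  then obtain f where f: "continuous_on S f" "\<And>t x. t \<in> F \<Longrightarrow> x \<in> t \<Longrightarrow> f x = E1 (g t x)"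
    unfolding cover by blast
  \<comment> \<open>Simple connectivity enters here: a continuous nowhere vanishing complex function
    on the sphere has a continuous logarithm.\<close>
  have "Borsukian S" by (rule Borsukian_sphere) simp
  moreover have "f \<in> S \<rightarrow> - {0}"
  proof
    fix x assume "x \<in> S"
    then obtain t where "t \<in> F" "x \<in> t" using cover by blast
    then show "f x \<in> - {0}" using f(2) by (simp add: E1_def)
  qed
  ultimately obtain G where G: "continuous_on S G" "\<And>x. x \<in> S \<Longrightarrow> f x = exp (G x)"
    using f(1) unfolding Borsukian_continuous_logarithm by metis
  have int: "\<exists>n :: int. G x - 2 * of_real pi * \<i> * complex_of_real (g t x) = 2 * of_real pi * \<i> * of_int n"
    if "t \<in> F" "x \<in> t" for t x
  proof -
    have "x \<in> S" using triangle_topology(3) that by blast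
    then have "exp (G x) = exp (2 * of_real pi * \<i> * complex_of_real (g t x))"
      using G(2)[of x] f(2)[OF that] by (simp add: E1_def)
    then obtain n :: int where "G x = 2 * of_real pi * \<i> * complex_of_real (g t x) + of_int (2 * n) * pi * \<i>"
      unfolding exp_eq by blast
    then show ?thesis by (intro exI[of _ n]) (simp add: algebra_simps)
  qed
  \<comment> \<open>On one triangle the rescaled lift differs from \<open>g t\<close> by a
    continuous integer-valued function, hence by a constant.\<close>
  define H where "H t x = (G x - 2 * of_real pi * \<i> * complex_of_real (g t x)) / (2 * of_real pi * \<i>)" for t x
  have H_int: "H t x \<in> \<int>" if "t \<in> F" "x \<in> t" for t x
    using int[OF that] by (auto simp: H_def)
  have H_const: "H t x = H t y" if t: "t \<in> F" and xy: "x \<in> t" "y \<in> t" for t x y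
  proof -
    have "continuous_on t (H t)" unfolding H_def using t triangle_topology(3)[OF t]
      by (intro continuous_intros cont_g continuous_on_subset[OF G(1)]) auto
    have "H t constant_on t"
    proof (rule continuous_discrete_range_constant[OF triangle_topology(2)[OF t] \<open>continuous_on t (H t)\<close>])
      fix z assume z: "z \<in> t"
      have "1 \<le> norm (H t y - H t z)" if "y \<in> t" "H t y \<noteq> H t z" for y
      proof -
        have "H t y - H t z \<in> \<int>" using H_int[OF t] that z by (intro Ints_diff) auto
        then obtain n :: int where "H t y - H t z = of_int n" by (rule Ints_cases)
        moreover have "n \<noteq> 0" using calculation that by auto
        ultimately show ?thesis by (simp add: norm_of_int)
      qed
      then show "\<exists>e>0. \<forall>y. y \<in> t \<and> H t y \<noteq> H t z \<longrightarrow> e \<le> norm (H t y - H t z)" by (intro exI[of _ 1]) auto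
    qed
    then show ?thesis using xy by (metis constant_on_def)
  qed
  \<comment> \<open>At the points of the triangulation the quotient is an integer; the floor of the
    real part merely extracts it.\<close>
  define u :: "real^3 \<Rightarrow> int" where "u p = \<lfloor>Re (G p / (2 * of_real pi * \<i>))\<rfloor>" for p
  have u: "complex_of_int (u p) = H t p + of_int (A t p)" if t: "t \<in> F" and p: "p \<in> P \<inter> t" for t p
  proof -
    have eq: "G p / (2 * of_real pi * \<i>) = H t p + of_int (A t p)"
      using g_P[OF t p] by (simp add: H_def diff_divide_distrib)
    have "H t p + of_int (A t p) \<in> \<int>" using H_int[OF t, of p] p by auto
    then obtain n :: int where "H t p + of_int (A t p) = of_int n" by (rule Ints_cases)
    then show ?thesis unfolding u_def eq by simp
  qed
  have "u p - u q = A t p - A t q" if t: "t \<in> F" "p \<in> P \<inter> t" "q \<in> P \<inter> t" for t p q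
  proof -
    have "complex_of_int (u p - u q) = complex_of_int (A t p - A t q)"
      using u[OF t(1,2)] u[OF t(1,3)] H_const[OF t(1), of p q] t by simp
    then show ?thesis unfolding of_int_eq_iff .
  qed
  then show ?thesis by blast
qed

end

section \<open>The map of a trinity\<close>

locale trinity_map =
  fixes T :: trinity
  assumes is_trinity: "is_trinity T"
begin

sublocale triangulation "points T" "edges T" "triangles T"
  using is_trinity unfolding is_trinity_def triangulation_def by (rule conjunct1)

section \<open>Colored points and sides of a triangle\<close>

definition pt :: "color \<Rightarrow> point set \<Rightarrow> point" where
  "pt k t = (THE p. p \<in> points T \<inter> t \<and> col T p = k)"

definition side :: "color \<Rightarrow> point set \<Rightarrow> point set" where
  "side k t = (THE e. e \<in> colored_edges T k \<and> e \<subseteq> t)"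

lemma colored_edgesD: "e \<in> colored_edges T k \<Longrightarrow> e \<in> edges T"
  by (simp add: colored_edges_def)

lemma sides_exist:
  assumes t: "t \<in> triangles T"
  shows "\<exists>s x y z. points T \<inter> t = {x, y, z} \<and> col T x \<noteq> col T y \<and> col T y \<noteq> col T z \<and> col T z \<noteq> col T x \<and>
    (\<forall>k. s k \<in> edges T \<and> s k \<subseteq> t \<and> points T \<inter> s k = {p \<in> points T \<inter> t. col T p \<noteq> k}) \<and>
    \<Union>(edges T) \<inter> t = (\<Union>k. s k)"
proof -
  obtain x y z exy eyz ezx where ne: "x \<noteq> y" "y \<noteq> z" "z \<noteq> x" and P: "points T \<inter> t = {x, y, z}"
    and E: "exy \<in> edges T" "eyz \<in> edges T" "ezx \<in> edges T" and sub: "exy \<subseteq> t" "eyz \<subseteq> t" "ezx \<subseteq> t"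
    and Pe: "points T \<inter> exy = {x, y}" "points T \<inter> eyz = {y, z}" "points T \<inter> ezx = {z, x}"
    and U: "\<Union>(edges T) \<inter> t = exy \<union> eyz \<union> ezx"
    by (rule triangle_facts[OF t])
  have inj: "inj_on (col T) (points T \<inter> e)" if "e \<in> edges T" for e
    using is_trinity that by (simp add: is_trinity_def ends_def)
  have c: "col T x \<noteq> col T y" "col T y \<noteq> col T z" "col T z \<noteq> col T x"
    using inj[OF E(1)] inj[OF E(2)] inj[OF E(3)] ne by (auto simp: Pe)
  define s where "s k = (if k = col T z then exy else if k = col T x then eyz else ezx)" for k
  have k: "k = col T x \<or> k = col T y \<or> k = col T z" for k
    using c by (cases k; cases "col T x"; cases "col T y"; cases "col T z") auto
  show ?thesis
  proof (rule exI[of _ s], rule exI[of _ x], rule exI[of _ y], rule exI[of _ z], intro conjI allI P c)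
    show "s k \<in> edges T" "s k \<subseteq> t" for k using E sub by (auto simp: s_def)
    show "points T \<inter> s k = {p \<in> points T \<inter> t. col T p \<noteq> k}" for k
      unfolding P using k[of k] c Pe by (auto simp: s_def)
    have "s (col T z) = exy" "s (col T x) = eyz" "s (col T y) = ezx" using c by (auto simp: s_def)
    moreover have "s k \<in> {exy, eyz, ezx}" for k by (auto simp: s_def)
    moreover have "s (col T z) \<in> range s" "s (col T x) \<in> range s" "s (col T y) \<in> range s" by (rule rangeI)+
    ultimately have "range s = {exy, eyz, ezx}" by (intro equalityI subsetI) auto
    then show "\<Union>(edges T) \<inter> t = (\<Union>k. s k)" using U by (simp add: Un_assoc)
  qed
qed

lemma pt_unique:
  assumes t: "t \<in> triangles T"
  shows "\<exists>!p. p \<in> points T \<inter> t \<and> col T p = k"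
proof -
  obtain x y z where P: "points T \<inter> t = {x, y, z}" and c: "col T x \<noteq> col T y" "col T y \<noteq> col T z" "col T z \<noteq> col T x"
    using sides_exist[OF t] by (elim exE conjE) (rule that)
  have "k = col T x \<or> k = col T y \<or> k = col T z"
    using c by (cases k; cases "col T x"; cases "col T y"; cases "col T z") auto
  then show ?thesis unfolding P using c by auto
qed

lemma pt:
  assumes "t \<in> triangles T"
  shows "pt k t \<in> points T" "pt k t \<in> t" "col T (pt k t) = k"
  using theI'[OF pt_unique[OF assms, of k]] unfolding pt_def by simp_all

lemma pt_eqI: "\<lbrakk>t \<in> triangles T; p \<in> points T; p \<in> t; col T p = k\<rbrakk> \<Longrightarrow> pt k t = p"
  unfolding pt_def by (rule the1_equality[OF pt_unique]) simp_all

lemma pt_col: "\<lbrakk>t \<in> triangles T; p \<in> points T; p \<in> t\<rbrakk> \<Longrightarrow> p = pt (col T p) t"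
  by (simp add: pt_eqI)

lemma side_unique:
  assumes t: "t \<in> triangles T"
  shows "\<exists>!e. e \<in> colored_edges T k \<and> e \<subseteq> t"
    and "e \<in> edges T \<Longrightarrow> e \<subseteq> t \<Longrightarrow> \<exists>k. e \<in> colored_edges T k"
    and "e \<in> colored_edges T k \<Longrightarrow> e \<subseteq> t \<Longrightarrow> points T \<inter> e = {p \<in> points T \<inter> t. col T p \<noteq> k}"
proof -
  obtain s where s: "\<forall>k. s k \<in> edges T \<and> s k \<subseteq> t \<and> points T \<inter> s k = {p \<in> points T \<inter> t. col T p \<noteq> k}"
    and U: "\<Union>(edges T) \<inter> t = (\<Union>k. s k)"
    using sides_exist[OF t] by (elim exE conjE) (rule that)
  have sE: "s k \<in> edges T" and st: "s k \<subseteq> t" and Ps: "points T \<inter> s k = {p \<in> points T \<inter> t. col T p \<noteq> k}" for k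
    using s by blast+
  \<comment> \<open>An inner point of an edge contained in \<open>t\<close> lies on some side of
    \<open>t\<close>, and distinct edges meet only in points of the triangulation; so the edge is
    that side.\<close>
  have mem: "\<exists>k. e = s k" if e: "e \<in> edges T" "e \<subseteq> t" for e
  proof -
    obtain x where x: "x \<in> e" "x \<notin> points T" using edge_facts(2)[OF e(1)] by blast
    then have "x \<in> (\<Union>k. s k)" using U e by blast
    then obtain k where "x \<in> s k" by blast
    then show ?thesis using edge_Int[OF e(1) sE[of k]] x by blast
  qed
  have col: "s k \<in> colored_edges T k' \<longleftrightarrow> k = k'" for k k'
  proof -
    have "k' \<in> col T ` (points T \<inter> s k) \<longleftrightarrow> k' \<noteq> k" unfolding Ps using pt[OF t, of k'] by (auto simp: image_iff)
    then show ?thesis using sE by (auto simp: colored_edges_def ends_def)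
  qed
  show "\<exists>!e. e \<in> colored_edges T k \<and> e \<subseteq> t"
  proof (rule ex1I[of _ "s k"])
    show "s k \<in> colored_edges T k \<and> s k \<subseteq> t" using col st by simp
    fix e assume e: "e \<in> colored_edges T k \<and> e \<subseteq> t"
    then obtain k' where "e = s k'" using mem colored_edgesD by blast
    then show "e = s k" using e col by simp
  qed
  show "\<exists>k. e \<in> colored_edges T k" if "e \<in> edges T" "e \<subseteq> t" using mem[OF that] col by blast
  show "points T \<inter> e = {p \<in> points T \<inter> t. col T p \<noteq> k}" if e: "e \<in> colored_edges T k" "e \<subseteq> t"
  proof -
    obtain k' where "e = s k'" using mem[OF colored_edgesD[OF e(1)] e(2)] by blast
    then show ?thesis using e col Ps by simp
  qed
qed

lemma side:
  assumes "t \<in> triangles T"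
  shows "side k t \<in> colored_edges T k" "side k t \<subseteq> t"
  using theI'[OF side_unique(1)[OF assms, of k]] unfolding side_def by simp_all

lemma side_eqI: "\<lbrakk>t \<in> triangles T; e \<in> colored_edges T k; e \<subseteq> t\<rbrakk> \<Longrightarrow> side k t = e"
  unfolding side_def by (rule the1_equality[OF side_unique(1)]) simp_all

lemma ends_side: "t \<in> triangles T \<Longrightarrow> points T \<inter> side k t = {p \<in> points T \<inter> t. col T p \<noteq> k}"
  by (rule side_unique(3)[OF _ side(1) side(2)])

lemma pt_in_side:
  assumes t: "t \<in> triangles T" and "j \<noteq> k"
  shows "pt j t \<in> side k t"
proof -
  have "pt j t \<in> points T \<inter> side k t"
    unfolding ends_side[OF t] using pt[OF t] \<open>j \<noteq> k\<close> by simp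
  then show ?thesis by simp
qed

lemma pt_eq_of_side_eq:
  assumes "t \<in> triangles T" "t' \<in> triangles T" "side k t = side k t'" "j \<noteq> k"
  shows "pt j t = pt j t'"
proof (rule pt_eqI[OF assms(1)])
  show "pt j t' \<in> points T" "col T (pt j t') = j" by (rule pt[OF assms(2)])+
  show "pt j t' \<in> t" using pt_in_side[OF assms(2,4)] side(2)[OF assms(1), of k] assms(3) by auto
qed

section \<open>Black and white triangles\<close>

lemma orient_cases:
  assumes t: "t \<in> triangles T"
  obtains (black) "black T t" "\<not> white T t"
      "orient T t = {(pt Red t, pt Emerald t), (pt Emerald t, pt Violet t), (pt Violet t, pt Red t)}"
    | (white) "white T t" "\<not> black T t"
      "orient T t = {(pt Red t, pt Violet t), (pt Violet t, pt Emerald t), (pt Emerald t, pt Red t)}"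
proof -
  let ?b = "{(pt Red t, pt Emerald t), (pt Emerald t, pt Violet t), (pt Violet t, pt Red t)}"
  let ?w = "{(pt Red t, pt Violet t), (pt Violet t, pt Emerald t), (pt Emerald t, pt Red t)}"
  have "\<exists>a b c. distinct [a, b, c] \<and> points T \<inter> t = {a, b, c} \<and> orient T t = {(a, b), (b, c), (c, a)}"
    using is_trinity t by (simp add: is_trinity_def is_orientation_def)
  then obtain a b c where abc: "distinct [a, b, c]" "points T \<inter> t = {a, b, c}"
    and o: "orient T t = {(a, b), (b, c), (c, a)}" by blast
  have eq: "a = pt (col T a) t" "b = pt (col T b) t" "c = pt (col T c) t"
    using abc(2) by (auto intro!: pt_col[OF t])
  have "col T a \<noteq> col T b" "col T b \<noteq> col T c" "col T c \<noteq> col T a"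
    using abc(1) eq by (metis distinct_length_2_or_more)+
  \<comment> \<open>Three colors have just two cyclic orders.\<close>
  moreover have "{(pt i t, pt j t), (pt j t, pt k t), (pt k t, pt i t)} \<in> {?b, ?w}"
    if "i \<noteq> j" "j \<noteq> k" "k \<noteq> i" for i j k
    using that by (cases i; cases j; cases k) (simp_all add: insert_commute)
  ultimately have "orient T t \<in> {?b, ?w}" unfolding o using eq by metis
  then have bw: "orient T t = ?b \<or> orient T t = ?w" by simp
  have "\<not> (black T t \<and> white T t)"
  proof
    assume bw: "black T t \<and> white T t"
    then obtain r e v where 1: "col T r = Red" "col T e = Emerald" "orient T t = {(r, e), (e, v), (v, r)}"
      unfolding black_def by blast
    obtain r' e' v' where 2: "col T r' = Red" "col T e' = Emerald" "col T v' = Violet"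
      "orient T t = {(r', v'), (v', e'), (e', r')}" using bw unfolding white_def by blast
    have "(r, e) \<in> orient T t" using 1 by simp
    then show False using 1(1,2) 2 by auto
  qed
  moreover have "black T t" if "orient T t = ?b" unfolding black_def using pt(3)[OF t] that by blast
  moreover have "white T t" if "orient T t = ?w" unfolding white_def using pt(3)[OF t] that by blast
  ultimately show thesis using bw black white by blast
qed

definition W :: "point set set" where "W = {t \<in> triangles T. white T t}"

definition Bl :: "point set set" where "Bl = {t \<in> triangles T. black T t}"

lemma W_Bl: "W \<inter> Bl = {}" "W \<union> Bl = triangles T" and W_sub: "t \<in> W \<Longrightarrow> t \<in> triangles T" and Bl_sub: "t \<in> Bl \<Longrightarrow> t \<in> triangles T"
proof -
  show "W \<inter> Bl = {}" unfolding W_def Bl_def by (auto elim: orient_cases)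
  show "W \<union> Bl = triangles T" unfolding W_def Bl_def by (auto elim: orient_cases)
qed (auto simp: W_def Bl_def)

lemma pt_inj: "\<lbrakk>t \<in> triangles T; t' \<in> triangles T\<rbrakk> \<Longrightarrow> pt i t = pt j t' \<longleftrightarrow> i = j \<and> pt i t = pt i t'"
  using pt(3)[of t i] pt(3)[of t' j] by auto

text \<open>Coherent orientations traverse the common edge in opposite directions while its ends
  keep their colors, so the cyclic orders of the colors are opposite.\<close>

lemma shared_side:
  assumes t: "t \<in> triangles T" "t' \<in> triangles T" "t \<noteq> t'" and e: "e \<in> colored_edges T k" "e \<subseteq> t" "e \<subseteq> t'"
  shows "t \<in> W \<longleftrightarrow> t' \<in> Bl"
proof -
  have s: "side k t = e" "side k t' = e" using side_eqI t e by auto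
  have eq: "pt j t = pt j t'" if "j \<noteq> k" for j using pt_eq_of_side_eq[OF t(1,2) _ that] s by simp
  have coh: "(a, b) \<in> orient T t \<longleftrightarrow> (b, a) \<in> orient T t'" if "ends T e = {a, b}" for a b
    using is_trinity t e colored_edgesD[OF e(1)] that unfolding is_trinity_def is_orientation_def by blast
  have ends: "ends T e = {pt i t, pt j t}" if "{i, j} = UNIV - {k}" for i j
  proof -
    have "{p \<in> points T \<inter> t. col T p \<noteq> k} = {pt i t, pt j t}"
    proof (intro equalityI subsetI)
      fix p assume p: "p \<in> {p \<in> points T \<inter> t. col T p \<noteq> k}"
      then have "col T p \<in> {i, j}" using that by auto
      then show "p \<in> {pt i t, pt j t}" using pt_col[OF t(1), of p] p by auto
    next
      fix p assume "p \<in> {pt i t, pt j t}"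
      moreover have "i \<noteq> k" "j \<noteq> k" using that by auto
      ultimately show "p \<in> {p \<in> points T \<inter> t. col T p \<noteq> k}" using pt[OF t(1)] by auto
    qed
    then show ?thesis using ends_side[OF t(1), of k] s by (simp add: ends_def)
  qed
  \<comment> \<open>The order of \<open>i\<close> and \<open>j\<close> is such that black triangles
    contain the directed side from color \<open>i\<close> to color \<open>j\<close>, and white ones
    its reverse.\<close>
  define i j where "i = (case k of Red \<Rightarrow> Emerald | Emerald \<Rightarrow> Violet | Violet \<Rightarrow> Red)"
    and "j = (case k of Red \<Rightarrow> Violet | Emerald \<Rightarrow> Red | Violet \<Rightarrow> Emerald)"
  have ij: "{i, j} = UNIV - {k}" "i \<noteq> k" "j \<noteq> k"
  proof -
    have "UNIV = {Red, Emerald, Violet}" using color.exhaust by auto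
    then show "{i, j} = UNIV - {k}" "i \<noteq> k" "j \<noteq> k" unfolding i_def j_def by (cases k; auto)+
  qed
  have dir: "((pt i s, pt j s) \<in> orient T s \<longleftrightarrow> s \<in> Bl) \<and> ((pt j s, pt i s) \<in> orient T s \<longleftrightarrow> s \<in> W)"
    if s: "s \<in> triangles T" for s
    using s by (cases rule: orient_cases; cases k) (simp_all add: W_def Bl_def i_def j_def pt_inj s)
  have "(pt j t, pt i t) \<in> orient T t \<longleftrightarrow> (pt i t, pt j t) \<in> orient T t'"
    by (rule coh) (use ends[OF ij(1)] in \<open>simp add: insert_commute\<close>)
  then show ?thesis using dir[OF t(1)] dir[OF t(2)] eq[OF ij(2)] eq[OF ij(3)] by simp
qed

text \<open>An edge lies in at least two triangles, and of any two distinct triangles on it exactly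
  one is white by \<open>shared_side\<close>. So it lies in exactly one triangle of each
  kind.\<close>

lemma bij_side: "bij_betw (side k) W (colored_edges T k)" "bij_betw (side k) Bl (colored_edges T k)"
proof -
  have inj: "t = t'" if "t \<in> triangles T" "t' \<in> triangles T" "side k t = side k t'" "t \<in> W \<longleftrightarrow> t' \<in> W" for t t'
  proof (rule ccontr)
    assume "t \<noteq> t'"
    have "t \<in> W \<longleftrightarrow> t' \<in> Bl"
      by (rule shared_side[of t t' "side k t" k]) (use that \<open>t \<noteq> t'\<close> side[of t k] side[of t' k] in simp_all)
    then show False using that W_Bl by blast
  qed
  have "\<exists>w\<in>W. \<exists>b\<in>Bl. side k w = e \<and> side k b = e" if e: "e \<in> colored_edges T k" for e
  proof -
    obtain t t' where t: "t \<in> triangles T" "t' \<in> triangles T" "t \<noteq> t'" "e \<subseteq> t" "e \<subseteq> t'"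
      using edge_in_two_triangles[OF colored_edgesD[OF e]] by metis
    have "side k t = e" "side k t' = e" using side_eqI t e by auto
    moreover have "t \<in> W \<longleftrightarrow> t' \<in> Bl" by (rule shared_side[OF t(1-3) e t(4,5)])
    moreover have "t \<in> W \<or> t \<in> Bl" "t' \<in> W \<or> t' \<in> Bl" using t W_Bl by auto
    ultimately show ?thesis using W_Bl by blast
  qed
  then have surj: "colored_edges T k \<subseteq> side k ` W" "colored_edges T k \<subseteq> side k ` Bl" by blast+
  show "bij_betw (side k) W (colored_edges T k)"
  proof (intro bij_betw_imageI inj_onI)
    show "t = t'" if "t \<in> W" "t' \<in> W" "side k t = side k t'" for t t'
      using inj[of t t'] that W_sub by blast
    show "side k ` W = colored_edges T k" using side(1)[OF W_sub] surj by blast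
  qed
  show "bij_betw (side k) Bl (colored_edges T k)"
  proof (intro bij_betw_imageI inj_onI)
    show "t = t'" if "t \<in> Bl" "t' \<in> Bl" "side k t = side k t'" for t t'
      using inj[of t t'] that Bl_sub W_Bl by blast
    show "side k ` Bl = colored_edges T k" using side(1)[OF Bl_sub] surj by blast
  qed
qed

definition nb :: "color \<Rightarrow> point set \<Rightarrow> point set" where
  "nb k = inv_into Bl (side k) \<circ> side k"

lemma bij_nb: "bij_betw (nb k) W Bl"
  unfolding nb_def by (rule bij_betw_trans[OF bij_side(1) bij_betw_inv_into[OF bij_side(2)]])

lemma nb_in: "w \<in> W \<Longrightarrow> nb k w \<in> Bl"
  using bij_nb by (rule bij_betw_apply)

lemma side_nb: "w \<in> W \<Longrightarrow> side k (nb k w) = side k w"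
  unfolding nb_def using bij_betw_inv_into_right[OF bij_side(2) bij_betw_apply[OF bij_side(1)]] by simp

lemma pt_nb: "w \<in> W \<Longrightarrow> j \<noteq> k \<Longrightarrow> pt j (nb k w) = pt j w"
  by (rule pt_eq_of_side_eq[where k = k]) (simp_all add: side_nb nb_in Bl_sub W_sub)

lemma nb_eqI: "\<lbrakk>w \<in> W; t \<in> Bl; side k t = side k w\<rbrakk> \<Longrightarrow> nb k w = t"
  unfolding nb_def using bij_betw_inv_into_left[OF bij_side(2), of t k] by simp

lemma nb_surj:
  assumes "t \<in> Bl"
  shows "\<exists>w\<in>W. nb k w = t"
proof -
  have "t \<in> nb k ` W" using assms bij_betw_imp_surj_on[OF bij_nb] by simp
  then show ?thesis by auto
qed

lemma finite_W: "finite W"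
  using finite_F by (simp add: W_def)

lemma W_nonempty: "W \<noteq> {}"
proof -
  have "S \<noteq> {}" by simp
  then obtain t where "t \<in> triangles T" using cover by blast
  then show ?thesis using W_Bl nb_surj by blast
qed


lemma color_point_in_triangle:
  assumes "p \<in> points T"
  shows "\<exists>w\<in>W. pt (col T p) w = p"
proof -
  have "p \<in> S" using assms P_sub by blast
  then obtain t where t: "t \<in> triangles T" "p \<in> t" using cover by blast
  then have pt: "pt (col T p) t = p" using assms by (intro pt_eqI) auto
  obtain j where j: "j \<noteq> col T p" by (metis color.distinct(1))
  show ?thesis
  proof (cases "t \<in> W")
    case False
    then have "t \<in> Bl" using t W_Bl by blast
    then obtain w where w: "w \<in> W" "nb j w = t" using nb_surj by blast
    have "pt (col T p) w = pt (col T p) (nb j w)" using pt_nb[OF w(1), of "col T p" j] j by simp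
    also have "\<dots> = p" using pt w by simp
    finally show ?thesis using w(1) by blast
  qed (use pt in blast)
qed

lemma color_class_eq: "color_class T k = pt k ` W"
proof (intro equalityI subsetI)
  fix p assume "p \<in> color_class T k"
  then show "p \<in> pt k ` W" using color_point_in_triangle[of p] by (auto simp: color_class_def)
next
  fix p assume "p \<in> pt k ` W"
  then obtain w where "w \<in> W" "p = pt k w" by blast
  then show "p \<in> color_class T k" using pt[OF W_sub] by (simp add: color_class_def)
qed

text \<open>The relation is the graph of a permutation of a finite set. The elements reachable from
  \<open>y\<close> are mapped injectively, hence onto, so they include the predecessor of
  \<open>y\<close>.\<close>

lemma rtrancl_sym_of_bij:
  assumes fin: "finite A" and p: "bij_betw p A B" and q: "bij_betw q A B"
    and xy: "(x, y) \<in> {(x, y). x \<in> A \<and> y \<in> A \<and> p x = q y}\<^sup>*"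
  shows "(y, x) \<in> {(x, y). x \<in> A \<and> y \<in> A \<and> p x = q y}\<^sup>*"
proof -
  let ?r = "{(x, y). x \<in> A \<and> y \<in> A \<and> p x = q y}"
  define s where "s = inv_into A q \<circ> p"
  have s: "bij_betw s A A" unfolding s_def by (rule bij_betw_trans[OF p bij_betw_inv_into[OF q]])
  have r_s: "(x, y) \<in> ?r \<longleftrightarrow> x \<in> A \<and> y = s x" for x y
    using bij_betw_inv_into_left[OF q] bij_betw_inv_into_right[OF q] bij_betw_apply[OF p]
      bij_betw_apply[OF bij_betw_inv_into[OF q]] by (auto simp: s_def)
  have "(y, x) \<in> ?r\<^sup>*" if xy: "(x, y) \<in> ?r" for x y
  proof -
    define Z where "Z = {z \<in> A. (y, z) \<in> ?r\<^sup>*}"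
    have xA: "x \<in> A" "y = s x" using xy r_s by blast+
    have "s z \<in> Z" if "z \<in> Z" for z
    proof -
      have "(z, s z) \<in> ?r" using r_s that by (simp add: Z_def)
      then have "(y, s z) \<in> ?r\<^sup>*" "s z \<in> A" using that by (auto simp: Z_def intro: rtrancl_into_rtrancl)
      then show ?thesis by (simp add: Z_def)
    qed
    then have "s ` Z \<subseteq> Z" by blast
    moreover have "inj_on s Z" using s by (auto simp: bij_betw_def Z_def inj_on_def)
    moreover have "finite Z" using fin by (simp add: Z_def)
    ultimately have "s ` Z = Z" by (simp add: endo_inj_surj)
    moreover have "y \<in> Z" using xy by (simp add: Z_def)
    ultimately obtain z where z: "z \<in> Z" "s z = y" by (metis imageE)
    then have "z = x" using s xA by (auto simp: Z_def bij_betw_def inj_on_def)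
    then show ?thesis using z by (simp add: Z_def)
  qed
  with xy show ?thesis by (induction rule: rtrancl_induct) (auto intro: rtrancl_trans)
qed

section \<open>Links, connectedness and cohomology in terms of colors\<close>

lemma side_cases:
  assumes "t \<in> triangles T" "e \<in> edges T" "e \<subseteq> t"
  obtains k where "e = side k t"
  using side_unique(2)[OF assms] side_eqI[OF assms(1) _ assms(3)] by blast

lemma point_in_side_imp:
  assumes t: "t \<in> triangles T" and p: "p \<in> points T" "p \<in> side k t"
  shows "col T p \<noteq> k"
  using ends_side[OF t, of k] p by blast

lemma neighbour_across_side:
  assumes t: "t \<in> triangles T" "t' \<in> triangles T" "t \<noteq> t'" and sub: "side k t \<subseteq> t'"
  shows "t \<in> W \<and> t' = nb k t \<or> t' \<in> W \<and> t = nb k t'"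
proof -
  have s: "side k t' = side k t" using side_eqI[OF t(2) side(1)[OF t(1)] sub] .
  have "t \<in> W \<longleftrightarrow> t' \<in> Bl" by (rule shared_side[OF t side(1)[OF t(1)] side(2)[OF t(1)] sub])
  then show ?thesis using nb_eqI[of t t' k] nb_eqI[of t' t k] s t W_Bl by auto
qed

text \<open>\<open>link_connected\<close> is applied to the white triangles reachable from
  \<open>w\<close> and their black neighbours across the sides of colors \<open>i\<close> and
  \<open>j\<close>, which are the sides through the point. Returning from a black triangle to either
  white neighbour uses that reachability is symmetric.\<close>

lemma link:
  assumes ijk: "i \<noteq> j" "j \<noteq> k" "k \<noteq> i" and w: "w \<in> W" "w' \<in> W" "pt k w = pt k w'"
  shows "(w, w') \<in> {(x, y). x \<in> W \<and> y \<in> W \<and> nb i x = nb j y}\<^sup>*"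
proof -
  let ?r = "{(x, y). x \<in> W \<and> y \<in> W \<and> nb i x = nb j y}"
  define p where "p = pt k w"
  have p: "p \<in> points T" "p \<in> w" "col T p = k" using pt[OF W_sub[OF w(1)]] by (simp_all add: p_def)
  have rev: "(y, x) \<in> ?r\<^sup>*" if "(x, y) \<in> ?r" for x y
    using rtrancl_sym_of_bij[OF finite_W bij_nb bij_nb r_into_rtrancl[OF that]] .
  define K where "K = {t \<in> triangles T. p \<in> t \<and> (\<exists>x\<in>W. (w, x) \<in> ?r\<^sup>* \<and> (t = x \<or> t = nb i x \<or> t = nb j x))}"
  have j_i: "\<exists>y\<in>W. (w, y) \<in> ?r\<^sup>* \<and> nb i y = nb j x" if x: "x \<in> W" "(w, x) \<in> ?r\<^sup>*" for x
  proof -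
    obtain y where y: "y \<in> W" "nb i y = nb j x" using nb_surj[OF nb_in[OF x(1)]] by blast
    then have "(y, x) \<in> ?r" using x by simp
    from rev[OF this] show ?thesis using x y by (meson rtrancl_trans)
  qed
  have i_j: "\<exists>y\<in>W. (w, y) \<in> ?r\<^sup>* \<and> nb j y = nb i x" if x: "x \<in> W" "(w, x) \<in> ?r\<^sup>*" for x
  proof -
    obtain y where y: "y \<in> W" "nb j y = nb i x" using nb_surj[OF nb_in[OF x(1)]] by blast
    then have "(x, y) \<in> ?r" using x by simp
    then show ?thesis using x y by (meson rtrancl_into_rtrancl)
  qed
  have "K = {t \<in> triangles T. p \<in> t}"
  proof (rule link_connected[OF p(1)])
    show "K \<subseteq> {t \<in> triangles T. p \<in> t}" by (auto simp: K_def)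
    have "w \<in> K" using w W_sub p by (auto simp: K_def)
    then show "K \<noteq> {}" by blast
    fix t t' e assume t: "t \<in> K" "t' \<in> triangles T" and e: "e \<in> edges T" "p \<in> e" "e \<subseteq> t" "e \<subseteq> t'"
    have tT: "t \<in> triangles T" using t by (simp add: K_def)
    have pt': "p \<in> t'" using e by blast
    obtain l where l: "e = side l t" by (rule side_cases[OF tT e(1,3)])
    have "l \<noteq> k" using point_in_side_imp[OF tT p(1), of l] e(2) l p(3) by blast
    then have lij: "l = i \<or> l = j" using ijk by (cases i; cases j; cases k; cases l) auto
    obtain x where x: "x \<in> W" "(w, x) \<in> ?r\<^sup>*" "t = x \<or> t = nb i x \<or> t = nb j x" using t by (auto simp: K_def)
    show "t' \<in> K"
    proof (cases "t = t'")
      case False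
      then consider "t \<in> W" "t' = nb l t" | "t' \<in> W" "t = nb l t'"
        using neighbour_across_side[OF tT t(2) False, of l] e l by blast
      then show ?thesis
      proof cases
        case 1
        then have "t = x" using x nb_in W_Bl by blast
        then show ?thesis using 1 x lij t(2) pt' by (auto simp: K_def)
      next
        case 2
        then have "t \<in> Bl" using nb_in by blast
        then have "t = nb i x \<or> t = nb j x" using x W_Bl by blast
        then have "\<exists>y\<in>W. (w, y) \<in> ?r\<^sup>* \<and> nb l y = t"
          using lij x(1,2) i_j[OF x(1,2)] j_i[OF x(1,2)] by blast
        then obtain y where y: "y \<in> W" "(w, y) \<in> ?r\<^sup>*" "nb l y = t" by blast
        then have "y = t'" using bij_nb[of l] 2 by (auto simp: bij_betw_def inj_on_def)
        then show ?thesis using y t(2) pt' by (auto simp: K_def)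
      qed
    qed (use t in simp)
  qed
  moreover have "p \<in> w'" using pt(2)[OF W_sub[OF w(2)], of k] w(3) by (simp add: p_def)
  ultimately have "w' \<in> K" using W_sub[OF w(2)] by blast
  then obtain x where "(w, x) \<in> ?r\<^sup>*" "x \<in> W" "w' = x \<or> w' = nb i x \<or> w' = nb j x" by (auto simp: K_def)
  then show ?thesis using w(2) nb_in W_Bl by blast
qed

lemma connected_by_points:
  assumes w: "w \<in> W" "w' \<in> W"
  shows "(w, w') \<in> {(x, y). x \<in> W \<and> y \<in> W \<and> (\<exists>k. pt k x = pt k y)}\<^sup>*"
proof -
  let ?r = "{(x, y). x \<in> W \<and> y \<in> W \<and> (\<exists>k. pt k x = pt k y)}"
  define K where "K = {t \<in> triangles T. \<exists>x\<in>W. \<exists>k. (w, x) \<in> ?r\<^sup>* \<and> pt k x = pt k t}"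
  have "K = triangles T"
  proof (rule triangles_connected)
    show "K \<subseteq> triangles T" by (auto simp: K_def)
    have "w \<in> K" using w W_sub by (auto simp: K_def)
    then show "K \<noteq> {}" by blast
    fix t t' assume t: "t \<in> K" "t' \<in> triangles T" "points T \<inter> t \<inter> t' \<noteq> {}"
    then obtain p where p: "p \<in> points T" "p \<in> t" "p \<in> t'" by blast
    obtain x k where tT: "t \<in> triangles T" and x: "x \<in> W" "(w, x) \<in> ?r\<^sup>*" "pt k x = pt k t"
      using t by (auto simp: K_def)
    have pj: "pt (col T p) t = p" "pt (col T p) t' = p" using pt_eqI p tT t(2) by simp_all
    obtain y where y: "y \<in> W" "pt k y = pt k t" "pt (col T p) y = pt (col T p) t"
    proof (cases "t \<in> W")
      case False
      then have "t \<in> Bl" using tT W_Bl by blast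
      \<comment> \<open>Crossing a side whose color differs from \<open>k\<close> and
        \<open>col T p\<close> keeps the points of both these colors.\<close>
      obtain i where i: "i \<noteq> k" "i \<noteq> col T p" by (metis color.distinct(1,3,5))
      obtain y where "y \<in> W" "nb i y = t" using nb_surj[OF \<open>t \<in> Bl\<close>] by blast
      then show thesis using that[of y] pt_nb[of y _ i] i by metis
    qed (use that in blast)
    then have "pt k x = pt k y" using x(3) by simp
    then have "(x, y) \<in> ?r" using x(1) y(1) by blast
    then have "(w, y) \<in> ?r\<^sup>*" using x(2) by (simp add: rtrancl_into_rtrancl)
    moreover have "pt (col T p) y = pt (col T p) t'" using y(3) pj by simp
    ultimately show "t' \<in> K" using y(1) t(2) unfolding K_def by blast
  qed
  then have "w' \<in> K" using w W_sub by blast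
  then obtain x k where x: "(w, x) \<in> ?r\<^sup>*" "x \<in> W" "pt k x = pt k w'" by (auto simp: K_def)
  then have "(x, w') \<in> ?r" using w by blast
  with x(1) show ?thesis by (rule rtrancl_into_rtrancl)
qed

lemma triangle_cohomology:
  fixes f g h :: "point set \<Rightarrow> int"
  assumes fg: "\<And>w. w \<in> W \<Longrightarrow> f w - g w = f (nb Violet w) - g (nb Violet w)"
    and gh: "\<And>w. w \<in> W \<Longrightarrow> g w - h w = g (nb Red w) - h (nb Red w)"
    and hf: "\<And>w. w \<in> W \<Longrightarrow> h w - f w = h (nb Emerald w) - f (nb Emerald w)"
  shows "\<exists>u :: point \<Rightarrow> int. \<forall>w\<in>W. u (pt Red w) - u (pt Emerald w) = f w - g w \<and>
    u (pt Emerald w) - u (pt Violet w) = g w - h w"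
proof -
  define A where "A t p = (case col T p of Red \<Rightarrow> f t | Emerald \<Rightarrow> g t | Violet \<Rightarrow> h t)" for t p
  have A: "A w p - A w q = A (nb k w) p - A (nb k w) q" if "w \<in> W" "col T p \<noteq> k" "col T q \<noteq> k" for w p q k
    using that fg[OF that(1)] gh[OF that(1)] hf[OF that(1)]
    by (cases k; cases "col T p"; cases "col T q") (simp_all add: A_def)
  have "\<exists>u :: point \<Rightarrow> int. \<forall>t\<in>triangles T. \<forall>p\<in>points T \<inter> t. \<forall>q\<in>points T \<inter> t. u p - u q = A t p - A t q"
  proof (rule cohomology)
    fix t t' e p q
    assume t: "t \<in> triangles T" "t' \<in> triangles T" and e: "e \<in> edges T" "e \<subseteq> t" "e \<subseteq> t'"
      and pq: "p \<in> points T \<inter> e" "q \<in> points T \<inter> e"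
    obtain k where k: "e = side k t" by (rule side_cases[OF t(1) e(1,2)])
    have col: "col T p \<noteq> k" "col T q \<noteq> k" using point_in_side_imp[OF t(1)] pq k by auto
    show "A t p - A t q = A t' p - A t' q"
    proof (cases "t = t'")
      case False
      then show ?thesis using neighbour_across_side[OF t False, of k] e(3) k A[OF _ col] by metis
    qed simp
  qed
  then obtain u :: "point \<Rightarrow> int" where
    u: "\<forall>t\<in>triangles T. \<forall>p\<in>points T \<inter> t. \<forall>q\<in>points T \<inter> t. u p - u q = A t p - A t q" ..
  have "u (pt i w) - u (pt j w) = A w (pt i w) - A w (pt j w)" if "w \<in> W" for w i j
    using u W_sub[OF that] pt[OF W_sub[OF that]] by simp
  then show ?thesis using pt(3)[OF W_sub] by (intro exI[of _ u]) (simp add: A_def)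
qed

lemma sphere_map_RGV: "sphere_map W Bl (pt Red) (pt Emerald) (pt Violet) (nb Red) (nb Emerald) (nb Violet)"
proof
  show "finite W" "W \<noteq> {}" "W \<inter> Bl = {}" by (rule finite_W W_nonempty W_Bl)+
  show "bij_betw (nb Red) W Bl" "bij_betw (nb Emerald) W Bl" "bij_betw (nb Violet) W Bl" by (rule bij_nb)+
next
  fix w assume w: "w \<in> W"
  show "pt Emerald (nb Red w) = pt Emerald w" "pt Violet (nb Red w) = pt Violet w"
    "pt Red (nb Emerald w) = pt Red w" "pt Violet (nb Emerald w) = pt Violet w"
    "pt Red (nb Violet w) = pt Red w" "pt Emerald (nb Violet w) = pt Emerald w" by (rule pt_nb[OF w], simp)+
next
  fix w w' assume w: "w \<in> W" "w' \<in> W"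
  show "(w, w') \<in> {(x, y). x \<in> W \<and> y \<in> W \<and> nb Violet x = nb Emerald y}\<^sup>*" if "pt Red w = pt Red w'"
    by (rule link[OF _ _ _ w that]) simp_all
  show "(w, w') \<in> {(x, y). x \<in> W \<and> y \<in> W \<and> nb Red x = nb Violet y}\<^sup>*" if "pt Emerald w = pt Emerald w'"
    by (rule link[OF _ _ _ w that]) simp_all
  show "(w, w') \<in> {(x, y). x \<in> W \<and> y \<in> W \<and> nb Emerald x = nb Red y}\<^sup>*" if "pt Violet w = pt Violet w'"
    by (rule link[OF _ _ _ w that]) simp_all
  have "(\<exists>k. pt k x = pt k y) \<longleftrightarrow> pt Red x = pt Red y \<or> pt Emerald x = pt Emerald y \<or> pt Violet x = pt Violet y" for x y
    by (metis color.exhaust)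
  then show "(w, w') \<in> {(x, y). x \<in> W \<and> y \<in> W \<and> (pt Red x = pt Red y \<or> pt Emerald x = pt Emerald y \<or> pt Violet x = pt Violet y)}\<^sup>*"
    using connected_by_points[OF w] by simp
qed (rule triangle_cohomology)

lemma sphere_map_colors:
  assumes "i \<noteq> j" "j \<noteq> k" "k \<noteq> i"
  shows "sphere_map W Bl (pt i) (pt j) (pt k) (nb i) (nb j) (nb k)"
proof -
  note 1 = sphere_map_RGV
  note 2 = sphere_map.sphere_map_rotate[OF 1]
  note 3 = sphere_map.sphere_map_rotate[OF 2]
  note s = 1 2 3 sphere_map.sphere_map_swap[OF 1] sphere_map.sphere_map_swap[OF 2] sphere_map.sphere_map_swap[OF 3]
  show ?thesis using assms s by (cases i; cases j; cases k) simp_all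
qed

section \<open>Dual digraphs and hypergraphs of the trinity\<close>

lemma head_tail_dual:
  assumes w: "w \<in> W"
  shows "head (dual_digraph T k) (side k w) = pt k w" "tail (dual_digraph T k) (side k w) = pt k (nb k w)"
proof -
  have *: "(THE p. p \<in> color_class T k \<and> (\<exists>t\<in>triangles T. Q t \<and> side k w \<subseteq> t \<and> p \<in> t)) = pt k s"
    if s: "s \<in> triangles T" "Q s" "side k w \<subseteq> s"
      and unique: "\<And>t. \<lbrakk>t \<in> triangles T; Q t; side k w \<subseteq> t\<rbrakk> \<Longrightarrow> t = s" for Q s
  proof (rule the_equality)
    show "pt k s \<in> color_class T k \<and> (\<exists>t\<in>triangles T. Q t \<and> side k w \<subseteq> t \<and> pt k s \<in> t)"
      using s pt[OF s(1)] by (auto simp: color_class_def)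
    fix p assume "p \<in> color_class T k \<and> (\<exists>t\<in>triangles T. Q t \<and> side k w \<subseteq> t \<and> p \<in> t)"
    then have "p \<in> points T" "col T p = k" "p \<in> s" using unique by (auto simp: color_class_def)
    then show "p = pt k s" using pt_eqI[OF s(1)] by simp
  qed
  have eq: "side k t = side k w" if "t \<in> triangles T" "side k w \<subseteq> t" for t
    using side_eqI[OF that(1) side(1)[OF W_sub[OF w]] that(2)] .
  have "white T w" using w by (simp add: W_def)
  show "head (dual_digraph T k) (side k w) = pt k w"
    unfolding dual_digraph_def pre_digraph.simps
  proof (rule *[of w "white T", OF W_sub[OF w] \<open>white T w\<close> side(2)[OF W_sub[OF w]]])
    fix t assume t: "t \<in> triangles T" "white T t" "side k w \<subseteq> t"
    then have "t \<in> W" by (simp add: W_def)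
    then show "t = w" using bij_side(1)[of k] eq[OF t(1,3)] w by (auto simp: bij_betw_def inj_on_def)
  qed
  have b: "nb k w \<in> Bl" "nb k w \<in> triangles T" "black T (nb k w)" using nb_in[OF w, of k] by (auto simp: Bl_def)
  show "tail (dual_digraph T k) (side k w) = pt k (nb k w)"
    unfolding dual_digraph_def pre_digraph.simps
  proof (rule *[of "nb k w" "black T", OF b(2,3)])
    show "side k w \<subseteq> nb k w" using side(2)[OF b(2), of k] side_nb[OF w] by simp
    fix t assume t: "t \<in> triangles T" "black T t" "side k w \<subseteq> t"
    then have "t \<in> Bl" by (simp add: Bl_def)
    then show "t = nb k w" using nb_eqI[OF w _ eq[OF t(1,3)]] by simp
  qed
qed

lemma arborescence_number_dual:
  assumes "i \<noteq> j" "j \<noteq> k" "k \<noteq> i"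
  shows "arborescence_number (dual_digraph T i) = card (profiles W (pt i) (pt j))"
proof -
  interpret sphere_map W Bl "pt i" "pt j" "pt k" "nb i" "nb j" "nb k" by (rule sphere_map_colors[OF assms])
  show ?thesis
  proof (rule arborescence_number_eq_card_profiles)
    show "verts (dual_digraph T i) = pt i ` W" by (simp add: dual_digraph_def color_class_eq)
    show "arcs (dual_digraph T i) = side i ` W" using bij_side(1)[of i] by (simp add: dual_digraph_def bij_betw_def)
    show "inj_on (side i) W" using bij_side(1)[of i] by (simp add: bij_betw_def)
  qed (rule head_tail_dual, assumption)+
qed

lemma represents_induced:
  assumes "i \<noteq> j" "j \<noteq> k" "k \<noteq> i"
  shows "represents (induced_hypergraph (color_graph T k) (color_class T i) (color_class T j)) W (pt i) (pt j)"
proof -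
  have "(\<exists>e\<in>colored_edges T k. ends T e = {p, q}) \<longleftrightarrow> (\<exists>w\<in>W. pt i w = p \<and> pt j w = q)"
    if p: "p \<in> color_class T i" and q: "q \<in> color_class T j" for p q
  proof
    assume "\<exists>e\<in>colored_edges T k. ends T e = {p, q}"
    then obtain e where e: "e \<in> colored_edges T k" "ends T e = {p, q}" by blast
    then have "e \<in> side k ` W" using bij_side(1)[of k] by (simp add: bij_betw_def)
    then obtain w where w: "w \<in> W" "ends T (side k w) = {p, q}" using e by auto
    then have "p \<in> w" "q \<in> w" using side(2)[OF W_sub[OF w(1)], of k] by (auto simp: ends_def)
    then have "pt i w = p" "pt j w = q" using p q W_sub[OF w(1)] by (auto simp: color_class_def intro: pt_eqI)
    then show "\<exists>w\<in>W. pt i w = p \<and> pt j w = q" using w by blast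
  next
    assume "\<exists>w\<in>W. pt i w = p \<and> pt j w = q"
    then obtain w where w: "w \<in> W" "pt i w = p" "pt j w = q" by blast
    note wT = W_sub[OF w(1)]
    have "ends T (side k w) = {p, q}"
    proof (intro equalityI subsetI)
      fix x assume "x \<in> ends T (side k w)"
      then have x: "x \<in> points T" "x \<in> w" "col T x \<noteq> k" using ends_side[OF wT, of k] by (auto simp: ends_def)
      then have "col T x = i \<or> col T x = j" using assms by (cases i; cases j; cases k; cases "col T x") auto
      then show "x \<in> {p, q}" using pt_col[OF wT x(1,2)] w by auto
    next
      fix x assume "x \<in> {p, q}"
      then show "x \<in> ends T (side k w)"
        using w(2,3) pt_in_side[OF wT, of i k] pt_in_side[OF wT, of j k] pt(1)[OF wT] assms by (auto simp: ends_def)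
    qed
    then show "\<exists>e\<in>colored_edges T k. ends T e = {p, q}" using side(1)[OF wT] by blast
  qed
  then show ?thesis by (simp add: represents_def induced_hypergraph_def color_graph_def color_class_eq)
qed

text \<open>Both arborescence numbers count profiles with hyperedges of the remaining color
  \<open>j\<close>, and these correspond under complements of trees. Tutte's Tree Trinity Theorem is
  thereby proved along with the count of hypertrees.\<close>

lemma arborescence_number_eq:
  assumes "i \<noteq> j" "j \<noteq> k" "k \<noteq> i"
  shows "arborescence_number (dual_digraph T k) = arborescence_number (dual_digraph T i)"
proof -
  interpret sphere_map W Bl "pt i" "pt j" "pt k" "nb i" "nb j" "nb k" by (rule sphere_map_colors[OF assms])
  show ?thesis using card_profiles_eq arborescence_number_dual[OF assms] arborescence_number_dual[of k j i] assms by simp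
qed

lemma trinity_arborescence_number_eq: "trinity_arborescence_number T = arborescence_number (dual_digraph T k)"
proof -
  have "arborescence_number (dual_digraph T c) = arborescence_number (dual_digraph T k)" for c
  proof (cases "c = k")
    case False
    obtain j where "j \<noteq> c" "j \<noteq> k" by (metis color.distinct(1,3,5))
    then show ?thesis using arborescence_number_eq[of k j c] False by simp
  qed simp
  then show ?thesis unfolding trinity_arborescence_number_def by (intro the_equality) auto
qed

lemma card_hypertrees:
  assumes "i \<noteq> j" "j \<noteq> k" "k \<noteq> i"
  shows "card (hypertrees (induced_hypergraph (color_graph T k) (color_class T i) (color_class T j))) =
    trinity_arborescence_number T"
  using hypertrees_eq_profiles[OF represents_induced[OF assms] finite_W W_nonempty] arborescence_number_dual[OF assms]
    trinity_arborescence_number_eq[of i] by simp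

end

theorem corollary10p3:
  fixes T :: trinity
  assumes "is_trinity T"
  defines "R \<equiv> color_class T Red" and "E \<equiv> color_class T Emerald" and "V \<equiv> color_class T Violet"
  shows "card (hypertrees (induced_hypergraph (color_graph T Red) V E)) = trinity_arborescence_number T \<and>
         card (hypertrees (induced_hypergraph (color_graph T Red) E V)) = trinity_arborescence_number T \<and>
         card (hypertrees (induced_hypergraph (color_graph T Violet) R E)) = trinity_arborescence_number T \<and>
         card (hypertrees (induced_hypergraph (color_graph T Violet) E R)) = trinity_arborescence_number T \<and>
         card (hypertrees (induced_hypergraph (color_graph T Emerald) R V)) = trinity_arborescence_number T \<and>
         card (hypertrees (induced_hypergraph (color_graph T Emerald) V R)) = trinity_arborescence_number T"
proof -
  interpret trinity_map T by unfold_locales (rule assms(1))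
  show ?thesis unfolding R_def E_def V_def
    by (intro conjI card_hypertrees) simp_all
qed

end
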